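(* The monochromatic complete functions $S_n^{(i)}=S_{n\cdot\mathbf{e}_i}$ ($n\ge 1$, $i\in C$) generate a Hopf subalgebra $\mathbf{MR}^{(\ell)}$ of $\mathbf{Sym}^{(\ell)}$. If $C=\mathbb{Z}/\ell\mathbb{Z}$, this Hopf algebra, with the internal product $*$ of $\mathbf{Sym}^{(\ell)}$ restricted to it, is isomorphic to the Mantaci–Reutenauer descent algebra of the wreath products $\mathfrak{S}_n^{(\ell)}=(\mathbb{Z}/\ell\mathbb{Z})\wr\mathfrak{S}_n$.
   Context: Let $C$ be a set of $\ell$ colors. $\mathbf{Sym}^{(\ell)}$ is the free associative algebra on symbols $S_{\mathbf{n}}$, $\mathbf{n}\in\mathbb{N}^\ell\setminus\{0\}$ (with $S_{\mathbf{0}}=1$; coordinates are indexed by $C$), with Hopf structure $\Delta S_{\mathbf{n}}=\sum_{\mathbf{i}+\mathbf{j}=\mathbf{n}}S_{\mathbf{i}}\otimes S_{\mathbf{j}}$ and basis $S^{\mathbf{I}}=S_{\mathbf{i}_1}\cdots S_{\mathbf{i}_m}$, where $\mathbf{I}=(\mathbf{i}_1,\ldots,\mathbf{i}_m)$ runs over finite sequences of nonzero vectors of $\mathbb{N}^\ell$; $S_{\mathbf{n}}$ has degree $|\mathbf{n}|=\sum n_i$. $\mathbf{e}_i$ is the canonical basis of $\mathbb{N}^\ell$. Internal product (for $C=\mathbb{Z}/\ell\mathbb{Z}$): let $M_{\mathbf{I}}(\mathbb{X})=\sum_{j_1<\cdots<j_m}\prod_{k}\prod_{c\in C}(x_{j_k}^{(c)})^{(\mathbf{i}_k)_c}$,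 which span the algebra $QSym^{(\ell)}$; let $\mathbb{X}\times_C\mathbb{Y}$ be the alphabet with variables $t_{rs}^{(\gamma)}=\sum_{\alpha+\beta=\gamma}x_r^{(\alpha)}y_s^{(\beta)}$, pairs $(r,s)$ ordered lexicographically, and $\delta(F)=F(\mathbb{X}\times_C\mathbb{Y})$. Then the coefficient of $S^{\mathbf{K}}$ in $S^{\mathbf{I}}*S^{\mathbf{J}}$ is the coefficient of $M_{\mathbf{I}}\otimes M_{\mathbf{J}}$ in $\delta(M_{\mathbf{K}})$. Mantaci–Reutenauer algebra: the wreath product $\mathfrak{S}_n^{(\ell)}=(\mathbb{Z}/\ell\mathbb{Z})\wr\mathfrak{S}_n$ consists of pairs $(\sigma;c_1,\ldots,c_n)$ with product $(\sigma;c)(\tau;d)=(\sigma\tau;c_{\tau(1)}+d_1,\ldots,c_{\tau(n)}+d_n)$. For a colored composition $(I,u)=((i_1,\ldots,i_m),(u_1,\ldots,u_m))$ of $n$ (a composition $I$ of $n$ and colors $u_k$), cut $\{1,\ldots,n\}$ into consecutive blocks of lengths $i_1,\ldots,i_m$ and let $B_{(I,u)}$ be the sum in the group algebra of all $(\sigma;c)$ such that, on the $k$-th block, $c$ is constant equal to $u_k$ and $\sigma$ is increasing. The span of the $B_{(I,u)}$, over colored compositions of $n$, is a subalgebra of the group algebra of $\mathfrak{S}_n^{(\ell)}$, the Mantaci–Reutenauer descent algebra; as internal product on it one takes the opposite of the group algebra multiplication (products of elements of different degrees being $0$). The direct sum over $n$ is a Hopf algebra: it is the free associative algebra on the $B_n^{(i)}=B_{((n),(i))}$,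 with outer product $B_{(I,u)}B_{(J,v)}=B_{(I\cdot J,u\cdot v)}$ (concatenation) and coproduct $\Delta B_n^{(i)}=\sum_{p+q=n}B_p^{(i)}\otimes B_q^{(i)}$ (with $B_0^{(i)}=1$). *)

theory Defs
  imports
    Complex_Main
    "HOL.Hull"
    "HOL-Library.Poly_Mapping"
    "HOL-Library.Product_Plus"
    "HOL-Library.Cardinality"
    "HOL-Combinatorics.Permutations"
    "HOL-Algebra.Elementary_Groups"
begin

section \<open>Vector spaces with a basis, tensors\<close>

text \<open>\<open>'b \<Rightarrow>\<^sub>0 'k\<close> is the \<open>'k\<close>-vector space with basis \<open>'b\<close>. When \<open>'b\<close> is a monoid, the
  product of \<open>Poly_Mapping\<close> makes it the monoid algebra.\<close>

definition scl :: "'k::field \<Rightarrow> ('b \<Rightarrow>\<^sub>0 'k) \<Rightarrow> ('b \<Rightarrow>\<^sub>0 'k)" where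
  "scl c x = Poly_Mapping.map ((*) c) x"

lemma lookup_scl [simp]: "Poly_Mapping.lookup (scl c x) b = c * Poly_Mapping.lookup x b"
  unfolding scl_def by (cases "c = 0") (auto simp: Poly_Mapping.map.rep_eq when_def)

global_interpretation pm: vector_space "scl :: 'k::field \<Rightarrow> ('b \<Rightarrow>\<^sub>0 'k) \<Rightarrow> ('b \<Rightarrow>\<^sub>0 'k)"
  by unfold_locales (auto intro!: poly_mapping_eqI simp: lookup_add algebra_simps)

definition linear_on :: "('b \<Rightarrow>\<^sub>0 'k::field) set \<Rightarrow> ('k \<Rightarrow> 'v \<Rightarrow> 'v::ab_group_add)
    \<Rightarrow> (('b \<Rightarrow>\<^sub>0 'k) \<Rightarrow> 'v) \<Rightarrow> bool" where
  "linear_on V s f \<longleftrightarrow> (\<forall>x\<in>V. \<forall>y\<in>V. f (x + y) = f x + f y) \<and> (\<forall>c. \<forall>x\<in>V. f (scl c x) = s c (f x))"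

definition lin_extend :: "('b \<Rightarrow> ('d \<Rightarrow>\<^sub>0 'k::field)) \<Rightarrow> ('b \<Rightarrow>\<^sub>0 'k) \<Rightarrow> ('d \<Rightarrow>\<^sub>0 'k)" where
  "lin_extend \<phi> x = (\<Sum>b\<in>Poly_Mapping.keys x. scl (Poly_Mapping.lookup x b) (\<phi> b))"

text \<open>The tensor product of \<open>'b \<Rightarrow>\<^sub>0 'k\<close> and \<open>'d \<Rightarrow>\<^sub>0 'k\<close> is \<open>('b \<times> 'd) \<Rightarrow>\<^sub>0 'k\<close>.\<close>

definition tens :: "('b \<Rightarrow>\<^sub>0 'k::field) \<Rightarrow> ('d \<Rightarrow>\<^sub>0 'k) \<Rightarrow> ('b \<times> 'd \<Rightarrow>\<^sub>0 'k)" where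
  "tens x y = (\<Sum>a\<in>Poly_Mapping.keys x. \<Sum>b\<in>Poly_Mapping.keys y. Poly_Mapping.single (a, b) (Poly_Mapping.lookup x a * Poly_Mapping.lookup y b))"

definition tensor_space :: "('b \<Rightarrow>\<^sub>0 'k::field) set \<Rightarrow> ('d \<Rightarrow>\<^sub>0 'k) set \<Rightarrow> ('b \<times> 'd \<Rightarrow>\<^sub>0 'k) set" where
  "tensor_space V W = pm.span {tens x y | x y. x \<in> V \<and> y \<in> W}"

text \<open>The map \<open>V \<otimes> W \<rightarrow> 'v\<close> induced by a map \<open>h\<close> that is bilinear on \<open>V \<times> W\<close>. For such \<open>h\<close> the value
  does not depend on the chosen representation of \<open>t \<in> V \<otimes> W\<close> as a sum of pure tensors.\<close>

definition tensor_lift :: "('b \<Rightarrow>\<^sub>0 'k::field) set \<Rightarrow> ('d \<Rightarrow>\<^sub>0 'k) set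
    \<Rightarrow> (('b \<Rightarrow>\<^sub>0 'k) \<Rightarrow> ('d \<Rightarrow>\<^sub>0 'k) \<Rightarrow> 'v::comm_monoid_add) \<Rightarrow> ('b \<times> 'd \<Rightarrow>\<^sub>0 'k) \<Rightarrow> 'v" where
  "tensor_lift V W h t =
    (let xs = (SOME xs. set xs \<subseteq> V \<times> W \<and> t = (\<Sum>(x, y)\<leftarrow>xs. tens x y))
     in \<Sum>(x, y)\<leftarrow>xs. h x y)"

definition tensor_mult :: "('b \<Rightarrow>\<^sub>0 'k::field) set
    \<Rightarrow> (('b \<Rightarrow>\<^sub>0 'k) \<Rightarrow> ('b \<Rightarrow>\<^sub>0 'k) \<Rightarrow> ('b \<Rightarrow>\<^sub>0 'k))
    \<Rightarrow> ('b \<times> 'b \<Rightarrow>\<^sub>0 'k) \<Rightarrow> ('b \<times> 'b \<Rightarrow>\<^sub>0 'k) \<Rightarrow> ('b \<times> 'b \<Rightarrow>\<^sub>0 'k)" where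
  "tensor_mult V m t u =
    tensor_lift V V (\<lambda>a b. tensor_lift V V (\<lambda>c d. tens (m a c) (m b d)) u) t"


section \<open>Hopf algebras\<close>

text \<open>Only the values of the operations on the carrier are meaningful.\<close>

record (overloaded) ('b, 'k) hopf =
  hcarrier :: "('b \<Rightarrow>\<^sub>0 'k::field) set"
  hmult :: "('b \<Rightarrow>\<^sub>0 'k) \<Rightarrow> ('b \<Rightarrow>\<^sub>0 'k) \<Rightarrow> ('b \<Rightarrow>\<^sub>0 'k)"
  hone :: "'b \<Rightarrow>\<^sub>0 'k"
  hcomult :: "('b \<Rightarrow>\<^sub>0 'k) \<Rightarrow> ('b \<times> 'b \<Rightarrow>\<^sub>0 'k)"
  hcounit :: "('b \<Rightarrow>\<^sub>0 'k) \<Rightarrow> 'k"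

definition is_subalgebra :: "('b, 'k::field) hopf \<Rightarrow> ('b \<Rightarrow>\<^sub>0 'k) set \<Rightarrow> bool" where
  "is_subalgebra H A \<longleftrightarrow> A \<subseteq> hcarrier H \<and> pm.subspace A \<and> hone H \<in> A
     \<and> (\<forall>x\<in>A. \<forall>y\<in>A. hmult H x y \<in> A)"

definition is_algebra :: "('b, 'k::field) hopf \<Rightarrow> bool" where
  "is_algebra H \<longleftrightarrow> (let V = hcarrier H; m = hmult H in
     is_subalgebra H V
     \<and> (\<forall>x\<in>V. linear_on V scl (m x)) \<and> (\<forall>y\<in>V. linear_on V scl (\<lambda>x. m x y))
     \<and> (\<forall>x\<in>V. \<forall>y\<in>V. \<forall>z\<in>V. m (m x y) z = m x (m y z))
     \<and> (\<forall>x\<in>V. m (hone H) x = x \<and> m x (hone H) = x))"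

definition is_coalgebra :: "('b, 'k::field) hopf \<Rightarrow> bool" where
  "is_coalgebra H \<longleftrightarrow> (let V = hcarrier H; \<Delta> = hcomult H; \<epsilon> = hcounit H in
     linear_on V scl \<Delta> \<and> \<Delta> ` V \<subseteq> tensor_space V V \<and> linear_on V (*) \<epsilon>
     \<and> (\<forall>x\<in>V. tensor_lift V V (\<lambda>a b. tensor_lift V V (\<lambda>c d. tens c (tens d b)) (\<Delta> a)) (\<Delta> x)
             = tensor_lift V V (\<lambda>a b. tens a (\<Delta> b)) (\<Delta> x))
     \<and> (\<forall>x\<in>V. tensor_lift V V (\<lambda>a b. scl (\<epsilon> a) b) (\<Delta> x) = x
             \<and> tensor_lift V V (\<lambda>a b. scl (\<epsilon> b) a) (\<Delta> x) = x))"

definition is_bialgebra :: "('b, 'k::field) hopf \<Rightarrow> bool" where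
  "is_bialgebra H \<longleftrightarrow> is_algebra H \<and> is_coalgebra H
     \<and> (let V = hcarrier H; m = hmult H; \<Delta> = hcomult H; \<epsilon> = hcounit H in
          (\<forall>x\<in>V. \<forall>y\<in>V. \<Delta> (m x y) = tensor_mult V m (\<Delta> x) (\<Delta> y) \<and> \<epsilon> (m x y) = \<epsilon> x * \<epsilon> y)
          \<and> \<Delta> (hone H) = tens (hone H) (hone H) \<and> \<epsilon> (hone H) = 1)"

definition is_antipode :: "('b, 'k::field) hopf \<Rightarrow> (('b \<Rightarrow>\<^sub>0 'k) \<Rightarrow> ('b \<Rightarrow>\<^sub>0 'k)) \<Rightarrow> bool" where
  "is_antipode H \<chi> \<longleftrightarrow> (let V = hcarrier H; m = hmult H; \<Delta> = hcomult H in
     linear_on V scl \<chi> \<and> \<chi> ` V \<subseteq> V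
     \<and> (\<forall>x\<in>V. tensor_lift V V (\<lambda>a b. m (\<chi> a) b) (\<Delta> x) = scl (hcounit H x) (hone H)
             \<and> tensor_lift V V (\<lambda>a b. m a (\<chi> b)) (\<Delta> x) = scl (hcounit H x) (hone H)))"

definition hopf_algebra :: "('b, 'k::field) hopf \<Rightarrow> bool" where
  "hopf_algebra H \<longleftrightarrow> is_bialgebra H \<and> (\<exists>\<chi>. is_antipode H \<chi>)"

definition hopf_subalgebra :: "('b \<Rightarrow>\<^sub>0 'k::field) set \<Rightarrow> ('b, 'k) hopf \<Rightarrow> bool" where
  "hopf_subalgebra A H \<longleftrightarrow> hopf_algebra H \<and> is_subalgebra H A
     \<and> hcomult H ` A \<subseteq> tensor_space A A \<and> (\<forall>\<chi>. is_antipode H \<chi> \<longrightarrow> \<chi> ` A \<subseteq> A)"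

text \<open>Compatibility with the antipodes is automatic for bialgebra isomorphisms.\<close>

definition hopf_iso :: "('b, 'k::field) hopf \<Rightarrow> ('d, 'k) hopf \<Rightarrow> (('b \<Rightarrow>\<^sub>0 'k) \<Rightarrow> ('d \<Rightarrow>\<^sub>0 'k)) \<Rightarrow> bool" where
  "hopf_iso H H' f \<longleftrightarrow> (let V = hcarrier H in
     bij_betw f V (hcarrier H') \<and> linear_on V scl f
     \<and> (\<forall>x\<in>V. \<forall>y\<in>V. f (hmult H x y) = hmult H' (f x) (f y)) \<and> f (hone H) = hone H'
     \<and> (\<forall>x\<in>V. hcomult H' (f x) = tensor_lift V V (\<lambda>a b. tens (f a) (f b)) (hcomult H x))
     \<and> (\<forall>x\<in>V. hcounit H' (f x) = hcounit H x))"


section \<open>Noncommutative multi-symmetric functions\<close>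

datatype 'a word = Word (letters: "'a list")

instantiation word :: (type) monoid_add
begin
definition "0 = Word []"
definition "u + v = Word (letters u @ letters v)"
instance by standard (auto simp: zero_word_def plus_word_def)
end

typedef 'c nzvec = "{v :: 'c \<Rightarrow> nat. v \<noteq> (\<lambda>_. 0)}"
  by (rule exI[of _ "\<lambda>_. 1"]) (auto dest: fun_cong)

text \<open>The set of colors is the finite type \<open>'c\<close>; vectors in \<open>\<nat>\<^sup>\<ell>\<close> are functions \<open>'c \<Rightarrow> nat\<close>. The free
  algebra on the symbols \<open>S\<^sub>n\<close> is the algebra of the free monoid on the nonzero vectors, and its basis
  element indexed by a word is the product of the corresponding \<open>S\<^sub>n\<close>.\<close>

type_synonym ('c, 'k) ncsf = "'c nzvec word \<Rightarrow>\<^sub>0 'k"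

definition nc_S :: "('c \<Rightarrow> nat) \<Rightarrow> ('c::finite, 'k::field) ncsf" where
  "nc_S n = (if n = (\<lambda>_. 0) then 1 else Poly_Mapping.single (Word [Abs_nzvec n]) 1)"

definition nc_comult_S :: "('c \<Rightarrow> nat) \<Rightarrow> ('c::finite nzvec word \<times> 'c nzvec word \<Rightarrow>\<^sub>0 'k::field)" where
  "nc_comult_S n = (\<Sum>(i, j) \<in> {(i, j). \<forall>c. i c + j c = n c}. tens (nc_S i) (nc_S j))"

text \<open>The coproduct is the algebra morphism extending its values on the generators. The product of
  \<open>('b \<times> 'b) \<Rightarrow>\<^sub>0 'k\<close>, used in \<^const>\<open>prod_list\<close> below, is that of the tensor square, because the monoid
  operation on \<open>'b \<times> 'b\<close> is componentwise.\<close>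

definition nc_comult :: "('c::finite, 'k::field) ncsf \<Rightarrow> ('c nzvec word \<times> 'c nzvec word \<Rightarrow>\<^sub>0 'k)" where
  "nc_comult = lin_extend (\<lambda>w. prod_list (map (\<lambda>v. nc_comult_S (Rep_nzvec v)) (letters w)))"

definition NCSF :: "('c::finite nzvec word, 'k::field) hopf" where
  "NCSF = \<lparr>hcarrier = UNIV, hmult = (*), hone = 1, hcomult = nc_comult, hcounit = (\<lambda>x. Poly_Mapping.lookup x 0)\<rparr>"

definition word_degree :: "'c::finite nzvec word \<Rightarrow> nat" where
  "word_degree w = (\<Sum>v\<leftarrow>letters w. \<Sum>c\<in>UNIV. Rep_nzvec v c)"

definition nc_homogeneous :: "nat \<Rightarrow> ('c::finite, 'k::field) ncsf set" where
  "nc_homogeneous n = {x. \<forall>w\<in>Poly_Mapping.keys x. word_degree w = n}"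

definition mono_S :: "nat \<Rightarrow> 'c \<Rightarrow> ('c::finite, 'k::field) ncsf" where
  "mono_S n i = nc_S (\<lambda>c. if c = i then n else 0)"

definition MR :: "('c::finite, 'k::field) ncsf set" where
  "MR = is_subalgebra NCSF hull {mono_S n i | n i. n \<ge> 1}"

definition MR_hopf :: "('c::finite nzvec word, 'k::field) hopf" where
  "MR_hopf = NCSF\<lparr>hcarrier := MR\<rparr>"


section \<open>The internal product\<close>

text \<open>A monomial in the variables \<open>x\<^sub>j\<^sup>(\<^sup>c\<^sup>)\<close>, \<open>j\<close> a natural number, is its exponent function.\<close>

type_synonym 'c monomial = "nat \<times> 'c \<Rightarrow>\<^sub>0 nat"

text \<open>\<open>M_I\<close> evaluated on the alphabet \<open>t\<close>, whose letters are indexed by \<open>'i\<close> with strict order \<open>lt\<close>: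
  the coefficient of the monomial \<open>m\<close> in the formal infinite sum of polynomials
  \<open>\<Sum>j\<^sub>1 < \<dots> < j\<^sub>p. \<Prod>k c. t j\<^sub>k c ^ (I\<^sub>k)\<^sub>c\<close>. In all uses below only finitely many
  terms contain \<open>m\<close>.\<close>

definition M_term :: "('i \<Rightarrow> 'c \<Rightarrow> ('m::comm_monoid_add \<Rightarrow>\<^sub>0 'k::field)) \<Rightarrow> 'c::finite nzvec word
    \<Rightarrow> 'i list \<Rightarrow> ('m \<Rightarrow>\<^sub>0 'k)" where
  "M_term t I js = (\<Prod>k<length (letters I). \<Prod>c\<in>UNIV. t (js ! k) c ^ Rep_nzvec (letters I ! k) c)"

definition M_on :: "('i \<Rightarrow> 'i \<Rightarrow> bool) \<Rightarrow> ('i \<Rightarrow> 'c \<Rightarrow> ('m::comm_monoid_add \<Rightarrow>\<^sub>0 'k::field))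
    \<Rightarrow> 'c::finite nzvec word \<Rightarrow> 'm \<Rightarrow> 'k" where
  "M_on lt t I m =
    (\<Sum>js \<in> {js. length js = length (letters I) \<and> sorted_wrt lt js \<and> Poly_Mapping.lookup (M_term t I js) m \<noteq> 0}.
       Poly_Mapping.lookup (M_term t I js) m)"

definition var :: "nat \<Rightarrow> 'c \<Rightarrow> ('c monomial \<Rightarrow>\<^sub>0 'k::field)" where
  "var j c = Poly_Mapping.single (Poly_Mapping.single (j, c) 1) 1"

definition qsym_M :: "'c::finite nzvec word \<Rightarrow> 'c monomial \<Rightarrow> 'k::field" where
  "qsym_M = M_on (<) var"

text \<open>The alphabet \<open>X \<times>\<^sub>C Y\<close>, with polynomials in \<open>X\<close> and \<open>Y\<close> as elements of \<open>k[X] \<otimes> k[Y]\<close>; the group law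
  of \<open>C\<close> is that of \<open>G\<close>, and the index pairs are ordered lexicographically.\<close>

definition prod_alphabet :: "'c::finite monoid \<Rightarrow> nat \<times> nat \<Rightarrow> 'c
    \<Rightarrow> ('c monomial \<times> 'c monomial \<Rightarrow>\<^sub>0 'k::field)" where
  "prod_alphabet G rs \<gamma> =
    (\<Sum>(\<alpha>, \<beta>) \<in> {(\<alpha>, \<beta>). \<alpha> \<otimes>\<^bsub>G\<^esub> \<beta> = \<gamma>}. tens (var (fst rs) \<alpha>) (var (snd rs) \<beta>))"

definition delta_M :: "'c::finite monoid \<Rightarrow> 'c nzvec word \<Rightarrow> 'c monomial \<times> 'c monomial \<Rightarrow> 'k::field" where
  "delta_M G = M_on (\<lambda>p q. (p, q) \<in> less_than <*lex*> less_than) (prod_alphabet G)"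

text \<open>The expansion of \<open>\<delta>(M_K)\<close> on the \<open>M_I \<otimes> M_J\<close>.\<close>

definition delta_expansion :: "'c::finite monoid \<Rightarrow> 'c nzvec word
    \<Rightarrow> ('c nzvec word \<times> 'c nzvec word \<Rightarrow>\<^sub>0 'k::field)" where
  "delta_expansion G K = (THE p. \<forall>m m'. delta_M G K (m, m')
     = (\<Sum>(I, J)\<in>Poly_Mapping.keys p. Poly_Mapping.lookup p (I, J) * (qsym_M I m * qsym_M J m')))"

definition internal_basis :: "'c::finite monoid \<Rightarrow> 'c nzvec word \<Rightarrow> 'c nzvec word \<Rightarrow> ('c, 'k::field) ncsf" where
  "internal_basis G I J = Abs_poly_mapping (\<lambda>K. Poly_Mapping.lookup (delta_expansion G K) (I, J))"

definition internal_prod :: "'c::finite monoid \<Rightarrow> ('c, 'k::field) ncsf \<Rightarrow> ('c, 'k) ncsf \<Rightarrow> ('c, 'k) ncsf" where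
  "internal_prod G x y = lin_extend (\<lambda>I. lin_extend (\<lambda>J. internal_basis G I J) y) x"


section \<open>The Mantaci--Reutenauer descent algebra\<close>

text \<open>\<open>G\<close> wreath the symmetric group on \<open>{1..n}\<close>. For \<open>n = 0\<close> this is the trivial group.\<close>

definition wreath :: "'c monoid \<Rightarrow> nat \<Rightarrow> ((nat \<Rightarrow> nat) \<times> (nat \<Rightarrow> 'c)) monoid" where
  "wreath G n = \<lparr>carrier = {\<sigma>. \<sigma> permutes {1..n}} \<times> ({1..n} \<rightarrow>\<^sub>E carrier G),
     monoid.mult = (\<lambda>(\<sigma>, c) (\<tau>, d). (\<sigma> \<circ> \<tau>, restrict (\<lambda>i. c (\<tau> i) \<otimes>\<^bsub>G\<^esub> d i) {1..n})),
     one = (id, restrict (\<lambda>i. \<one>\<^bsub>G\<^esub>) {1..n})\<rparr>"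

text \<open>The direct sum of the group algebras of all \<^term>\<open>wreath G n\<close>; the first component of a basis
  element is \<open>n\<close>.\<close>

type_synonym 'c wr = "nat \<times> (nat \<Rightarrow> nat) \<times> (nat \<Rightarrow> 'c)"

definition group_alg_mult :: "'c monoid \<Rightarrow> ('c wr \<Rightarrow>\<^sub>0 'k::field) \<Rightarrow> ('c wr \<Rightarrow>\<^sub>0 'k) \<Rightarrow> ('c wr \<Rightarrow>\<^sub>0 'k)" where
  "group_alg_mult G = (\<lambda>x y. lin_extend (\<lambda>(n, g). lin_extend (\<lambda>(m, h).
     if n = m then Poly_Mapping.single (n, g \<otimes>\<^bsub>wreath G n\<^esub> h) 1 else 0) y) x)"

definition MR_internal :: "'c monoid \<Rightarrow> ('c wr \<Rightarrow>\<^sub>0 'k::field) \<Rightarrow> ('c wr \<Rightarrow>\<^sub>0 'k) \<Rightarrow> ('c wr \<Rightarrow>\<^sub>0 'k)" where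
  "MR_internal G x y = group_alg_mult G y x"

text \<open>A colored composition \<open>(I, u)\<close> is the list of the pairs \<open>(i\<^sub>k, u\<^sub>k)\<close>.\<close>

type_synonym 'c ccomp = "(nat \<times> 'c) list"

definition ccomps :: "'c monoid \<Rightarrow> 'c ccomp set" where
  "ccomps G = {w. \<forall>(i, u) \<in> set w. i \<ge> 1 \<and> u \<in> carrier G}"

definition csize :: "'c ccomp \<Rightarrow> nat" where
  "csize w = sum_list (map fst w)"

definition cblock :: "'c ccomp \<Rightarrow> nat \<Rightarrow> nat set" where
  "cblock w k = {csize (take k w) <.. csize (take (Suc k) w)}"

definition MR_B :: "'c monoid \<Rightarrow> 'c ccomp \<Rightarrow> ('c wr \<Rightarrow>\<^sub>0 'k::field)" where
  "MR_B G w = (\<Sum>(\<sigma>, c) \<in> {(\<sigma>, c) \<in> carrier (wreath G (csize w)). \<forall>k < length w.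
        strict_mono_on (cblock w k) \<sigma> \<and> (\<forall>i \<in> cblock w k. c i = snd (w ! k))}.
     Poly_Mapping.single (csize w, \<sigma>, c) 1)"

definition MR_descent_deg :: "'c monoid \<Rightarrow> nat \<Rightarrow> ('c wr \<Rightarrow>\<^sub>0 'k::field) set" where
  "MR_descent_deg G n = pm.span (MR_B G ` {w \<in> ccomps G. csize w = n})"

definition MR_descent :: "'c monoid \<Rightarrow> ('c wr \<Rightarrow>\<^sub>0 'k::field) set" where
  "MR_descent G = pm.span (MR_B G ` ccomps G)"

text \<open>Coordinates on the basis of the \<^const>\<open>MR_B\<close>. The outer product and the coproduct are those of the
  free algebra on the elements \<open>MR_B G [(n, i)]\<close>, \<open>n \<ge> 1\<close>.\<close>

definition MR_coords :: "'c monoid \<Rightarrow> ('c wr \<Rightarrow>\<^sub>0 'k::field) \<Rightarrow> ('c ccomp \<Rightarrow>\<^sub>0 'k)" where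
  "MR_coords G x = (THE p. Poly_Mapping.keys p \<subseteq> ccomps G \<and> x = lin_extend (MR_B G) p)"

definition MR_outer :: "'c monoid \<Rightarrow> ('c wr \<Rightarrow>\<^sub>0 'k::field) \<Rightarrow> ('c wr \<Rightarrow>\<^sub>0 'k) \<Rightarrow> ('c wr \<Rightarrow>\<^sub>0 'k)" where
  "MR_outer G x y =
    lin_extend (\<lambda>v. lin_extend (\<lambda>w. MR_B G (v @ w)) (MR_coords G y)) (MR_coords G x)"

text \<open>\<open>MR_B G [(0, i)] = MR_B G []\<close> is the unit, because the only block of \<open>[(0, i)]\<close> is empty.\<close>

primrec MR_comult_B :: "'c monoid \<Rightarrow> 'c ccomp \<Rightarrow> ('c wr \<times> 'c wr \<Rightarrow>\<^sub>0 'k::field)" where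
  "MR_comult_B G [] = tens (MR_B G []) (MR_B G [])"
| "MR_comult_B G (x # w) = tensor_mult (MR_descent G) (MR_outer G)
     (\<Sum>p\<le>fst x. tens (MR_B G [(p, snd x)]) (MR_B G [(fst x - p, snd x)])) (MR_comult_B G w)"

definition MR_descent_hopf :: "'c monoid \<Rightarrow> ('c wr, 'k::field) hopf" where
  "MR_descent_hopf G = \<lparr>hcarrier = MR_descent G, hmult = MR_outer G, hone = MR_B G [],
     hcomult = (\<lambda>x. lin_extend (MR_comult_B G) (MR_coords G x)),
     hcounit = (\<lambda>x. Poly_Mapping.lookup (MR_coords G x) [])\<rparr>"

end

theory Submission
  imports Defs "HOL-Library.Product_Lexorder"
begin

text \<open>The span of the monochromatic words is closed under products and coproducts, and any antipode is computed on it by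
  recursion on the degree. Setting to zero, in \<open>X \<times>\<^sub>C Y\<close>, the variables of the wrong colors shows that the product of
  two monochromatic words \<open>I\<close> and \<open>J\<close> is the sum, over the nonnegative integer matrices with row sums \<open>I\<close> and column sums
  \<open>J\<close>, of the monochromatic word obtained by reading the matrix row by row and coloring the entry \<open>(r, s)\<close> by the product
  of the colors of row \<open>r\<close> and column \<open>s\<close>. The block sums multiply by the same rule in the opposite group algebra: if \<open>\<tau>\<close>
  is increasing on the blocks of \<open>I\<close> and \<open>\<sigma>\<close> on those of \<open>J\<close>, the matrix of \<open>(\<sigma>, \<tau>)\<close> counts the positions of block \<open>r\<close> of
  \<open>I\<close> that \<open>\<tau>\<close> sends to block \<open>s\<close> of \<open>J\<close>, and \<open>(\<sigma>, \<tau>)\<close> is recovered from its matrix and \<open>\<sigma> \<circ> \<tau>\<close>.\<close>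

section \<open>Linear maps\<close>

text \<open>Three notions rest on choice or description: \<open>tensor_lift\<close> on a chosen
  representation, \<open>delta_expansion\<close> and \<open>MR_coords\<close> on unique existence.
  This shapes the proof. Maps are taken linear on the whole ambient space, where basis vectors
  determine them, and are compared with \<open>tensor_lift\<close> by their values on pure tensors.
  The expansion of \<open>\<delta>(M_K)\<close> exists because it is quasi-symmetric in both
  alphabets, and is finite because it is homogeneous; its coefficients are read at monomials that
  occupy initial segments of rows. Coordinates in the descent algebra are unique because the block
  sums are linearly independent, as permutations with inversions between all blocks show. The two
  products meet in sorted lists of matrix cells, each cell repeated as often as its entry says: the
  run-length encoding of such a list is the word in the quasi-symmetric computation, and its fibers
  are the blocks in the group algebra. The opposite multiplication yields the colors in reverse
  order, which commutativity of the color group repairs.\<close>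

abbreviation lookup where "lookup \<equiv> Poly_Mapping.lookup"
abbreviation keys where "keys \<equiv> Poly_Mapping.keys"
abbreviation single where "single \<equiv> Poly_Mapping.single"

global_interpretation pmp: vector_space_pair
  "scl :: 'k::field \<Rightarrow> ('b \<Rightarrow>\<^sub>0 'k) \<Rightarrow> ('b \<Rightarrow>\<^sub>0 'k)" "scl :: 'k \<Rightarrow> ('d \<Rightarrow>\<^sub>0 'k) \<Rightarrow> ('d \<Rightarrow>\<^sub>0 'k)"
  by unfold_locales

text \<open>Maps are total on the ambient space, so that linear algebra applies without carriers;
  \<open>linear_on\<close> is reached from here by restriction.\<close>

abbreviation lin :: "(('b \<Rightarrow>\<^sub>0 'k::field) \<Rightarrow> ('d \<Rightarrow>\<^sub>0 'k)) \<Rightarrow> bool" where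
  "lin \<equiv> Vector_Spaces.linear scl scl"

lemma linI: "\<lbrakk>\<And>x y. f (x + y) = f x + f y; \<And>c x. f (scl c x) = scl c (f x)\<rbrakk> \<Longrightarrow> lin f"
  by unfold_locales auto

lemma lin_add: "lin f \<Longrightarrow> f (x + y) = f x + f y"
  by (rule pmp.linear_add)

lemma lin_scl: "lin f \<Longrightarrow> f (scl c x) = scl c (f x)"
  by (rule pmp.linear_scale)

lemma lin_sum: "lin f \<Longrightarrow> f (sum g A) = (\<Sum>a\<in>A. f (g a))"
  by (rule pmp.linear_sum)

lemma lin_0: "lin f \<Longrightarrow> f 0 = 0"
  by (rule pmp.linear_0)

lemma lin_sum_list: "lin f \<Longrightarrow> f (sum_list xs) = (\<Sum>x\<leftarrow>xs. f x)"
  by (induction xs) (auto simp: lin_0 lin_add)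

lemma lin_comp: "lin f \<Longrightarrow> lin g \<Longrightarrow> lin (\<lambda>x. f (g x))"
  by (auto intro!: linI simp: lin_add lin_scl)

lemma lin_imp_linear_on: "lin f \<Longrightarrow> linear_on V scl f"
  by (auto simp: linear_on_def lin_add lin_scl)

lemma linear_on_UNIV_iff: "linear_on UNIV scl f \<longleftrightarrow> lin f"
  by (auto simp: linear_on_def lin_add lin_scl intro!: linI)

lemma scl_single [simp]: "scl c (single b d) = single b (c * d)"
  by (rule poly_mapping_eqI) (auto simp: lookup_single when_def)

lemma scl_sum: "scl c (sum g A) = (\<Sum>a\<in>A. scl c (g a))"
  by (rule pm.scale_sum_right)

lemma lin_extend_superset:
  assumes "finite A" "keys x \<subseteq> A"
  shows "lin_extend \<phi> x = (\<Sum>b\<in>A. scl (lookup x b) (\<phi> b))"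
  unfolding lin_extend_def
  by (rule sum.mono_neutral_left) (use assms in \<open>auto simp: in_keys_iff\<close>)

lemma lin_lin_extend [intro, simp]: "lin (lin_extend \<phi>)"
proof (rule linI)
  fix x y c
  show "lin_extend \<phi> (x + y) = lin_extend \<phi> x + lin_extend \<phi> y"
    using Poly_Mapping.keys_add[of x y]
    by (subst (1 2 3) lin_extend_superset[of "keys x \<union> keys y"])
      (auto simp: lookup_add pm.scale_left_distrib sum.distrib)
  show "lin_extend \<phi> (scl c x) = scl c (lin_extend \<phi> x)"
    by (subst (1 2) lin_extend_superset[of "keys x"]) (auto simp: in_keys_iff scl_sum)
qed

lemma lin_lin_extend_comp: "lin f \<Longrightarrow> lin (\<lambda>x. lin_extend \<phi> (f x))"
  by (rule lin_comp[OF lin_lin_extend])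

lemma lin_extend_single [simp]: "lin_extend \<phi> (single b c) = scl c (\<phi> b)"
  by (subst lin_extend_superset[of "{b}"]) auto

lemma lin_extend_cong: "(\<And>b. b \<in> keys x \<Longrightarrow> \<phi> b = \<psi> b) \<Longrightarrow> lin_extend \<phi> x = lin_extend \<psi> x"
  by (simp add: lin_extend_def)

lemma lookup_lin_extend: "lookup (lin_extend \<phi> x) d = (\<Sum>b\<in>keys x. lookup x b * lookup (\<phi> b) d)"
  by (simp add: lin_extend_def lookup_sum)

lemma keys_lin_extend: "keys (lin_extend \<phi> x) \<subseteq> (\<Union>b\<in>keys x. keys (\<phi> b))"
proof
  fix d assume "d \<in> keys (lin_extend \<phi> x)"
  then have "(\<Sum>b\<in>keys x. lookup x b * lookup (\<phi> b) d) \<noteq> 0"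
    by (simp add: in_keys_iff lookup_lin_extend)
  then obtain b where "b \<in> keys x" "lookup x b * lookup (\<phi> b) d \<noteq> 0"
    by (rule sum.not_neutral_contains_not_neutral)
  then show "d \<in> (\<Union>b\<in>keys x. keys (\<phi> b))"
    by (auto simp: in_keys_iff)
qed

lemma lin_extend_singles: "lin_extend (\<lambda>b. single b 1) x = x"
  by (rule poly_mapping_eqI)
    (auto simp: lookup_lin_extend lookup_single when_def in_keys_iff if_distrib sum.If_cases
      cong: if_cong)

lemma lin_eq_lin_extend:
  assumes "lin f" shows "f x = lin_extend (\<lambda>b. f (single b 1)) x"
proof -
  have "f x = f (lin_extend (\<lambda>b. single b 1) x)" by (simp only: lin_extend_singles)
  also have "\<dots> = (\<Sum>b\<in>keys x. scl (lookup x b) (f (single b 1)))"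
    unfolding lin_extend_def by (simp only: lin_sum[OF assms] lin_scl[OF assms])
  finally show ?thesis by (simp add: lin_extend_def)
qed

text \<open>\<open>MR\<close> turns out to consist of the vectors supported on monochromatic words.
  Testing on the support alone therefore verifies identities on \<open>MR\<close> that may fail
  elsewhere.\<close>

lemma lin_eqI_on:
  assumes "lin f" "lin g" "\<And>b. b \<in> keys x \<Longrightarrow> f (single b 1) = g (single b 1)"
  shows "f x = g x"
  by (simp add: lin_eq_lin_extend[OF assms(1), of x] lin_eq_lin_extend[OF assms(2), of x]
      assms(3) cong: lin_extend_cong)

lemma lin_eqI:
  assumes "lin f" "lin g" "\<And>b. f (single b 1) = g (single b 1)"
  shows "f x = g x"
  using assms by (rule lin_eqI_on)

lemma lin_lin_extend_param:
  assumes "\<And>b. lin (\<lambda>y. h y b)"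
  shows "lin (\<lambda>y. lin_extend (h y) x)"
  unfolding lin_extend_def
  by (auto intro!: linI simp: lin_add[OF assms] lin_scl[OF assms] scl_sum sum.distrib
      pm.scale_right_distrib mult.commute)

text \<open>Coordinate subspaces become support conditions; \<open>MR\<close>, its homogeneous parts
  and its tensor square are treated this way.\<close>

lemma pm_span_singles:
  "pm.span ((\<lambda>b. single b (1::'k::field)) ` B) = {x. keys x \<subseteq> B}"
proof
  show "pm.span ((\<lambda>b. single b (1::'k)) ` B) \<subseteq> {x. keys x \<subseteq> B}"
    by (rule pm.span_minimal)
      (auto simp: pm.subspace_def in_keys_iff lookup_add subset_iff lookup_single when_def
        split: if_splits, metis add_0)
  show "{x. keys x \<subseteq> B} \<subseteq> pm.span ((\<lambda>b. single b (1::'k)) ` B)"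
  proof safe
    fix x :: "_ \<Rightarrow>\<^sub>0 'k" assume "keys x \<subseteq> B"
    then have "lin_extend (\<lambda>b. single b 1) x \<in> pm.span ((\<lambda>b. single b (1::'k)) ` B)"
      unfolding lin_extend_def by (intro pm.span_sum pm.span_scale pm.span_base) auto
    then show "x \<in> pm.span ((\<lambda>b. single b (1::'k)) ` B)" by (simp only: lin_extend_singles)
  qed
qed

lemma scl_conv_mult: "scl c x = single 0 c * x"
  by (simp add: scl_def mult_map_scale_conv_mult)

lemma mult_expand:
  fixes x y :: "'b::monoid_add \<Rightarrow>\<^sub>0 'k::field"
  shows "x * y = (\<Sum>a\<in>keys x. \<Sum>b\<in>keys y. single (a + b) (lookup x a * lookup y b))"
proof -
  have "x * y = lin_extend (\<lambda>b. single b 1) x * lin_extend (\<lambda>b. single b 1) y"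
    by (simp only: lin_extend_singles)
  also have "\<dots> = (\<Sum>a\<in>keys x. \<Sum>b\<in>keys y. single (a + b) (lookup x a * lookup y b))"
    unfolding lin_extend_def by (simp add: sum_product mult_single)
  finally show ?thesis .
qed

lemma scl_mult_left [simp]: "scl c x * y = scl c (x * y)"
  by (simp only: scl_conv_mult mult.assoc)

text \<open>The monoid may be noncommutative, but \<open>single 0 c\<close> is central, since 0 is
  neutral on both sides and scalars commute.\<close>

lemma scl_mult_right [simp]:
  fixes x y :: "'b::monoid_add \<Rightarrow>\<^sub>0 'k::field"
  shows "x * scl c y = scl c (x * y)"
proof -
  have "x * single 0 c = single 0 c * x"
    unfolding mult_expand[of x] mult_expand[of "single 0 c"]
    by (cases "c = 0") (auto intro!: sum.cong simp: mult.commute)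
  then show ?thesis
    by (simp only: scl_conv_mult mult.assoc[symmetric])
qed

lemma lin_mult_left: "lin f \<Longrightarrow> lin (\<lambda>x. f x * (y :: 'b::monoid_add \<Rightarrow>\<^sub>0 'k::field))"
  by (auto intro!: linI simp: lin_add lin_scl algebra_simps)

lemma lin_mult_right: "lin f \<Longrightarrow> lin (\<lambda>x. (y :: 'b::monoid_add \<Rightarrow>\<^sub>0 'k::field) * f x)"
  by (auto intro!: linI simp: lin_add lin_scl algebra_simps)

lemma lin_ident [simp]: "lin (\<lambda>x. x)"
  by (auto intro!: linI)

lemma lin_scl_fun: "lin f \<Longrightarrow> lin (\<lambda>x. scl c (f x))"
  by (auto intro!: linI simp: lin_add lin_scl pm.scale_right_distrib mult.commute)

lemma bilin_eqI:
  assumes "\<And>y. lin (\<lambda>x. F x y)" "\<And>x. lin (F x)" "\<And>y. lin (\<lambda>x. G x y)" "\<And>x. lin (G x)"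
    and "\<And>a b. a \<in> keys x \<Longrightarrow> b \<in> keys y \<Longrightarrow> F (single a 1) (single b 1) = G (single a 1) (single b 1)"
  shows "F x y = G x y"
  by (rule lin_eqI_on[of "\<lambda>x. F x y" "\<lambda>x. G x y"], rule assms, rule assms,
      rule lin_eqI_on, rule assms, rule assms, rule assms)

text \<open>Common source of multiplicative maps below: coproduct, counit, reassociation of tensors,
  relabelling of rows, annihilation of variables. The last kind sends some basis elements to 0,
  hence values in the whole algebra and not only in a monoid.\<close>

lemma lin_extend_mult:
  fixes \<phi> :: "'b::monoid_add \<Rightarrow> ('d::monoid_add \<Rightarrow>\<^sub>0 'k::field)"
  assumes "\<And>a b. \<phi> (a + b) = \<phi> a * \<phi> b"
  shows "lin_extend \<phi> (x * y) = lin_extend \<phi> x * lin_extend \<phi> y"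
  by (rule bilin_eqI[of "\<lambda>x y. lin_extend \<phi> (x * y)" "\<lambda>x y. lin_extend \<phi> x * lin_extend \<phi> y"])
    (auto intro!: lin_ident lin_mult_left lin_mult_right lin_lin_extend_comp simp: mult_single assms)

lemma one_conv_single: "1 = single 0 1"
  by simp

lemma lin_extend_one: "lin_extend \<phi> 1 = \<phi> 0"
  by (simp add: one_conv_single del: single_one)

lemma lookup_lin_extend_inj:
  assumes "inj h"
  shows "lookup (lin_extend (\<lambda>m. single (h m) 1) x) (h m) = lookup x m"
  by (auto simp: lookup_lin_extend lookup_single when_def inj_eq[OF assms] in_keys_iff
      if_distrib sum.If_cases cong: if_cong)

section \<open>Tensors\<close>

lemma lookup_tens [simp]: "lookup (tens x y) (a, b) = lookup x a * lookup y b"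
proof -
  have "lookup (tens x y) (a, b) =
      (\<Sum>c\<in>keys x. \<Sum>d\<in>keys y. if c = a \<and> d = b then lookup x c * lookup y d else 0)"
    by (auto simp: tens_def lookup_sum lookup_single when_def intro!: sum.cong)
  also have "\<dots> = (\<Sum>c\<in>keys x. if c = a then lookup x a * lookup y b else 0)"
  proof (rule sum.cong)
    fix c assume "c \<in> keys x"
    show "(\<Sum>d\<in>keys y. if c = a \<and> d = b then lookup x c * lookup y d else 0) =
        (if c = a then lookup x a * lookup y b else 0)"
      by (cases "c = a") (auto simp: in_keys_iff sum.delta)
  qed simp
  also have "\<dots> = lookup x a * lookup y b"
    by (auto simp: in_keys_iff)
  finally show ?thesis .
qed

lemma lin_tens_left: "lin f \<Longrightarrow> lin (\<lambda>x. tens (f x) y)"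
  by (auto intro!: linI poly_mapping_eqI simp: lin_add lin_scl lookup_add algebra_simps)

lemma lin_tens_right: "lin f \<Longrightarrow> lin (\<lambda>x. tens y (f x))"
  by (auto intro!: linI poly_mapping_eqI simp: lin_add lin_scl lookup_add algebra_simps)

lemmas lin_intros = lin_ident lin_mult_left lin_mult_right lin_tens_left lin_tens_right
  lin_lin_extend_comp lin_scl_fun

lemma tens_single [simp]: "tens (single a c) (single b d) = single (a, b) (c * d)"
  by (rule poly_mapping_eqI) (auto simp: lookup_single when_def split: if_splits)

lemma tens_mult:
  fixes x x' :: "'b::monoid_add \<Rightarrow>\<^sub>0 'k::field" and y y' :: "'d::monoid_add \<Rightarrow>\<^sub>0 'k"
  shows "tens x y * tens x' y' = tens (x * x') (y * y')"
proof (rule bilin_eqI[of "\<lambda>x y. tens x y * tens x' y'" "\<lambda>x y. tens (x * x') (y * y')"])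
  fix a b
  show "tens (single a 1) (single b 1) * tens x' y' = tens (single a 1 * x') (single b 1 * y')"
    by (rule bilin_eqI[of "\<lambda>x' y'. tens (single a 1) (single b 1) * tens x' y'"
          "\<lambda>x' y'. tens (single a 1 * x') (single b 1 * y')"])
      (auto intro!: lin_intros simp: mult_single)
qed (auto intro!: lin_intros)

lemma tens_one: "tens 1 1 = 1"
  by (simp add: one_conv_single zero_prod_def del: single_one)

lemma tens_in_tensor_space: "x \<in> V \<Longrightarrow> y \<in> W \<Longrightarrow> tens x y \<in> tensor_space V W"
  unfolding tensor_space_def by (auto intro: pm.span_base)

lemma tensor_space_keys:
  assumes "\<And>a. a \<in> A \<Longrightarrow> single a 1 \<in> V" "\<And>b. b \<in> B \<Longrightarrow> single b 1 \<in> W" "keys t \<subseteq> A \<times> B"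
  shows "t \<in> tensor_space V W"
proof -
  have "t \<in> pm.span ((\<lambda>ab. single ab 1) ` (A \<times> B))"
    using assms(3) by (simp add: pm_span_singles)
  also have "\<dots> \<subseteq> tensor_space V W"
    unfolding tensor_space_def
  proof (rule pm.span_mono, safe)
    fix a b assume "a \<in> A" "b \<in> B"
    then show "\<exists>x y. single (a, b) 1 = tens x y \<and> x \<in> V \<and> y \<in> W"
      by (intro exI[of _ "single a 1"] exI[of _ "single b 1"]) (auto simp: assms)
  qed
  finally show ?thesis .
qed

lemma tensor_space_UNIV [simp]: "tensor_space UNIV UNIV = UNIV"
  using tensor_space_keys[of UNIV UNIV UNIV UNIV] by auto

lemma tensor_space_list:
  assumes "t \<in> tensor_space V W" "pm.subspace V"
  obtains xs where "set xs \<subseteq> V \<times> W" "t = (\<Sum>(x, y)\<leftarrow>xs. tens x y)"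
proof -
  have "\<exists>xs. set xs \<subseteq> V \<times> W \<and> t = (\<Sum>(x, y)\<leftarrow>xs. tens x y)"
    using assms(1) unfolding tensor_space_def
  proof (induction rule: pm.span_induct_alt)
    case base
    show ?case by (intro exI[of _ "[]"]) auto
  next
    case (step c u t)
    then obtain x y xs where "x \<in> V" "y \<in> W" "u = tens x y"
      and "set xs \<subseteq> V \<times> W" "t = (\<Sum>(x, y)\<leftarrow>xs. tens x y)" by auto
    \<comment> \<open>The scalar is absorbed into the left factor, where closure of \<open>V\<close>
      under scaling keeps the pair admissible.\<close>
    then show ?case
      by (intro exI[of _ "(scl c x, y) # xs"])
        (auto simp: pm.subspace_scale[OF assms(2)] lin_scl[OF lin_tens_left[OF lin_ident]])
  qed
  with that show ?thesis by auto
qed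

text \<open>Bilinearity of \<open>h\<close> is implicit in the existence of \<open>H\<close>, which also makes the choice of a representation
  irrelevant.\<close>

lemma tensor_lift_eq:
  assumes "t \<in> tensor_space V W" "pm.subspace V" "lin H"
    and H: "\<And>x y. x \<in> V \<Longrightarrow> y \<in> W \<Longrightarrow> H (tens x y) = h x y"
  shows "tensor_lift V W h t = H t"
proof -
  define P where "P xs \<longleftrightarrow> set xs \<subseteq> V \<times> W \<and> t = (\<Sum>(x, y)\<leftarrow>xs. tens x y)" for xs
  define xs where "xs = (SOME xs. P xs)"
  have "\<exists>xs. P xs"
    using tensor_space_list[OF assms(1,2)] unfolding P_def by metis
  then have xs: "set xs \<subseteq> V \<times> W" "t = (\<Sum>(x, y)\<leftarrow>xs. tens x y)"
    using someI_ex[of P] unfolding xs_def P_def by auto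
  have "tensor_lift V W h t = (\<Sum>(x, y)\<leftarrow>xs. h x y)"
    unfolding tensor_lift_def Let_def xs_def P_def ..
  also have "\<dots> = (\<Sum>(x, y)\<leftarrow>xs. H (tens x y))"
    using xs(1) by (intro arg_cong[of _ _ sum_list] map_cong) (auto simp: H)
  also have "\<dots> = H t"
    unfolding xs(2) by (simp add: lin_sum_list[OF assms(3)] o_def case_prod_unfold)
  finally show ?thesis .
qed

text \<open>Only values of h on pairs of basis vectors enter, so the result is linear for every h;
  for bilinear h it is the map induced on the tensor product.\<close>

definition bilin_extend :: "(('b \<Rightarrow>\<^sub>0 'k::field) \<Rightarrow> ('d \<Rightarrow>\<^sub>0 'k) \<Rightarrow> ('e \<Rightarrow>\<^sub>0 'k)) \<Rightarrow> ('b \<times> 'd \<Rightarrow>\<^sub>0 'k) \<Rightarrow> ('e \<Rightarrow>\<^sub>0 'k)" where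
  "bilin_extend h = lin_extend (\<lambda>(a, b). h (single a 1) (single b 1))"

lemma lin_bilin_extend [simp]: "lin (bilin_extend h)"
  by (simp add: bilin_extend_def)

lemma lin_bilin_extend_comp: "lin f \<Longrightarrow> lin (\<lambda>x. bilin_extend h (f x))"
  by (rule lin_comp[OF lin_bilin_extend])

lemma bilin_extend_single [simp]:
  "bilin_extend h (single (a, b) c) = scl c (h (single a 1) (single b 1))"
  by (simp add: bilin_extend_def)

lemma bilin_extend_tens:
  assumes "\<And>y. lin (\<lambda>x. h x y)" "\<And>x. lin (h x)"
  shows "bilin_extend h (tens x y) = h x y"
  by (rule bilin_eqI[of "\<lambda>x y. bilin_extend h (tens x y)" h])
    (auto intro!: assms lin_bilin_extend_comp lin_intros)

lemma tensor_lift_bilin: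
  assumes "t \<in> tensor_space V W" "pm.subspace V" "\<And>y. lin (\<lambda>x. h x y)" "\<And>x. lin (h x)"
  shows "tensor_lift V W h t = bilin_extend h t"
  by (rule tensor_lift_eq) (use assms in \<open>auto intro: bilin_extend_tens\<close>)

lemma tensor_lift_UNIV:
  assumes "\<And>y. lin (\<lambda>x. h x y)" "\<And>x. lin (h x)"
  shows "tensor_lift UNIV UNIV h t = bilin_extend h t"
  by (rule tensor_lift_bilin) (use assms in auto)

text \<open>Reconciles the product defined by chosen representations with the monoid-algebra product
  on pairs, in which \<open>nc_comult\<close> is formed. The linear maps fed to
  \<open>tensor_lift_eq\<close> are left multiplication by \<open>tens a b\<close> and right
  multiplication by u.\<close>

lemma tensor_mult_UNIV: "tensor_mult UNIV (*) t u = t * (u :: 'b::monoid_add \<times> 'b \<Rightarrow>\<^sub>0 'k::field)"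
proof -
  have "tensor_lift UNIV UNIV (\<lambda>c d. tens (a * c) (b * d)) u = tens a b * u"
    for a b :: "'b \<Rightarrow>\<^sub>0 'k"
    by (rule tensor_lift_eq) (auto simp: tens_mult intro!: lin_intros)
  then show ?thesis unfolding tensor_mult_def
    by (simp, intro tensor_lift_eq) (auto intro!: lin_intros)
qed

section \<open>The bialgebra of noncommutative multi-symmetric functions\<close>

text \<open>The hypothesis makes h multiplicative on pure tensors, as for a coproduct or a counit
  applied to one factor of a tensor square.\<close>

lemma bilin_extend_mult:
  fixes h :: "('b::monoid_add \<Rightarrow>\<^sub>0 'k::field) \<Rightarrow> ('d::monoid_add \<Rightarrow>\<^sub>0 'k) \<Rightarrow> ('e::monoid_add \<Rightarrow>\<^sub>0 'k)"
  assumes "\<And>x x' y y'. h (x * x') (y * y') = h x y * h x' y'"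
  shows "bilin_extend h (t * u) = bilin_extend h t * bilin_extend h u"
  unfolding bilin_extend_def
proof (rule lin_extend_mult)
  fix p q :: "'b \<times> 'd"
  show "(case p + q of (a, b) \<Rightarrow> h (single a 1) (single b 1)) =
    (case p of (a, b) \<Rightarrow> h (single a 1) (single b 1)) * (case q of (a, b) \<Rightarrow> h (single a 1) (single b 1))"
    using assms[of "single (fst p) 1" "single (fst q) 1" "single (snd p) 1" "single (snd q) 1"]
    by (cases p; cases q) (simp add: mult_single)
qed

lemma word_add_eq_0_iff [simp]: "u + v = 0 \<longleftrightarrow> u = 0 \<and> v = (0 :: 'a word)"
  by (cases u; cases v) (auto simp: zero_word_def plus_word_def)

lemma word_induct [case_names zero add]:
  assumes "P 0" "\<And>v w. P w \<Longrightarrow> P (Word [v] + w)"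
  shows "P w"
proof -
  have "P (Word vs)" for vs
  proof (induction vs)
    case Nil
    then show ?case using assms(1) by (simp add: zero_word_def)
  next
    case (Cons v vs)
    then show ?case using assms(2)[of "Word vs" v] by (simp add: plus_word_def)
  qed
  then show ?thesis by (cases w) auto
qed

text \<open>Uniqueness in the universal property of the free algebra; it reduces the coalgebra
  axioms to single letters.\<close>

lemma word_alg_hom_eqI:
  fixes F G :: "('a word \<Rightarrow>\<^sub>0 'k::field) \<Rightarrow> ('d::monoid_add \<Rightarrow>\<^sub>0 'k)"
  assumes "lin F" "lin G" "\<And>x y. F (x * y) = F x * F y" "\<And>x y. G (x * y) = G x * G y"
    and "F 1 = G 1" "\<And>v. F (single (Word [v]) 1) = G (single (Word [v]) 1)"
  shows "F x = G x"
proof (rule lin_eqI[OF assms(1,2)])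
  fix w :: "'a word"
  show "F (single w 1) = G (single w 1)"
  proof (induction w rule: word_induct)
    case zero
    then show ?case using assms(5) by simp
  next
    case (add v w)
    have "single (Word [v] + w) 1 = single (Word [v]) 1 * single w (1::'k)"
      by (simp add: mult_single)
    then show ?case by (simp only: assms add)
  qed
qed

lemma lin_single_lookup: "lin f \<Longrightarrow> lin (\<lambda>x. single a (lookup (f x) b))"
  by (auto intro!: linI simp: lin_add lin_scl lookup_add single_add)

text \<open>A concatenation is empty only if both factors are. \<open>E\<close> is the counit
  followed by the unit, which turns a scalar-valued map into one to which
  \<open>lin_extend_mult\<close> applies.\<close>

lemma lookup_mult_0:
  fixes x y :: "'a word \<Rightarrow>\<^sub>0 'k::field"
  shows "lookup (x * y) 0 = lookup x 0 * lookup y 0"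
proof -
  define E where "E = lin_extend (\<lambda>w :: 'a word. if w = 0 then 1 else (0 :: 'a word \<Rightarrow>\<^sub>0 'k))"
  have E: "E z = single 0 (lookup z 0)" for z
    by (rule lin_eqI[of E]) (auto simp: E_def lookup_single intro!: lin_single_lookup lin_ident)
  have "E (x * y) = E x * E y" unfolding E_def by (rule lin_extend_mult) auto
  then show ?thesis by (simp add: E mult_single) (metis lookup_single_eq)
qed

definition vec_splits :: "('c \<Rightarrow> nat) \<Rightarrow> (('c \<Rightarrow> nat) \<times> ('c \<Rightarrow> nat)) set" where
  "vec_splits n = {(i, j). \<forall>c. i c + j c = n c}"

lemma finite_vec_le: "finite {i :: 'c::finite \<Rightarrow> nat. \<forall>c. i c \<le> n c}"
proof -
  have "{i. \<forall>c. i c \<le> n c} = PiE UNIV (\<lambda>c. {..n c})" by (auto simp: PiE_def Pi_def)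
  then show ?thesis by (simp add: finite_PiE)
qed

lemma finite_vec_splits [simp]: "finite (vec_splits (n :: 'c::finite \<Rightarrow> nat))"
proof (rule finite_subset)
  show "vec_splits n \<subseteq> {i. \<forall>c. i c \<le> n c} \<times> {i. \<forall>c. i c \<le> n c}"
    by (auto simp: vec_splits_def) (metis le_add1, metis le_add2)
qed (use finite_vec_le in auto)

lemma nc_comult_S_alt: "nc_comult_S n = (\<Sum>(i, j)\<in>vec_splits n. tens (nc_S i) (nc_S j))"
  by (simp add: nc_comult_S_def vec_splits_def)

lemma nc_S_0 [simp]: "nc_S (\<lambda>_. 0) = 1"
  by (simp add: nc_S_def)

lemma nc_S_Rep [simp]: "nc_S (Rep_nzvec v) = single (Word [v]) 1"
  using Rep_nzvec[of v] by (auto simp: nc_S_def Rep_nzvec_inverse)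

lemma vec_splits_0: "vec_splits (\<lambda>_. 0) = {(\<lambda>_. 0, \<lambda>_. 0)}"
  by (auto simp: vec_splits_def)

lemma nc_comult_S_0: "nc_comult_S (\<lambda>_. 0) = 1"
  by (simp add: nc_comult_S_alt vec_splits_0 tens_one)

lemma lin_nc_comult: "lin nc_comult"
  by (simp add: nc_comult_def)

lemma lin_nc_comult_comp: "lin f \<Longrightarrow> lin (\<lambda>x. nc_comult (f x))"
  by (rule lin_comp[OF lin_nc_comult])

lemma nc_comult_mult: "nc_comult (x * y) = nc_comult x * nc_comult y"
  unfolding nc_comult_def by (rule lin_extend_mult) (simp add: plus_word_def)

lemma nc_comult_one: "nc_comult 1 = 1"
  by (simp add: nc_comult_def lin_extend_one zero_word_def)

lemma nc_comult_nc_S: "nc_comult (nc_S n) = nc_comult_S n"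
proof (cases "n = (\<lambda>_. 0)")
  case True
  then show ?thesis by (simp add: nc_comult_one nc_comult_S_0)
next
  case False
  then show ?thesis by (simp add: nc_S_def nc_comult_def Abs_nzvec_inverse)
qed

lemma nc_comult_letter: "nc_comult (single (Word [v]) 1) = nc_comult_S (Rep_nzvec v)"
  by (simp add: nc_comult_nc_S flip: nc_S_Rep)

text \<open>\<open>('a \<times> 'b) \<times> 'd\<close> and
  \<open>'a \<times> 'b \<times> 'd\<close> are different types, so the canonical identification
  behind coassociativity has to be a map.\<close>

definition tens_assoc :: "(('a \<times> 'b) \<times> 'd \<Rightarrow>\<^sub>0 'k::field) \<Rightarrow> ('a \<times> 'b \<times> 'd \<Rightarrow>\<^sub>0 'k)" where
  "tens_assoc = lin_extend (\<lambda>((a, b), c). single (a, b, c) 1)"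

lemma lin_tens_assoc_comp: "lin f \<Longrightarrow> lin (\<lambda>x. tens_assoc (f x))"
  unfolding tens_assoc_def by (rule lin_lin_extend_comp)

lemma tens_assoc_tens: "tens_assoc (tens (tens x y) z) = tens x (tens y z)"
proof (rule poly_mapping_eqI, safe)
  fix a b c
  have "lookup (tens_assoc (tens (tens x y) z)) (a, b, c) = lookup (tens (tens x y) z) ((a, b), c)"
    using lookup_lin_extend_inj[of "\<lambda>((a, b), c). (a, b, c)" "tens (tens x y) z" "((a, b), c)"]
    by (simp add: tens_assoc_def case_prod_unfold inj_def prod_eq_iff)
  then show "lookup (tens_assoc (tens (tens x y) z)) (a, b, c) = lookup (tens x (tens y z)) (a, b, c)"
    by (simp add: mult.assoc)
qed

lemma tens_assoc_mult:
  fixes t u :: "('a::monoid_add \<times> 'b::monoid_add) \<times> 'd::monoid_add \<Rightarrow>\<^sub>0 'k::field"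
  shows "tens_assoc (t * u) = tens_assoc t * tens_assoc u"
  unfolding tens_assoc_def by (rule lin_extend_mult) (auto simp: mult_single)

definition comult_left :: "('c::finite nzvec word \<times> 'c nzvec word \<Rightarrow>\<^sub>0 'k::field) \<Rightarrow>
    ('c nzvec word \<times> 'c nzvec word \<times> 'c nzvec word \<Rightarrow>\<^sub>0 'k)" where
  "comult_left = bilin_extend (\<lambda>a b. tens_assoc (tens (nc_comult a) b))"

definition comult_right :: "('c::finite nzvec word \<times> 'c nzvec word \<Rightarrow>\<^sub>0 'k::field) \<Rightarrow>
    ('c nzvec word \<times> 'c nzvec word \<times> 'c nzvec word \<Rightarrow>\<^sub>0 'k)" where
  "comult_right = bilin_extend (\<lambda>a b. tens a (nc_comult b))"

lemma comult_left_tens: "comult_left (tens a b) = tens_assoc (tens (nc_comult a) b)"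
  unfolding comult_left_def
  by (rule bilin_extend_tens) (auto intro!: lin_tens_assoc_comp lin_nc_comult_comp lin_intros)

lemma comult_right_tens: "comult_right (tens a b) = tens a (nc_comult b)"
  unfolding comult_right_def
  by (rule bilin_extend_tens) (auto intro!: lin_nc_comult_comp lin_intros)

lemma lin_comult_left: "lin f \<Longrightarrow> lin (\<lambda>x. comult_left (f x))"
  unfolding comult_left_def by (rule lin_bilin_extend_comp)

lemma lin_comult_right: "lin f \<Longrightarrow> lin (\<lambda>x. comult_right (f x))"
  unfolding comult_right_def by (rule lin_bilin_extend_comp)

lemma nc_comult_coassoc:
  fixes x :: "('c::finite, 'k::field) ncsf"
  shows "comult_left (nc_comult x) = comult_right (nc_comult x)"
proof (rule word_alg_hom_eqI[of "\<lambda>x. comult_left (nc_comult x)" "\<lambda>x. comult_right (nc_comult x)"])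
  show "comult_left (nc_comult (x * y)) = comult_left (nc_comult x) * comult_left (nc_comult y)"
    for x y :: "('c, 'k) ncsf"
    unfolding nc_comult_mult unfolding comult_left_def
    by (rule bilin_extend_mult) (simp add: nc_comult_mult tens_mult flip: tens_assoc_mult)
  show "comult_right (nc_comult (x * y)) = comult_right (nc_comult x) * comult_right (nc_comult y)"
    for x y :: "('c, 'k) ncsf"
    unfolding nc_comult_mult unfolding comult_right_def
    by (rule bilin_extend_mult) (simp add: nc_comult_mult tens_mult)
  show "comult_left (nc_comult 1) = comult_right (nc_comult (1 :: ('c, 'k) ncsf))"
    by (simp add: nc_comult_one comult_left_tens comult_right_tens tens_assoc_tens flip: tens_one)
  fix v :: "'c nzvec"
  define n where "n = Rep_nzvec v"
  define F :: "('c \<Rightarrow> nat) \<Rightarrow> ('c \<Rightarrow> nat) \<Rightarrow> ('c \<Rightarrow> nat) \<Rightarrow> ('c nzvec word \<times> 'c nzvec word \<times> 'c nzvec word \<Rightarrow>\<^sub>0 'k)"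
    where "F a b j = tens (nc_S a) (tens (nc_S b) (nc_S j))" for a b j
  have "comult_left (nc_comult_S n) = (\<Sum>(i, j)\<in>vec_splits n. \<Sum>(a, b)\<in>vec_splits i. F a b j)"
    by (simp add: nc_comult_S_alt lin_sum[OF lin_comult_left[OF lin_ident]] comult_left_tens
        nc_comult_nc_S case_prod_unfold F_def lin_sum[OF lin_tens_assoc_comp[OF lin_ident]]
        lin_sum[OF lin_tens_left[OF lin_ident]] tens_assoc_tens)
  also have "\<dots> = (\<Sum>((i, j), (a, b))\<in>Sigma (vec_splits n) (\<lambda>(i, j). vec_splits i). F a b j)"
    by (subst sum.Sigma[symmetric]) (auto simp: case_prod_unfold)
  \<comment> \<open>Both index sets encode the decompositions of n as a + b + j, bracketed as (a +
    b) + j and as a + (b + j).\<close>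
  also have "\<dots> = (\<Sum>((a, k), (b, j))\<in>Sigma (vec_splits n) (\<lambda>(a, k). vec_splits k). F a b j)"
    by (rule sum.reindex_bij_witness[where
          i = "\<lambda>((a, k), (b, j)). ((\<lambda>c. a c + b c, j), (a, b))" and
          j = "\<lambda>((i, j), (a, b)). ((a, \<lambda>c. b c + j c), (b, j))"])
      (auto simp: vec_splits_def add.assoc intro!: ext, (metis add.assoc)+)
  also have "\<dots> = (\<Sum>(a, k)\<in>vec_splits n. \<Sum>(b, j)\<in>vec_splits k. F a b j)"
    by (subst sum.Sigma[symmetric]) (auto simp: case_prod_unfold)
  also have "\<dots> = comult_right (nc_comult_S n)"
    by (simp add: nc_comult_S_alt lin_sum[OF lin_comult_right[OF lin_ident]] comult_right_tens
        nc_comult_nc_S case_prod_unfold F_def lin_sum[OF lin_tens_right[OF lin_ident]])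
  finally show "comult_left (nc_comult (single (Word [v]) 1)) = comult_right (nc_comult (single (Word [v]) (1::'k)))"
    by (simp add: nc_comult_letter n_def)
qed (auto intro!: lin_comult_left lin_comult_right lin_nc_comult)

section \<open>The counit laws\<close>

definition counit_left :: "('c::finite nzvec word \<times> 'c nzvec word \<Rightarrow>\<^sub>0 'k::field) \<Rightarrow> ('c, 'k) ncsf" where
  "counit_left = bilin_extend (\<lambda>a b. scl (lookup a 0) b)"

definition counit_right :: "('c::finite nzvec word \<times> 'c nzvec word \<Rightarrow>\<^sub>0 'k::field) \<Rightarrow> ('c, 'k) ncsf" where
  "counit_right = bilin_extend (\<lambda>a b. scl (lookup b 0) a)"

lemma lin_scl_lookup: "lin f \<Longrightarrow> lin (\<lambda>x. scl (lookup (f x) b) y)"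
  by (auto intro!: linI simp: lin_add lin_scl lookup_add pm.scale_left_distrib)

lemma counit_left_tens: "counit_left (tens a b) = scl (lookup a 0) b"
  unfolding counit_left_def by (rule bilin_extend_tens) (auto intro!: lin_scl_lookup lin_intros)

lemma counit_right_tens: "counit_right (tens a b) = scl (lookup b 0) a"
  unfolding counit_right_def by (rule bilin_extend_tens) (auto intro!: lin_scl_lookup lin_intros)

lemma lin_counit_left: "lin f \<Longrightarrow> lin (\<lambda>x. counit_left (f x))"
  unfolding counit_left_def by (rule lin_bilin_extend_comp)

lemma lin_counit_right: "lin f \<Longrightarrow> lin (\<lambda>x. counit_right (f x))"
  unfolding counit_right_def by (rule lin_bilin_extend_comp)

lemma lookup_nc_S_0: "lookup (nc_S n) 0 = (if n = (\<lambda>_. 0) then 1 else 0)"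
  by (auto simp: nc_S_def lookup_single zero_word_def[symmetric])
     (simp add: zero_word_def)

lemma nc_counit_left:
  fixes x :: "('c::finite, 'k::field) ncsf"
  shows "counit_left (nc_comult x) = x"
proof (rule word_alg_hom_eqI[of "\<lambda>x. counit_left (nc_comult x)" "\<lambda>x. x"])
  show "counit_left (nc_comult (x * y)) = counit_left (nc_comult x) * counit_left (nc_comult y)"
    for x y :: "('c, 'k) ncsf"
    unfolding nc_comult_mult unfolding counit_left_def
    by (rule bilin_extend_mult) (simp add: lookup_mult_0 mult.commute)
  show "counit_left (nc_comult 1) = (1 :: ('c, 'k) ncsf)"
    by (simp add: nc_comult_one counit_left_tens lookup_one flip: tens_one)
  fix v :: "'c nzvec"
  \<comment> \<open>Only the splitting with i = 0 has a nonzero coefficient at the empty word, and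
    then j is the whole vector.\<close>
  have "counit_left (nc_comult_S (Rep_nzvec v)) =
      (\<Sum>(i, j)\<in>vec_splits (Rep_nzvec v). if (i, j) = (\<lambda>_. 0, Rep_nzvec v) then nc_S j else (0 :: ('c, 'k) ncsf))"
    unfolding nc_comult_S_alt lin_sum[OF lin_counit_left[OF lin_ident]]
    by (rule sum.cong) (auto simp: counit_left_tens lookup_nc_S_0 vec_splits_def fun_eq_iff)
  also have "\<dots> = (\<Sum>ij\<in>vec_splits (Rep_nzvec v). if ij = (\<lambda>_. 0, Rep_nzvec v) then nc_S (Rep_nzvec v) else 0)"
    by (rule sum.cong) (auto split: if_splits)
  also have "\<dots> = single (Word [v]) 1"
    by (subst sum.delta[OF finite_vec_splits]) (auto simp: vec_splits_def)
  finally show "counit_left (nc_comult (single (Word [v]) 1)) = single (Word [v]) (1::'k)"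
    by (simp add: nc_comult_letter)
qed (auto intro!: lin_counit_left lin_nc_comult)

lemma nc_counit_right:
  fixes x :: "('c::finite, 'k::field) ncsf"
  shows "counit_right (nc_comult x) = x"
proof (rule word_alg_hom_eqI[of "\<lambda>x. counit_right (nc_comult x)" "\<lambda>x. x"])
  show "counit_right (nc_comult (x * y)) = counit_right (nc_comult x) * counit_right (nc_comult y)"
    for x y :: "('c, 'k) ncsf"
    unfolding nc_comult_mult unfolding counit_right_def
    by (rule bilin_extend_mult) (simp add: lookup_mult_0 mult.commute)
  show "counit_right (nc_comult 1) = (1 :: ('c, 'k) ncsf)"
    by (simp add: nc_comult_one counit_right_tens lookup_one flip: tens_one)
  fix v :: "'c nzvec"
  have "counit_right (nc_comult_S (Rep_nzvec v)) =
      (\<Sum>(i, j)\<in>vec_splits (Rep_nzvec v). if (i, j) = (Rep_nzvec v, \<lambda>_. 0) then nc_S i else (0 :: ('c, 'k) ncsf))"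
    unfolding nc_comult_S_alt lin_sum[OF lin_counit_right[OF lin_ident]]
    by (rule sum.cong) (auto simp: counit_right_tens lookup_nc_S_0 vec_splits_def fun_eq_iff)
  also have "\<dots> = (\<Sum>ij\<in>vec_splits (Rep_nzvec v). if ij = (Rep_nzvec v, \<lambda>_. 0) then nc_S (Rep_nzvec v) else 0)"
    by (rule sum.cong) (auto split: if_splits)
  also have "\<dots> = single (Word [v]) 1"
    by (subst sum.delta[OF finite_vec_splits]) (auto simp: vec_splits_def)
  finally show "counit_right (nc_comult (single (Word [v]) 1)) = single (Word [v]) (1::'k)"
    by (simp add: nc_comult_letter)
qed (auto intro!: lin_counit_right lin_nc_comult)

lemma is_algebra_NCSF: "is_algebra (NCSF :: ('c::finite nzvec word, 'k::field) hopf)"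
  unfolding is_algebra_def is_subalgebra_def NCSF_def
  by (auto simp: Let_def linear_on_def algebra_simps)

text \<open>Nested lifts are removed from the inside outwards: each becomes the value of a linear
  map on the full tensor square, where the axioms are already known.\<close>

lemma is_coalgebra_NCSF: "is_coalgebra (NCSF :: ('c::finite nzvec word, 'k::field) hopf)"
proof -
  have inner: "tensor_lift UNIV UNIV (\<lambda>c d. tens c (tens d b)) t = tens_assoc (tens t b)"
    for t :: "'c nzvec word \<times> 'c nzvec word \<Rightarrow>\<^sub>0 'k" and b :: "('c, 'k) ncsf"
    by (rule tensor_lift_eq) (auto simp: tens_assoc_tens intro!: lin_tens_assoc_comp lin_intros)
  have "tensor_lift UNIV UNIV (\<lambda>a b. tensor_lift UNIV UNIV (\<lambda>c d. tens c (tens d b)) (nc_comult a)) t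
      = comult_left t" for t :: "'c nzvec word \<times> 'c nzvec word \<Rightarrow>\<^sub>0 'k"
    unfolding inner
    by (rule tensor_lift_eq) (auto simp: comult_left_tens intro!: lin_comult_left)
  moreover have "tensor_lift UNIV UNIV (\<lambda>a b. tens a (nc_comult b)) t = comult_right t"
    for t :: "'c nzvec word \<times> 'c nzvec word \<Rightarrow>\<^sub>0 'k"
    by (rule tensor_lift_eq) (auto simp: comult_right_tens intro!: lin_comult_right)
  moreover have "tensor_lift UNIV UNIV (\<lambda>a b. scl (lookup a 0) b) t = counit_left t"
    for t :: "'c nzvec word \<times> 'c nzvec word \<Rightarrow>\<^sub>0 'k"
    by (rule tensor_lift_eq) (auto simp: counit_left_tens intro!: lin_counit_left)
  moreover have "tensor_lift UNIV UNIV (\<lambda>a b. scl (lookup b 0) a) t = counit_right t"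
    for t :: "'c nzvec word \<times> 'c nzvec word \<Rightarrow>\<^sub>0 'k"
    by (rule tensor_lift_eq) (auto simp: counit_right_tens intro!: lin_counit_right)
  moreover have "linear_on UNIV (*) (\<lambda>x :: ('c, 'k) ncsf. lookup x 0)"
    by (auto simp: linear_on_def lookup_add)
  ultimately show ?thesis
    unfolding is_coalgebra_def NCSF_def
    by (simp add: Let_def linear_on_UNIV_iff lin_nc_comult nc_comult_coassoc nc_counit_left
        nc_counit_right)
qed

lemma is_bialgebra_NCSF: "is_bialgebra (NCSF :: ('c::finite nzvec word, 'k::field) hopf)"
  using is_algebra_NCSF is_coalgebra_NCSF unfolding is_bialgebra_def
  by (auto simp: Let_def NCSF_def tensor_mult_UNIV nc_comult_mult lookup_mult_0 nc_comult_one tens_one)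

section \<open>Grading and antipode\<close>

lemma word_degree_0 [simp]: "word_degree 0 = 0"
  by (simp add: word_degree_def zero_word_def)

lemma word_degree_add [simp]: "word_degree (u + v) = word_degree u + word_degree v"
  by (simp add: word_degree_def plus_word_def)

lemma word_degree_letter: "word_degree (Word [v]) = (\<Sum>c\<in>UNIV. Rep_nzvec v c)"
  by (simp add: word_degree_def)

lemma nzvec_degree_pos: "(\<Sum>c\<in>UNIV. Rep_nzvec (v :: 'c::finite nzvec) c) > 0"
proof -
  have "Rep_nzvec v \<noteq> (\<lambda>_. 0)" using Rep_nzvec[of v] by simp
  then obtain c where "Rep_nzvec v c \<noteq> 0" by auto
  then show ?thesis by (intro sum_pos2[of _ c]) auto
qed

text \<open>Letters are nonzero vectors, so the grading is connected; this is what makes the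
  antipode recursion terminate.\<close>

lemma word_degree_eq_0_iff [simp]: "word_degree w = 0 \<longleftrightarrow> w = 0"
proof (induction w rule: word_induct)
  case (add v w)
  then show ?case using nzvec_degree_pos[of v]
    by (auto simp: word_degree_letter simp del: sum_eq_0_iff) (simp add: zero_word_def)
qed auto

lemma keys_nc_S: "keys (nc_S n :: ('c::finite, 'k::field) ncsf) =
    {if n = (\<lambda>_. 0) then 0 else Word [Abs_nzvec n]}"
  by (simp add: nc_S_def)

lemma word_degree_nc_S: "w \<in> keys (nc_S n :: ('c::finite, 'k::field) ncsf) \<Longrightarrow> word_degree w = (\<Sum>c\<in>UNIV. n c)"
  by (auto simp: keys_nc_S word_degree_letter Abs_nzvec_inverse split: if_splits)

lemma keys_tens: "keys (tens x y) \<subseteq> keys x \<times> keys y"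
  by (auto simp: in_keys_iff)

text \<open>The support of a product lies in the sum of the supports, so a submonoid of pairs that
  contains the supports for the letters contains the one for the word.\<close>

lemma keys_nc_comult_word:
  fixes w :: "'c::finite nzvec word"
  assumes "(0, 0) \<in> A"
    and "\<And>p q. p \<in> A \<Longrightarrow> q \<in> A \<Longrightarrow> p + q \<in> A"
    and "\<And>v. v \<in> set (letters w) \<Longrightarrow> keys (nc_comult_S (Rep_nzvec v) :: _ \<Rightarrow>\<^sub>0 'k::field) \<subseteq> A"
  shows "keys (nc_comult (single w 1) :: _ \<Rightarrow>\<^sub>0 'k::field) \<subseteq> A"
  using assms(3)
proof (induction w rule: word_induct)
  case zero
  then show ?case using assms(1) by (simp add: nc_comult_one zero_prod_def)
next
  case (add v w)
  have IH: "keys (nc_comult (single w 1) :: _ \<Rightarrow>\<^sub>0 'k) \<subseteq> A"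
    and v: "keys (nc_comult_S (Rep_nzvec v) :: _ \<Rightarrow>\<^sub>0 'k) \<subseteq> A"
    using add by (auto simp: plus_word_def)
  have "nc_comult (single (Word [v] + w) (1::'k)) = nc_comult_S (Rep_nzvec v) * nc_comult (single w 1)"
    by (simp add: nc_comult_mult[symmetric] nc_comult_letter[symmetric] mult_single)
  moreover have "keys (nc_comult_S (Rep_nzvec v) * nc_comult (single w (1::'k))) \<subseteq> A"
    by (rule order_trans[OF keys_mult]) (use IH v assms(2) in blast)
  ultimately show ?case by simp
qed

lemma nc_comult_homogeneous:
  assumes "(u, v) \<in> keys (nc_comult (single w 1) :: _ \<Rightarrow>\<^sub>0 'k::field)"
  shows "word_degree u + word_degree v = word_degree w"
proof -
  have S: "(u, v) \<in> keys (nc_comult_S n :: _ \<Rightarrow>\<^sub>0 'k) \<Longrightarrow> word_degree u + word_degree v = (\<Sum>c\<in>UNIV. n c)"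
    for u v :: "'a nzvec word" and n
  proof -
    assume "(u, v) \<in> keys (nc_comult_S n :: _ \<Rightarrow>\<^sub>0 'k)"
    then obtain i j where ij: "(i, j) \<in> vec_splits n"
      and uv: "(u, v) \<in> keys (tens (nc_S i) (nc_S j) :: _ \<Rightarrow>\<^sub>0 'k)"
      unfolding nc_comult_S_alt using keys_sum by fastforce
    then have "word_degree u = (\<Sum>c\<in>UNIV. i c)" "word_degree v = (\<Sum>c\<in>UNIV. j c)"
      using keys_tens[of "nc_S i :: ('a, 'k) ncsf" "nc_S j"] by (auto intro!: word_degree_nc_S)
    then show ?thesis using ij by (auto simp: vec_splits_def sum.distrib[symmetric])
  qed
  show ?thesis using assms
  proof (induction w arbitrary: u v rule: word_induct)
    case zero
    then show ?case by (auto simp: nc_comult_one zero_prod_def)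
  next
    case (add l w)
    have "nc_comult (single (Word [l] + w) (1::'k)) = nc_comult_S (Rep_nzvec l) * nc_comult (single w 1)"
      by (simp add: nc_comult_mult[symmetric] nc_comult_letter[symmetric] mult_single)
    then show ?case
      using add.prems keys_mult[of "nc_comult_S (Rep_nzvec l)" "nc_comult (single w (1::'k))"]
      by (auto dest!: subsetD[of "keys _"] S add.IH simp: word_degree_letter)
  qed
qed

text \<open>The counit law read on coefficients: the pair \<open>(w, 0)\<close> occurs in the
  coproduct of w with coefficient 1, and every other term has a nonempty right factor.\<close>

lemma lookup_nc_comult_right_0: "lookup (nc_comult (single w 1)) (u, 0) = (if u = w then 1 else (0::'k::field))"
proof -
  have "lookup (counit_right t) u = lookup t (u, 0)" for t :: "_ \<Rightarrow>\<^sub>0 'k"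
  proof -
    have "lookup (counit_right t) u = (\<Sum>p\<in>keys t. if p = (u, 0) then lookup t (u, 0) else 0)"
      unfolding counit_right_def bilin_extend_def lookup_lin_extend
      by (rule sum.cong) (auto simp: lookup_single when_def split: if_splits)
    then show ?thesis by (auto simp: in_keys_iff)
  qed
  from this[of "nc_comult (single w 1)"] show ?thesis
    by (auto simp: nc_counit_right lookup_single)
qed

lemma lookup_nc_comult_left_0: "lookup (nc_comult (single w 1)) (0, u) = (if u = w then 1 else (0::'k::field))"
proof -
  have "lookup (counit_left t) u = lookup t (0, u)" for t :: "_ \<Rightarrow>\<^sub>0 'k"
  proof -
    have "lookup (counit_left t) u = (\<Sum>p\<in>keys t. if p = (0, u) then lookup t (0, u) else 0)"
      unfolding counit_left_def bilin_extend_def lookup_lin_extend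
      by (rule sum.cong) (auto simp: lookup_single when_def split: if_splits)
    then show ?thesis by (auto simp: in_keys_iff)
  qed
  from this[of "nc_comult (single w 1)"] show ?thesis
    by (auto simp: nc_counit_left lookup_single)
qed

section \<open>The convolution product, in which the antipode is the inverse of the identity\<close>

definition conv :: "(('c::finite, 'k::field) ncsf \<Rightarrow> ('c, 'k) ncsf) \<Rightarrow> (('c, 'k) ncsf \<Rightarrow> ('c, 'k) ncsf) \<Rightarrow>
    ('c, 'k) ncsf \<Rightarrow> ('c, 'k) ncsf" where
  "conv f g x = bilin_extend (\<lambda>a b. f a * g b) (nc_comult x)"

lemma lin_conv: "lin (conv f g)"
  unfolding conv_def by (intro lin_bilin_extend_comp lin_nc_comult)

abbreviation conv_unit :: "('c::finite, 'k::field) ncsf \<Rightarrow> ('c, 'k) ncsf" where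
  "conv_unit x \<equiv> scl (lookup x 0) 1"

lemma lin_conv_unit: "lin conv_unit"
  by (intro lin_scl_lookup lin_ident)

lemma conv_unit_left: "lin f \<Longrightarrow> conv conv_unit f x = f x"
proof -
  assume f: "lin f"
  have "bilin_extend (\<lambda>a b. conv_unit a * f b) t = f (counit_left t)" for t
  proof (rule lin_eqI[of "bilin_extend _"])
    show "lin (\<lambda>t. f (counit_left t))" by (intro lin_comp[OF f] lin_counit_left lin_ident)
  qed (auto simp: counit_left_def lin_scl[OF f, symmetric])
  then show ?thesis by (simp add: conv_def nc_counit_left)
qed

lemma conv_unit_right: "lin f \<Longrightarrow> conv f conv_unit x = f x"
proof -
  assume f: "lin f"
  have "bilin_extend (\<lambda>a b. f a * conv_unit b) t = f (counit_right t)" for t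
  proof (rule lin_eqI[of "bilin_extend _"])
    show "lin (\<lambda>t. f (counit_right t))" by (intro lin_comp[OF f] lin_counit_right lin_ident)
  qed (auto simp: counit_right_def lin_scl[OF f, symmetric])
  then show ?thesis by (simp add: conv_def nc_counit_right)
qed

lemma conv_assoc:
  fixes f g h :: "('c::finite, 'k::field) ncsf \<Rightarrow> ('c, 'k) ncsf"
  assumes f: "lin f" and g: "lin g" and h: "lin h"
  shows "conv (conv f g) h x = conv f (conv g h) x"
proof -
  \<comment> \<open>\<open>M\<close> is the triple product of f a, g b and h c on three tensor
    factors; the two sides are \<open>M\<close> after the two iterated coproducts.\<close>
  define M where "M = bilin_extend (\<lambda>a t. f a * bilin_extend (\<lambda>b c. g b * h c) t)"
  have M: "M (single (a, b, c) 1) = f (single a 1) * (g (single b 1) * h (single c 1))" for a b c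
    by (simp add: M_def)
  have linM2: "lin (\<lambda>x. M (k x))" if "lin k" for k
    unfolding M_def by (intro lin_bilin_extend_comp that)
  have "bilin_extend (\<lambda>a b. conv f g a * h b) t = M (comult_left t)" for t
  proof (rule lin_eqI[of "bilin_extend _"])
    fix p :: "'c nzvec word \<times> 'c nzvec word"
    obtain a b where p: "p = (a, b)" by force
    have "bilin_extend (\<lambda>a b. f a * g b) u * h (single b 1) = M (tens_assoc (tens u (single b 1)))" for u
    proof (rule lin_eqI[of "\<lambda>u. bilin_extend (\<lambda>a b. f a * g b) u * h (single b 1)"])
      fix q show "bilin_extend (\<lambda>a b. f a * g b) (single q 1) * h (single b 1) =
          M (tens_assoc (tens (single q 1) (single b 1)))"
        by (cases q) (simp add: tens_assoc_def M mult.assoc)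
    qed (intro lin_mult_left lin_bilin_extend_comp linM2 lin_tens_assoc_comp lin_tens_left lin_ident)+
    then show "bilin_extend (\<lambda>a b. conv f g a * h b) (single p 1) = M (comult_left (single p 1))"
      by (simp add: p comult_left_def conv_def)
  qed (auto intro!: linM2 lin_comult_left)
  moreover have "bilin_extend (\<lambda>a b. f a * conv g h b) t = M (comult_right t)" for t
  proof (rule lin_eqI[of "bilin_extend _"])
    fix p :: "'c nzvec word \<times> 'c nzvec word"
    obtain a b where p: "p = (a, b)" by force
    have "f (single a 1) * bilin_extend (\<lambda>b c. g b * h c) u = M (tens (single a 1) u)" for u
    proof (rule lin_eqI[of "\<lambda>u. f (single a 1) * bilin_extend (\<lambda>b c. g b * h c) u"])
      fix q show "f (single a 1) * bilin_extend (\<lambda>b c. g b * h c) (single q 1) = M (tens (single a 1) (single q 1))"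
        by (cases q) (simp add: M)
    qed (intro lin_mult_right lin_bilin_extend_comp linM2 lin_tens_right lin_ident)+
    then show "bilin_extend (\<lambda>a b. f a * conv g h b) (single p 1) = M (comult_right (single p 1))"
      by (simp add: p comult_right_def conv_def)
  qed (auto intro!: linM2 lin_comult_right)
  ultimately show ?thesis
    unfolding conv_def[of "conv f g"] conv_def[of f] by (simp add: nc_comult_coassoc)
qed

text \<open>The type argument fixes the field, because supports depend on it: the coproduct of the
  square of a generator of degree 1 has a term with coefficient 2, absent in characteristic
  2.\<close>

definition proper_terms :: "'k::field itself \<Rightarrow> 'c::finite nzvec word \<Rightarrow> ('c nzvec word \<times> 'c nzvec word) set" where
  "proper_terms _ w = {(u, v). (u, v) \<in> keys (nc_comult (single w 1) :: _ \<Rightarrow>\<^sub>0 'k) \<and> v \<noteq> 0}"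

definition proper_terms' :: "'k::field itself \<Rightarrow> 'c::finite nzvec word \<Rightarrow> ('c nzvec word \<times> 'c nzvec word) set" where
  "proper_terms' _ w = {(u, v). (u, v) \<in> keys (nc_comult (single w 1) :: _ \<Rightarrow>\<^sub>0 'k) \<and> u \<noteq> 0}"

lemma conv_word: "conv f g (single w 1) =
    (\<Sum>(u, v)\<in>keys (nc_comult (single w (1::'k))). scl (lookup (nc_comult (single w (1::'k::field))) (u, v))
        (f (single u 1) * g (single v 1)))"
  unfolding conv_def bilin_extend_def lin_extend_def by (simp add: case_prod_unfold)

lemma keys_split_proper:
  "keys (nc_comult (single w 1) :: _ \<Rightarrow>\<^sub>0 'k::field) = insert (w, 0) (proper_terms TYPE('k) w)"
  "keys (nc_comult (single w 1) :: _ \<Rightarrow>\<^sub>0 'k::field) = insert (0, w) (proper_terms' TYPE('k) w)"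
  "(w, 0) \<notin> proper_terms TYPE('k) w" "(0, w) \<notin> proper_terms' TYPE('k) w"
  by (auto simp: proper_terms_def proper_terms'_def in_keys_iff lookup_nc_comult_right_0
      lookup_nc_comult_left_0 split: if_splits)

lemma finite_proper [simp]:
  "finite (proper_terms (T :: 'k::field itself) w)" "finite (proper_terms' (T :: 'k itself) w)"
  by (rule finite_subset[of _ "keys (nc_comult (single w (1::'k)))"],
      auto simp: proper_terms_def proper_terms'_def)+

lemma word_degree_pos: "w \<noteq> 0 \<Longrightarrow> word_degree w > 0"
  by (rule gr0I) simp

lemma proper_terms_degree:
  fixes T :: "'k::field itself"
  shows "p \<in> proper_terms T w \<Longrightarrow> word_degree (fst p) < word_degree w"
  "p \<in> proper_terms' T w \<Longrightarrow> word_degree (snd p) < word_degree w"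
  using nc_comult_homogeneous[where ?'k = 'k, of "fst p" "snd p" w]
  by (auto simp: proper_terms_def proper_terms'_def dest!: word_degree_pos)

lemma conv_word_right:
  "conv f (\<lambda>x. x) (single w 1) = f (single w 1) + (\<Sum>(u, v)\<in>proper_terms TYPE('k) w.
      scl (lookup (nc_comult (single w (1::'k::field))) (u, v)) (f (single u 1) * single v 1))"
  unfolding conv_word by (subst keys_split_proper(1)) (simp add: keys_split_proper lookup_nc_comult_right_0)

lemma conv_word_left:
  "conv (\<lambda>x. x) f (single w 1) = f (single w 1) + (\<Sum>(u, v)\<in>proper_terms' TYPE('k) w.
      scl (lookup (nc_comult (single w (1::'k::field))) (u, v)) (single u 1 * f (single v 1)))"
  unfolding conv_word by (subst keys_split_proper(2)) (simp add: keys_split_proper lookup_nc_comult_left_0)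

text \<open>The equation for a left convolution inverse of the identity, solved for the value at w:
  in all other terms the left factor has smaller degree. \<open>antipode_r\<close> solves the
  mirrored equation.\<close>

function antipode_l :: "'c::finite nzvec word \<Rightarrow> ('c, 'k::field) ncsf" where
  "antipode_l w = conv_unit (single w 1) - (\<Sum>p\<in>proper_terms TYPE('k) w.
      scl (lookup (nc_comult (single w 1)) p) (antipode_l (fst p) * single (snd p) 1))"
  by pat_completeness simp
termination
  by (relation "measure word_degree") (simp, subst in_measure, erule proper_terms_degree(1))

declare antipode_l.simps [simp del]

function antipode_r :: "'c::finite nzvec word \<Rightarrow> ('c, 'k::field) ncsf" where
  "antipode_r w = conv_unit (single w 1) - (\<Sum>p\<in>proper_terms' TYPE('k) w.
      scl (lookup (nc_comult (single w 1)) p) (single (fst p) 1 * antipode_r (snd p)))"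
  by pat_completeness simp
termination
  by (relation "measure word_degree") (simp, subst in_measure, erule proper_terms_degree(2))

declare antipode_r.simps [simp del]

lemma conv_antipode_l: "conv (lin_extend antipode_l) (\<lambda>x. x) x = conv_unit x"
  by (rule lin_eqI[OF lin_conv lin_conv_unit])
    (subst conv_word_right, simp, subst antipode_l.simps, simp add: case_prod_unfold)

lemma conv_antipode_r: "conv (\<lambda>x. x) (lin_extend antipode_r) x = conv_unit x"
  by (rule lin_eqI[OF lin_conv lin_conv_unit])
    (subst conv_word_left, simp, subst antipode_r.simps, simp add: case_prod_unfold)

text \<open>In a monoid, a left inverse and a right inverse of one element coincide; here the monoid
  is convolution and the element is the identity map.\<close>

lemma antipode_l_eq_r:
  "lin_extend antipode_l x = (lin_extend antipode_r x :: ('c::finite, 'k::field) ncsf)"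
proof -
  let ?l = "lin_extend antipode_l :: ('c, 'k) ncsf \<Rightarrow> _"
    and ?r = "lin_extend antipode_r :: ('c, 'k) ncsf \<Rightarrow> _"
  have "?l x = conv ?l conv_unit x"
    by (simp add: conv_unit_right)
  also have "\<dots> = conv ?l (conv (\<lambda>x. x) ?r) x"
    by (simp add: conv_antipode_r[abs_def])
  also have "\<dots> = conv (conv ?l (\<lambda>x. x)) ?r x"
    by (simp add: conv_assoc)
  also have "\<dots> = conv conv_unit ?r x"
    by (simp add: conv_antipode_l[abs_def])
  also have "\<dots> = ?r x"
    by (simp add: conv_unit_left)
  finally show ?thesis .
qed

lemma is_antipode_NCSF_iff:
  fixes \<chi> :: "('c::finite, 'k::field) ncsf \<Rightarrow> ('c, 'k) ncsf"
  shows "is_antipode NCSF \<chi> \<longleftrightarrow> lin \<chi> \<and> (\<forall>x. conv \<chi> (\<lambda>x. x) x = conv_unit x)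
    \<and> (\<forall>x. conv (\<lambda>x. x) \<chi> x = conv_unit x)"
proof (cases "lin \<chi>")
  case True
  have "tensor_lift UNIV UNIV (\<lambda>a b. \<chi> a * b) t = bilin_extend (\<lambda>a b. \<chi> a * b) t"
    "tensor_lift UNIV UNIV (\<lambda>a b. a * \<chi> b) t = bilin_extend (\<lambda>a b. a * \<chi> b) t" for t
    by (rule tensor_lift_UNIV; intro lin_intros True)+
  then show ?thesis
    by (auto simp: is_antipode_def NCSF_def Let_def linear_on_UNIV_iff conv_def True)
qed (simp add: is_antipode_def NCSF_def linear_on_UNIV_iff)

lemma hopf_algebra_NCSF: "hopf_algebra (NCSF :: ('c::finite nzvec word, 'k::field) hopf)"
proof -
  have "is_antipode NCSF (lin_extend antipode_l :: ('c, 'k) ncsf \<Rightarrow> ('c, 'k) ncsf)"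
    unfolding is_antipode_NCSF_iff
    by (simp add: conv_antipode_l antipode_l_eq_r[abs_def] conv_antipode_r)
      (simp add: antipode_l_eq_r[abs_def, symmetric] conv_antipode_l)
  then show ?thesis unfolding hopf_algebra_def using is_bialgebra_NCSF by blast
qed

section \<open>The Hopf subalgebra of monochromatic words\<close>

definition mono_vec :: "nat \<Rightarrow> 'c \<Rightarrow> 'c \<Rightarrow> nat" where
  "mono_vec n i = (\<lambda>c. if c = i then n else 0)"

definition mono_words :: "'c::finite nzvec word set" where
  "mono_words = {w. \<forall>v\<in>set (letters w). \<exists>n i. n \<ge> 1 \<and> Rep_nzvec v = mono_vec n i}"

lemma mono_vec_0 [simp]: "mono_vec 0 i = (\<lambda>_. 0)"
  by (auto simp: mono_vec_def)

lemma mono_vec_eq_0_iff [simp]: "mono_vec n i = (\<lambda>_. 0) \<longleftrightarrow> n = 0"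
  by (auto simp: mono_vec_def fun_eq_iff)

lemma mono_S_conv: "mono_S n i = nc_S (mono_vec n i)"
  by (simp add: mono_S_def mono_vec_def)

lemma Rep_Abs_mono_vec [simp]: "n \<ge> 1 \<Longrightarrow> Rep_nzvec (Abs_nzvec (mono_vec n i)) = mono_vec n i"
  by (simp add: Abs_nzvec_inverse)

lemma mono_words_0 [simp]: "0 \<in> mono_words"
  by (simp add: mono_words_def zero_word_def)

lemma mono_words_add [simp]: "u + v \<in> mono_words \<longleftrightarrow> u \<in> mono_words \<and> v \<in> mono_words"
  by (auto simp: mono_words_def plus_word_def)

lemma mono_word_letter: "n \<noteq> 0 \<Longrightarrow> Word [Abs_nzvec (mono_vec n i)] \<in> mono_words"
  unfolding mono_words_def by (auto intro!: exI[of _ n] exI[of _ i])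

text \<open>Monochromatic words are closed under concatenation, and each of them is a product of
  generators, so the generated subalgebra is a coordinate subspace.\<close>

lemma MR_eq: "(MR :: ('c::finite, 'k::field) ncsf set) = {x. keys x \<subseteq> mono_words}"
proof
  have "is_subalgebra NCSF {x :: ('c, 'k) ncsf. keys x \<subseteq> mono_words}"
    unfolding is_subalgebra_def NCSF_def
  proof (simp, intro conjI allI impI)
    show "pm.subspace {x :: ('c, 'k) ncsf. keys x \<subseteq> mono_words}"
      unfolding pm_span_singles[symmetric] by simp
    fix x y :: "('c, 'k) ncsf"
    assume "keys x \<subseteq> mono_words" "keys y \<subseteq> mono_words"
    then show "keys (x * y) \<subseteq> mono_words"
      by (intro order_trans[OF keys_mult]) auto
  qed
  moreover have "{mono_S n i | n i. n \<ge> 1} \<subseteq> {x :: ('c, 'k) ncsf. keys x \<subseteq> mono_words}"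
    by (auto simp: mono_S_conv keys_nc_S mono_word_letter)
  ultimately show "(MR :: ('c, 'k) ncsf set) \<subseteq> {x. keys x \<subseteq> mono_words}"
    unfolding MR_def by (rule hull_minimal[rotated])
  have sub: "x \<in> A" if A: "is_subalgebra NCSF A" "{mono_S n i | n i. n \<ge> 1} \<subseteq> A"
    and x: "keys x \<subseteq> mono_words" for A and x :: "('c, 'k) ncsf"
  proof -
    have w: "w \<in> mono_words \<Longrightarrow> single w 1 \<in> A" for w
    proof (induction w rule: word_induct)
      case zero
      then show ?case using A(1) by (simp add: is_subalgebra_def NCSF_def)
    next
      case (add v w)
      then obtain n i where "n \<ge> 1" "Rep_nzvec v = mono_vec n i"
        by (auto simp: mono_words_def plus_word_def)
      then have "(single (Word [v]) 1 :: ('c, 'k) ncsf) = mono_S n i"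
        by (simp add: mono_S_conv flip: nc_S_Rep)
      then have "single (Word [v]) 1 \<in> A"
        using A(2) \<open>n \<ge> 1\<close> by auto
      then have "single (Word [v]) 1 * single w 1 \<in> A"
        using A(1) add by (simp add: is_subalgebra_def NCSF_def)
      then show ?case by (simp add: mult_single)
    qed
    have "x \<in> pm.span ((\<lambda>w. single w 1) ` mono_words)"
      using x by (simp add: pm_span_singles)
    also have "\<dots> \<subseteq> A"
      using A(1) w by (intro pm.span_minimal) (auto simp: is_subalgebra_def)
    finally show ?thesis .
  qed
  show "{x. keys x \<subseteq> mono_words} \<subseteq> (MR :: ('c, 'k) ncsf set)"
    unfolding MR_def hull_def using sub by auto
qed

lemma MR_span: "(MR :: ('c::finite, 'k::field) ncsf set) = pm.span ((\<lambda>w. single w 1) ` mono_words)"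
  by (simp add: MR_eq pm_span_singles)

lemma subspace_MR [simp]: "pm.subspace MR"
  by (simp add: MR_span)

lemma single_in_MR: "w \<in> mono_words \<Longrightarrow> single w c \<in> MR"
  by (auto simp: MR_eq)

lemma is_subalgebra_MR: "is_subalgebra NCSF (MR :: ('c::finite, 'k::field) ncsf set)"
proof -
  have "keys (x * y) \<subseteq> mono_words" if "keys x \<subseteq> mono_words" "keys y \<subseteq> mono_words"
    for x y :: "('c, 'k) ncsf"
    by (rule order_trans[OF keys_mult]) (use that in auto)
  then show ?thesis
    using subspace_MR[where ?'b = 'c and ?'a = 'k] unfolding is_subalgebra_def NCSF_def by (auto simp: MR_eq)
qed

lemma MR_mult: "x \<in> MR \<Longrightarrow> y \<in> MR \<Longrightarrow> x * y \<in> MR"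
  using is_subalgebra_MR by (auto simp: is_subalgebra_def NCSF_def)

text \<open>Natural numbers with sum 0 vanish, so no color other than i can enter either part. The
  coproduct stays monochromatic for this reason.\<close>

lemma vec_splits_mono:
  "vec_splits (mono_vec n i) = (\<lambda>p. (mono_vec p i, mono_vec (n - p) i)) ` {..n}"
proof safe
  fix a b assume ab: "(a, b) \<in> vec_splits (mono_vec n i)"
  then have *: "a c + b c = mono_vec n i c" for c by (auto simp: vec_splits_def)
  have "a i + b i = n" using *[of i] by (simp add: mono_vec_def)
  moreover have "a = mono_vec (a i) i" "b = mono_vec (b i) i"
    using * by (auto simp: mono_vec_def fun_eq_iff split: if_splits) (metis add_eq_0_iff_both_eq_0)+
  ultimately show "(a, b) \<in> (\<lambda>p. (mono_vec p i, mono_vec (n - p) i)) ` {..n}"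
    by (intro image_eqI[of _ _ "a i"]) auto
qed (auto simp: vec_splits_def mono_vec_def)

lemma nc_comult_S_mono:
  "nc_comult_S (mono_vec n i) = (\<Sum>p\<le>n. tens (nc_S (mono_vec p i)) (nc_S (mono_vec (n - p) i)))"
proof -
  have "inj_on (\<lambda>p. (mono_vec p i, mono_vec (n - p) i)) {..n}"
    by (rule inj_on_inverseI[of _ "\<lambda>(a, b). a i"]) (simp add: mono_vec_def)
  then show ?thesis
    unfolding nc_comult_S_alt vec_splits_mono by (simp add: sum.reindex)
qed

lemma nc_S_mono_in_MR: "(nc_S (mono_vec p i) :: ('c::finite, 'k::field) ncsf) \<in> MR"
  by (auto simp: MR_eq keys_nc_S mono_word_letter)

lemma keys_nc_comult_mono:
  assumes "w \<in> mono_words"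
  shows "keys (nc_comult (single w 1) :: _ \<Rightarrow>\<^sub>0 'k::field) \<subseteq> mono_words \<times> mono_words"
proof (rule keys_nc_comult_word)
  fix v assume "v \<in> set (letters w)"
  then obtain n i where "Rep_nzvec v = mono_vec n i"
    using assms by (auto simp: mono_words_def)
  moreover have "keys (tens (nc_S (mono_vec p i) :: (_, 'k) ncsf) (nc_S (mono_vec (n - p) i))) \<subseteq> mono_words \<times> mono_words" for p
    by (rule order_trans[OF keys_tens])
      (use nc_S_mono_in_MR[where ?'k = 'k] in \<open>auto simp: MR_eq\<close>)
  ultimately show "keys (nc_comult_S (Rep_nzvec v) :: _ \<Rightarrow>\<^sub>0 'k) \<subseteq> mono_words \<times> mono_words"
    unfolding nc_comult_S_mono \<open>Rep_nzvec v = mono_vec n i\<close> 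
    by (intro order_trans[OF keys_sum]) auto
qed auto

lemma nc_comult_MR:
  assumes "x \<in> MR" shows "nc_comult x \<in> tensor_space MR MR"
proof (rule tensor_space_keys)
  show "keys (nc_comult x) \<subseteq> mono_words \<times> mono_words"
  proof -
    have "keys (nc_comult x) = keys (lin_extend (\<lambda>w. nc_comult (single w 1)) x)"
      by (subst lin_eq_lin_extend[OF lin_nc_comult]) (rule refl)
    also have "\<dots> \<subseteq> (\<Union>w\<in>keys x. keys (nc_comult (single w 1) :: _ \<Rightarrow>\<^sub>0 'b))"
      by (rule keys_lin_extend)
    also have "\<dots> \<subseteq> mono_words \<times> mono_words"
      using assms keys_nc_comult_mono[where ?'k = 'b] unfolding MR_eq by blast
    finally show ?thesis .
  qed
qed (auto intro: single_in_MR)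

lemma antipode_MR:
  fixes \<chi> :: "('c::finite, 'k::field) ncsf \<Rightarrow> ('c, 'k) ncsf"
  assumes \<chi>: "is_antipode NCSF \<chi>" and x: "x \<in> MR"
  shows "\<chi> x \<in> MR"
proof -
  have lin: "lin \<chi>" and conv: "conv \<chi> (\<lambda>x. x) x = conv_unit x" for x
    using \<chi> by (auto simp: is_antipode_NCSF_iff)
  have w: "w \<in> mono_words \<Longrightarrow> \<chi> (single w 1) \<in> MR" for w
  proof (induction w rule: measure_induct_rule[of word_degree])
    case (less w)
    \<comment> \<open>The left convolution identity, solved for the value at w; the remaining values
      of \<chi> are at monochromatic words of smaller degree.\<close>
    have "\<chi> (single w 1) = conv_unit (single w 1) - (\<Sum>(u, v)\<in>proper_terms TYPE('k) w.
      scl (lookup (nc_comult (single w (1::'k))) (u, v)) (\<chi> (single u 1) * single v 1))"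
      using conv_word_right[of \<chi> w] by (simp add: conv)
    also have "\<dots> \<in> MR"
    proof (intro pm.subspace_diff pm.subspace_sum pm.subspace_scale subspace_MR, safe)
      show "(1 :: ('c, 'k) ncsf) \<in> MR" by (simp add: MR_eq)
      fix u v assume uv: "(u, v) \<in> proper_terms TYPE('k) w"
      then have "u \<in> mono_words" "v \<in> mono_words"
        using keys_nc_comult_mono[OF less.prems, where ?'k = 'k] by (auto simp: proper_terms_def)
      then show "scl (lookup (nc_comult (single w (1::'k))) (u, v)) (\<chi> (single u 1) * single v 1) \<in> MR"
        using less.IH proper_terms_degree(1)[OF uv] fst_conv
        by (intro MR_mult single_in_MR pm.subspace_scale subspace_MR) auto
    qed
    finally show ?case .
  qed
  have "\<chi> x = lin_extend (\<lambda>w. \<chi> (single w 1)) x" by (rule lin_eq_lin_extend[OF lin])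
  also have "\<dots> \<in> MR"
    unfolding lin_extend_def using x w
    by (intro pm.subspace_sum pm.subspace_scale subspace_MR) (auto simp: MR_eq)
  finally show ?thesis .
qed

theorem hopf_subalgebra_MR: "hopf_subalgebra (MR :: ('c::finite, 'k::field) ncsf set) NCSF"
  unfolding hopf_subalgebra_def
  using hopf_algebra_NCSF is_subalgebra_MR antipode_MR nc_comult_MR
  by (auto simp: NCSF_def) 

section \<open>Expansion of products of monomial quasi-symmetric functions\<close>

text \<open>The degree is a parameter, since total degree and degree in a single row are both used,
  in either factor of a pair of monomials.\<close>

definition homog :: "('m \<Rightarrow> nat) \<Rightarrow> nat \<Rightarrow> ('m \<Rightarrow>\<^sub>0 'k::zero) \<Rightarrow> bool" where
  "homog D d x \<longleftrightarrow> (\<forall>m\<in>keys x. D m = d)"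

lemma homog_mult:
  fixes x y :: "'m::monoid_add \<Rightarrow>\<^sub>0 'k::field"
  assumes "\<And>m m'. D (m + m') = D m + D m'" "homog D d x" "homog D e y"
  shows "homog D (d + e) (x * y)"
  using keys_mult[of x y] assms unfolding homog_def by fastforce

lemma homog_one: "D 0 = 0 \<Longrightarrow> homog D 0 (1 :: 'm::monoid_add \<Rightarrow>\<^sub>0 'k::field)"
  by (simp add: homog_def)

lemma homog_power:
  fixes x :: "'m::monoid_add \<Rightarrow>\<^sub>0 'k::field"
  assumes "\<And>m m'. D (m + m') = D m + D m'" "D 0 = 0" "homog D d x"
  shows "homog D (n * d) (x ^ n)"
  by (induction n) (auto intro!: homog_mult homog_one assms)

lemma homog_prod:
  fixes x :: "'i \<Rightarrow> 'm::comm_monoid_add \<Rightarrow>\<^sub>0 'k::field"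
  assumes "\<And>m m'. D (m + m') = D m + D m'" "D 0 = 0" "\<And>i. i \<in> A \<Longrightarrow> homog D (d i) (x i)"
  shows "homog D (\<Sum>i\<in>A. d i) (\<Prod>i\<in>A. x i)"
  using assms(3)
  by (induction A rule: infinite_finite_induct) (auto intro!: homog_mult homog_one assms(1,2))

definition vec_degree :: "'c::finite nzvec \<Rightarrow> nat" where
  "vec_degree v = (\<Sum>c\<in>UNIV. Rep_nzvec v c)"

lemma vec_degree_pos [simp]: "vec_degree v > 0"
  unfolding vec_degree_def by (rule nzvec_degree_pos)

lemma word_degree_alt: "word_degree w = (\<Sum>k<length (letters w). vec_degree (letters w ! k))"
  by (simp add: word_degree_def vec_degree_def[symmetric] sum_list_sum_nth atLeast0LessThan)

lemma M_term_homog: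
  fixes t :: "'i \<Rightarrow> 'c::finite \<Rightarrow> ('m::comm_monoid_add \<Rightarrow>\<^sub>0 'k::field)"
  assumes D: "\<And>m m'. D (m + m') = D m + D m'" "D 0 = 0" and t: "\<And>i c. homog D (d i) (t i c)"
  shows "homog D (\<Sum>k<length (letters K). vec_degree (letters K ! k) * d (js ! k)) (M_term t K js)"
  unfolding M_term_def vec_degree_def sum_distrib_right
  by (intro homog_prod homog_power D t)

text \<open>Each term is a product of powers of letters of the alphabet, so a unital multiplicative
  map may be pushed into the alphabet. It serves for relabelling rows and for annihilating
  variables.\<close>

lemma M_term_hom:
  fixes F :: "('m::comm_monoid_add \<Rightarrow>\<^sub>0 'k::field) \<Rightarrow> ('n::comm_monoid_add \<Rightarrow>\<^sub>0 'k)"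
  assumes "\<And>x y. F (x * y) = F x * F y" "F 1 = 1"
  shows "F (M_term t K js) = M_term (\<lambda>i c. F (t i c)) K js"
proof -
  have prod: "F (\<Prod>a\<in>A. g a) = (\<Prod>a\<in>A. F (g a))" for g :: "'z \<Rightarrow> _" and A
    by (induction A rule: infinite_finite_induct) (auto simp: assms)
  have power: "F (x ^ n) = F x ^ n" for x n
    by (induction n) (auto simp: assms)
  show ?thesis unfolding M_term_def prod power ..
qed

lemma M_term_map: "length js = length (letters K) \<Longrightarrow> M_term t K (map g js) = M_term (\<lambda>i. t (g i)) K js"
  by (simp add: M_term_def)

definition row_deg :: "nat \<Rightarrow> 'c::finite monomial \<Rightarrow> nat" where
  "row_deg r m = (\<Sum>c\<in>UNIV. lookup m (r, c))"

lemma row_deg_add [simp]: "row_deg r (m + m') = row_deg r m + row_deg r m'"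
  by (simp add: row_deg_def lookup_add sum.distrib)

lemma row_deg_0 [simp]: "row_deg r 0 = 0"
  by (simp add: row_deg_def)

lemma row_deg_single [simp]: "row_deg r (single (s, c) n) = (if r = s then n else 0)"
  by (simp add: row_deg_def lookup_single when_def)

lemma row_deg_pos_iff: "row_deg r m > 0 \<longleftrightarrow> r \<in> fst ` keys m"
proof -
  have "row_deg r m > 0 \<longleftrightarrow> (\<exists>c. lookup m (r, c) \<noteq> 0)"
    by (auto simp: row_deg_def intro: sum_pos2 simp flip: neq0_conv)
  then show ?thesis by (force simp: in_keys_iff)
qed

definition tot_deg :: "'a monomial \<Rightarrow> nat" where
  "tot_deg m = (\<Sum>b\<in>keys m. lookup m b)"

lemma tot_deg_add [simp]: "tot_deg (m + m') = tot_deg m + tot_deg m'"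
  unfolding tot_deg_def by (rule setsum_keys_plus_distrib) auto

lemma tot_deg_0 [simp]: "tot_deg 0 = 0"
  by (simp add: tot_deg_def)

lemma tot_deg_single [simp]: "tot_deg (single b n) = n"
  by (simp add: tot_deg_def)

lemma tot_deg_sum: "tot_deg (sum f A) = (\<Sum>a\<in>A. tot_deg (f a))"
  by (induction A rule: infinite_finite_induct) auto

lemma prod_alphabet_alt: "prod_alphabet G rs \<gamma> =
    (\<Sum>(\<alpha>, \<beta>)\<in>{(\<alpha>, \<beta>). \<alpha> \<otimes>\<^bsub>G\<^esub> \<beta> = \<gamma>}. single (single (fst rs, \<alpha>) 1, single (snd rs, \<beta>) 1) 1)"
  by (simp add: prod_alphabet_def var_def)

lemma keys_prod_alphabet:
  "keys (prod_alphabet G rs \<gamma> :: _ \<Rightarrow>\<^sub>0 'k::field)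
    \<subseteq> {(single (fst rs, \<alpha>) 1, single (snd rs, \<beta>) 1) | \<alpha> \<beta>. True}"
  unfolding prod_alphabet_alt by (rule order_trans[OF keys_sum]) auto

lemma prod_alphabet_homog:
  "homog (\<lambda>p. row_deg r (fst p)) (if r = fst rs then 1 else 0) (prod_alphabet G rs \<gamma> :: _ \<Rightarrow>\<^sub>0 'k::field)"
  "homog (\<lambda>p. row_deg r (snd p)) (if r = snd rs then 1 else 0) (prod_alphabet G rs \<gamma> :: _ \<Rightarrow>\<^sub>0 'k::field)"
  "homog (\<lambda>p. tot_deg (fst p)) 1 (prod_alphabet G rs \<gamma> :: _ \<Rightarrow>\<^sub>0 'k::field)"
  "homog (\<lambda>p. tot_deg (snd p)) 1 (prod_alphabet G rs \<gamma> :: _ \<Rightarrow>\<^sub>0 'k::field)"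
  using keys_prod_alphabet[of G rs \<gamma>, where ?'k = 'k] by (auto simp: homog_def)

lemma M_term_alphabet_degrees:
  assumes "lookup (M_term (prod_alphabet G) K js :: _ \<Rightarrow>\<^sub>0 'k::field) (m, m') \<noteq> 0"
  shows "row_deg r m = (\<Sum>k<length (letters K). vec_degree (letters K ! k) * (if r = fst (js ! k) then 1 else 0))"
    and "row_deg r m' = (\<Sum>k<length (letters K). vec_degree (letters K ! k) * (if r = snd (js ! k) then 1 else 0))"
    and "tot_deg m = word_degree K" and "tot_deg m' = word_degree K"
proof -
  have in_keys: "(m, m') \<in> keys (M_term (prod_alphabet G) K js :: _ \<Rightarrow>\<^sub>0 'k)"
    using assms by (simp add: in_keys_iff)
  show "row_deg r m = (\<Sum>k<length (letters K). vec_degree (letters K ! k) * (if r = fst (js ! k) then 1 else 0))"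
    using M_term_homog[of "\<lambda>p. row_deg r (fst p)" "\<lambda>rs. if r = fst rs then 1 else 0"
        "prod_alphabet G :: _ \<Rightarrow> _ \<Rightarrow> _ \<Rightarrow>\<^sub>0 'k" K js, OF _ _ prod_alphabet_homog(1)] in_keys
    by (fastforce simp: homog_def)
  show "row_deg r m' = (\<Sum>k<length (letters K). vec_degree (letters K ! k) * (if r = snd (js ! k) then 1 else 0))"
    using M_term_homog[of "\<lambda>p. row_deg r (snd p)" "\<lambda>rs. if r = snd rs then 1 else 0"
        "prod_alphabet G :: _ \<Rightarrow> _ \<Rightarrow> _ \<Rightarrow>\<^sub>0 'k" K js, OF _ _ prod_alphabet_homog(2)] in_keys
    by (fastforce simp: homog_def)
  show "tot_deg m = word_degree K"
    using M_term_homog[of "\<lambda>p. tot_deg (fst p)" "\<lambda>rs. 1"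
        "prod_alphabet G :: _ \<Rightarrow> _ \<Rightarrow> _ \<Rightarrow>\<^sub>0 'k" K js, OF _ _ prod_alphabet_homog(3)] in_keys
    by (fastforce simp: homog_def word_degree_alt)
  show "tot_deg m' = word_degree K"
    using M_term_homog[of "\<lambda>p. tot_deg (snd p)" "\<lambda>rs. 1"
        "prod_alphabet G :: _ \<Rightarrow> _ \<Rightarrow> _ \<Rightarrow>\<^sub>0 'k" K js, OF _ _ prod_alphabet_homog(4)] in_keys
    by (fastforce simp: homog_def word_degree_alt)
qed

text \<open>Letters of K have positive degree, so every index listed in js leaves a trace in the
  monomials. Index lists can thus be pulled back along a relabelling of the rows.\<close>

lemma M_term_alphabet_rows:
  assumes "lookup (M_term (prod_alphabet G) K js :: _ \<Rightarrow>\<^sub>0 'k::field) (m, m') \<noteq> 0" "k < length (letters K)"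
  shows "fst (js ! k) \<in> fst ` keys m" "snd (js ! k) \<in> fst ` keys m'"
proof -
  have "row_deg (fst (js ! k)) m > 0"
    unfolding M_term_alphabet_degrees(1)[OF assms(1)]
    by (rule sum_pos2[of _ k]) (use assms(2) in auto)
  then show "fst (js ! k) \<in> fst ` keys m" by (simp only: row_deg_pos_iff)
  have "row_deg (snd (js ! k)) m' > 0"
    unfolding M_term_alphabet_degrees(2)[OF assms(1)]
    by (rule sum_pos2[of _ k]) (use assms(2) in auto)
  then show "snd (js ! k) \<in> fst ` keys m'" by (simp only: row_deg_pos_iff)
qed

subsection \<open>Quasi-symmetry\<close>

definition relabel :: "(nat \<Rightarrow> nat) \<Rightarrow> 'c monomial \<Rightarrow> 'c monomial" where
  "relabel \<psi> m = (\<Sum>b\<in>keys m. single (\<psi> (fst b), snd b) (lookup m b))"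

lemma relabel_add: "relabel \<psi> (m + m') = relabel \<psi> m + relabel \<psi> m'"
  unfolding relabel_def by (rule setsum_keys_plus_distrib) (auto simp: single_add)

lemma relabel_0 [simp]: "relabel \<psi> 0 = 0"
  by (simp add: relabel_def)

lemma relabel_single [simp]: "relabel \<psi> (single (r, c) n) = single (\<psi> r, c) n"
  by (simp add: relabel_def)

lemma relabel_sum: "relabel \<psi> (sum f A) = (\<Sum>a\<in>A. relabel \<psi> (f a))"
  by (induction A rule: infinite_finite_induct) (auto simp: relabel_add)

lemma lookup_relabel:
  assumes "inj \<psi>" shows "lookup (relabel \<psi> m) (\<psi> r, c) = lookup m (r, c)"
proof -
  have "lookup (relabel \<psi> m) (\<psi> r, c) = (\<Sum>b\<in>keys m. if b = (r, c) then lookup m (r, c) else 0)"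
    unfolding relabel_def lookup_sum
    by (rule sum.cong) (auto simp: lookup_single when_def inj_eq[OF assms])
  then show ?thesis by (auto simp: in_keys_iff)
qed

lemma keys_relabel: "fst ` keys (relabel \<psi> m) \<subseteq> range \<psi>"
  unfolding relabel_def using keys_sum[of "\<lambda>b. single (\<psi> (fst b), snd b) (lookup m b)" "keys m"]
  by (auto split: if_splits)

lemma inj_relabel: "inj \<psi> \<Longrightarrow> inj (relabel \<psi>)"
  by (rule injI, rule poly_mapping_eqI) (metis lookup_relabel surj_pair)

lemma lex_strict_mono:
  assumes "strict_mono \<psi>" "strict_mono \<psi>'"
  shows "(map_prod \<psi> \<psi>' p, map_prod \<psi> \<psi>' q) \<in> less_than <*lex*> less_than \<longleftrightarrow>
    (p, q) \<in> less_than <*lex*> less_than"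
  by (cases p; cases q) (auto simp: strict_mono_less[OF assms(1)] strict_mono_less[OF assms(2)]
      strict_mono_eq[OF assms(1)])

lemma M_term_relabel:
  fixes K :: "'c::finite nzvec word"
  assumes "inj \<psi>" "inj \<psi>'" "length js = length (letters K)"
  shows "lookup (M_term (prod_alphabet G) K (map (map_prod \<psi> \<psi>') js) :: _ \<Rightarrow>\<^sub>0 'k::field)
      (relabel \<psi> m, relabel \<psi>' m') = lookup (M_term (prod_alphabet G) K js :: _ \<Rightarrow>\<^sub>0 'k) (m, m')"
proof -
  define F where "F = lin_extend (\<lambda>p :: 'c monomial \<times> 'c monomial.
    single (map_prod (relabel \<psi>) (relabel \<psi>') p) (1::'k))"
  have "F (prod_alphabet G rs \<gamma>) = prod_alphabet G (map_prod \<psi> \<psi>' rs) \<gamma>" for rs \<gamma>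
    unfolding F_def prod_alphabet_alt by (simp add: lin_sum case_prod_unfold)
  moreover have "F (M_term (prod_alphabet G) K js) = M_term (\<lambda>rs \<gamma>. F (prod_alphabet G rs \<gamma>)) K js"
  proof (rule M_term_hom)
    show "F (x * y) = F x * F y" for x y
      unfolding F_def
      by (rule lin_extend_mult) (auto simp: mult_single relabel_add plus_prod_def)
    show "F 1 = 1" by (simp add: F_def lin_extend_one zero_prod_def) (simp flip: zero_prod_def)
  qed
  ultimately have "M_term (prod_alphabet G) K (map (map_prod \<psi> \<psi>') js) = F (M_term (prod_alphabet G) K js)"
    by (simp add: M_term_map assms(3))
  moreover have "lookup (F x) (map_prod (relabel \<psi>) (relabel \<psi>') (m, m')) = lookup x (m, m')" for x
    unfolding F_def
    by (rule lookup_lin_extend_inj) (intro prod.inj_map inj_relabel assms)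
  ultimately show ?thesis by simp
qed

text \<open>Quasi-symmetry of \<open>\<delta>(M_K)\<close> in each alphabet: an increasing
  relabelling preserves the lexicographic order and matches the index lists that contribute on the
  two sides.\<close>

lemma delta_M_relabel:
  assumes "strict_mono \<psi>" "strict_mono \<psi>'"
  shows "(delta_M G K (relabel \<psi> m, relabel \<psi>' m') :: 'k::field) = delta_M G K (m, m')"
proof -
  define A where "A m m' = {js. length js = length (letters K) \<and>
      sorted_wrt (\<lambda>p q. (p, q) \<in> less_than <*lex*> less_than) js \<and>
      lookup (M_term (prod_alphabet G) K js :: _ \<Rightarrow>\<^sub>0 'k) (m, m') \<noteq> 0}" for m m'
  define g where "g = map (map_prod \<psi> \<psi>')"
  have inj: "inj \<psi>" "inj \<psi>'" using assms by (auto dest: strict_mono_imp_inj_on)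
  have A: "js \<in> A m m' \<longleftrightarrow> g js \<in> A (relabel \<psi> m) (relabel \<psi>' m')" for js
    using M_term_relabel[OF inj, of js K G m m', where ?'k = 'k]
    by (auto simp: A_def g_def sorted_wrt_map lex_strict_mono[OF assms])
  have "A (relabel \<psi> m) (relabel \<psi>' m') = g ` A m m'"
  proof
    show "A (relabel \<psi> m) (relabel \<psi>' m') \<subseteq> g ` A m m'"
    proof
      fix js assume js: "js \<in> A (relabel \<psi> m) (relabel \<psi>' m')"
      \<comment> \<open>A list contributing to relabelled monomials only uses indices in the ranges
        of \<psi> and \<psi>', so a one-sided inverse recovers it.\<close>
      have "map_prod \<psi> \<psi>' (map_prod (inv_into UNIV \<psi>) (inv_into UNIV \<psi>') (js ! k)) = js ! k" if "k < length js" for k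
      proof -
        have "fst (js ! k) \<in> range \<psi>" "snd (js ! k) \<in> range \<psi>'"
          using M_term_alphabet_rows[of G K js "relabel \<psi> m" "relabel \<psi>' m'" k, where ?'k = 'k]
            keys_relabel[of \<psi> m] keys_relabel[of \<psi>' m'] js that by (auto simp: A_def)
        then show ?thesis by (cases "js ! k") (auto simp: f_inv_into_f)
      qed
      then have "js = g (map (map_prod (inv_into UNIV \<psi>) (inv_into UNIV \<psi>')) js)"
        by (auto simp: g_def list_eq_iff_nth_eq)
      with js A show "js \<in> g ` A m m'" by (metis image_eqI)
    qed
  qed (use A in auto)
  moreover have "inj g" unfolding g_def using inj by (simp add: prod.inj_map)
  ultimately show ?thesis
    unfolding delta_M_def M_on_def A_def[symmetric]
    by (simp add: sum.reindex inj_on_subset)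
      (rule sum.cong, auto simp: A_def g_def M_term_relabel[OF inj])
qed

section \<open>Monomials occurring in the monomial quasi-symmetric functions\<close>

definition word_mon :: "'c::finite nzvec word \<Rightarrow> nat list \<Rightarrow> 'c monomial" where
  "word_mon I js = (\<Sum>k<length (letters I). \<Sum>c\<in>UNIV. single (js ! k, c) (Rep_nzvec (letters I ! k) c))"

text \<open>The exponents \<open>I\<close> sit in the first rows without gaps. Among all
  \<open>M_J\<close> only \<open>M_I\<close> contains this monomial, so evaluation at it extracts a
  coordinate.\<close>

definition canon_mon :: "'c::finite nzvec word \<Rightarrow> 'c monomial" where
  "canon_mon I = word_mon I [0..<length (letters I)]"

lemma lookup_word_mon:
  "lookup (word_mon I js) (r, c) = (\<Sum>k<length (letters I). if js ! k = r then Rep_nzvec (letters I ! k) c else 0)"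
proof -
  have *: "(\<Sum>d\<in>UNIV. lookup (single (s, d) (f d)) (r, c)) = (if s = r then f c else 0)"
    for s and f :: "'a \<Rightarrow> nat"
  proof -
    have "(\<Sum>d\<in>UNIV. lookup (single (s, d) (f d)) (r, c)) = (\<Sum>d\<in>UNIV. if d = c then if s = r then f c else 0 else 0)"
      by (rule sum.cong) (auto simp: lookup_single when_def)
    then show ?thesis by simp
  qed
  show ?thesis unfolding word_mon_def lookup_sum * ..
qed

lemma lookup_word_mon_nth:
  assumes "distinct js" "length js = length (letters I)" "k < length js"
  shows "lookup (word_mon I js) (js ! k, c) = Rep_nzvec (letters I ! k) c"
proof -
  have "lookup (word_mon I js) (js ! k, c) =
      (\<Sum>i<length (letters I). if i = k then Rep_nzvec (letters I ! k) c else 0)"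
    unfolding lookup_word_mon using assms
    by (intro sum.cong) (auto simp: nth_eq_iff_index_eq)
  then show ?thesis using assms by simp
qed

lemma lookup_word_mon_notin:
  assumes "length js = length (letters I)" "r \<notin> set js"
  shows "lookup (word_mon I js) (r, c) = 0"
  unfolding lookup_word_mon using assms by (intro sum.neutral) (auto simp: in_set_conv_nth)

lemma word_mon_rows:
  assumes "distinct js" "length js = length (letters I)"
  shows "fst ` keys (word_mon I js) = set js"
proof
  show "fst ` keys (word_mon I js) \<subseteq> set js"
    using lookup_word_mon_notin[OF assms(2)] by (force simp: in_keys_iff)
  show "set js \<subseteq> fst ` keys (word_mon I js)"
  proof
    fix r assume "r \<in> set js"
    then obtain k where k: "k < length js" "r = js ! k" by (auto simp: in_set_conv_nth)
    have "Rep_nzvec (letters I ! k) \<noteq> (\<lambda>_. 0)" using Rep_nzvec[of "letters I ! k"] by simp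
    then obtain c where "Rep_nzvec (letters I ! k) c \<noteq> 0" by auto
    then have "(r, c) \<in> keys (word_mon I js)"
      using lookup_word_mon_nth[OF assms k(1), of c] by (simp add: in_keys_iff k(2))
    then show "r \<in> fst ` keys (word_mon I js)" by force
  qed
qed

text \<open>Letters are nonzero, so the occupied rows are exactly the entries of js; sortedness
  recovers their order, and the exponents in these rows are the letters.\<close>

lemma word_mon_inject:
  assumes "sorted_wrt (<) js" "length js = length (letters I)"
    and "sorted_wrt (<) js'" "length js' = length (letters J)"
    and eq: "word_mon I js = word_mon J js'"
  shows "js = js' \<and> I = J"
proof -
  have d: "distinct js" "distinct js'" "sorted js" "sorted js'"
    using assms by (auto simp: strict_sorted_iff)
  have "set js = set js'"
    using word_mon_rows[OF d(1) assms(2)] word_mon_rows[OF d(2) assms(4)] eq by simp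
  then have js: "js = js'" using d by (simp add: sorted_distinct_set_unique)
  moreover have "letters I ! k = letters J ! k" if "k < length js" for k
    using lookup_word_mon_nth[OF d(1) assms(2) that] lookup_word_mon_nth[OF d(2) assms(4)] that eq js
    by (metis Rep_nzvec_inject ext)
  ultimately have "letters I = letters J"
    using assms by (auto simp: list_eq_iff_nth_eq)
  then show ?thesis using js by (cases I; cases J) auto
qed

lemma relabel_word_mon: "length js = length (letters I) \<Longrightarrow> relabel \<psi> (word_mon I js) = word_mon I (map \<psi> js)"
  by (simp add: word_mon_def relabel_sum)

lemma relabel_canon_mon: "relabel \<psi> (canon_mon I) = word_mon I (map \<psi> [0..<length (letters I)])"
  by (simp add: canon_mon_def relabel_word_mon)

lemma tot_deg_word_mon: "tot_deg (word_mon I js) = word_degree I"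
  by (simp add: word_mon_def tot_deg_sum word_degree_alt vec_degree_def)

lemma M_term_var: "M_term var I js = single (word_mon I js) (1::'k::field)"
proof -
  have power: "single m (1::'k) ^ n = single (\<Sum>i<n. m) 1" for m :: "'b monomial" and n
    by (induction n) (simp_all add: mult_single add.commute)
  have prod: "(\<Prod>a\<in>A. single (f a) (1::'k)) = single (sum f A) 1" for f :: "'z \<Rightarrow> 'b monomial" and A
    by (induction A rule: infinite_finite_induct) (simp_all add: mult_single)
  have n: "(\<Sum>i<n. single b 1) = single b n" for b :: "nat \<times> 'b" and n :: nat
    by (induction n) (simp_all flip: single_add)
  show ?thesis
    unfolding M_term_def word_mon_def var_def power prod n ..
qed

lemma qsym_M_word_mon:
  assumes "sorted_wrt (<) js" "length js = length (letters I)"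
  shows "(qsym_M J (word_mon I js) :: 'k::field) = (if J = I then 1 else 0)"
proof -
  have "(qsym_M J (word_mon I js) :: 'k) = (\<Sum>js'\<in>{js'. length js' = length (letters J) \<and> sorted_wrt (<) js'
      \<and> word_mon J js' = word_mon I js}. 1)"
    unfolding qsym_M_def M_on_def M_term_var
    by (rule sum.cong) (auto simp: lookup_single when_def)
  also have "{js'. length js' = length (letters J) \<and> sorted_wrt (<) js'
      \<and> word_mon J js' = word_mon I js} = (if J = I then {js} else {})"
    using word_mon_inject assms by (auto split: if_splits)
  finally show ?thesis by simp
qed

lemma monomial_canonical:
  fixes m :: "'c::finite monomial"
  obtains \<psi> I where "strict_mono \<psi>" "m = relabel \<psi> (canon_mon I)"
proof
  define rs where "rs = sorted_list_of_set (fst ` keys m)"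
  \<comment> \<open>\<open>N\<close> lies above all occupied rows, so continuing with N + k keeps
    \<psi> strictly increasing on all naturals; the inserted 0 covers the monomial without
    variables.\<close>
  define N where "N = Suc (Max (insert 0 (fst ` keys m)))"
  define \<psi> where "\<psi> k = (if k < length rs then rs ! k else N + k)" for k
  define I where "I = Word (map (\<lambda>r. Abs_nzvec (\<lambda>c. lookup m (r, c))) rs)"
  have rs: "set rs = fst ` keys m" "sorted_wrt (<) rs" "distinct rs"
    by (auto simp: rs_def)
  have lt_N: "r < N" if "r \<in> set rs" for r
    using that unfolding N_def rs(1) by (auto simp: less_Suc_eq_le)
  show mono: "strict_mono \<psi>"
  proof (rule strict_monoI)
    fix i j :: nat assume "i < j"
    then show "\<psi> i < \<psi> j"
      using sorted_wrt_nth_less[OF rs(2), of i j] lt_N[of "rs ! i"]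
      by (auto simp: \<psi>_def intro: less_le_trans)
  qed
  have Rep: "Rep_nzvec (letters I ! k) = (\<lambda>c. lookup m (rs ! k, c))" if k: "k < length rs" for k
  proof -
    have "rs ! k \<in> fst ` keys m" using k rs(1) nth_mem by blast
    then obtain c where "lookup m (rs ! k, c) \<noteq> 0" by (auto simp: in_keys_iff)
    then have "(\<lambda>c. lookup m (rs ! k, c)) \<noteq> (\<lambda>_. 0)" by metis
    then show ?thesis by (simp add: I_def k Abs_nzvec_inverse)
  qed
  have "relabel \<psi> (canon_mon I) = word_mon I (map \<psi> [0..<length (letters I)])"
    by (rule relabel_canon_mon)
  also have "map \<psi> [0..<length (letters I)] = rs"
    by (rule nth_equalityI) (auto simp: I_def \<psi>_def)
  also have "word_mon I rs = m"
  proof (rule poly_mapping_eqI)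
    fix b :: "nat \<times> 'c"
    obtain r c where b: "b = (r, c)" by force
    show "lookup (word_mon I rs) b = lookup m b"
    proof (cases "r \<in> set rs")
      case True
      then obtain k where k: "k < length rs" "r = rs ! k" by (auto simp: in_set_conv_nth)
      then show ?thesis
        unfolding b using lookup_word_mon_nth[OF rs(3), of I k c] Rep[OF k(1)] by (simp add: I_def)
    next
      case False
      then have "lookup m (r, c) = 0" unfolding rs(1) by (force simp: in_keys_iff)
      then show ?thesis unfolding b using lookup_word_mon_notin[of rs I r c] False by (simp add: I_def)
    qed
  qed
  finally show "m = relabel \<psi> (canon_mon I)" ..
qed

text \<open>Every letter has degree at least 1, which bounds the length, and finitely many colors
  leave finitely many letters of bounded degree.\<close>

lemma finite_words_of_degree: "finite {w :: 'c::finite nzvec word. word_degree w = n}"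
proof -
  define V where "V = {v :: 'c nzvec. vec_degree v \<le> n}"
  have "finite V"
  proof (rule finite_imageD[of Rep_nzvec])
    show "finite (Rep_nzvec ` V)"
    proof (rule finite_subset[OF _ finite_vec_le[of "\<lambda>_. n"]], safe)
      fix v c assume "v \<in> V"
      moreover have "Rep_nzvec v c \<le> vec_degree v" unfolding vec_degree_def by (rule member_le_sum) auto
      ultimately show "Rep_nzvec v c \<le> n" by (simp add: V_def)
    qed
  qed (simp add: inj_on_def Rep_nzvec_inject)
  have "{w :: 'c nzvec word. word_degree w = n} \<subseteq> Word ` {vs. set vs \<subseteq> V \<and> length vs \<le> n}"
  proof
    fix w :: "'c nzvec word" assume "w \<in> {w. word_degree w = n}"
    then have n: "(\<Sum>v\<leftarrow>letters w. vec_degree v) = n" by (simp add: word_degree_def vec_degree_def)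
    have "v \<in> V" if "v \<in> set (letters w)" for v
      using that n member_le_sum_list[of "vec_degree v" "map vec_degree (letters w)"] by (auto simp: V_def)
    moreover have "(\<Sum>v\<leftarrow>letters w. 1) \<le> n"
      unfolding n[symmetric] by (rule sum_list_mono) (simp add: Suc_le_eq)
    then have "length (letters w) \<le> n" by (simp add: sum_list_triv)
    ultimately show "w \<in> Word ` {vs. set vs \<subseteq> V \<and> length vs \<le> n}"
      by (intro image_eqI[of _ _ "letters w"]) auto
  qed
  then show ?thesis by (rule finite_subset) (use \<open>finite V\<close> finite_lists_length_le in auto)
qed

lemma delta_M_degree:
  assumes "(delta_M G K (m, m') :: 'k::field) \<noteq> 0"
  shows "tot_deg m = word_degree K" "tot_deg m' = word_degree K"
proof -
  have "\<exists>js. lookup (M_term (prod_alphabet G) K js :: _ \<Rightarrow>\<^sub>0 'k) (m, m') \<noteq> 0"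
  proof (rule ccontr)
    assume "\<not> ?thesis"
    then have "(delta_M G K (m, m') :: 'k) = 0" by (simp add: delta_M_def M_on_def)
    with assms show False ..
  qed
  then obtain js where js: "lookup (M_term (prod_alphabet G) K js :: _ \<Rightarrow>\<^sub>0 'k) (m, m') \<noteq> 0" ..
  then show "tot_deg m = word_degree K" "tot_deg m' = word_degree K"
    using M_term_alphabet_degrees(3,4)[OF js] by simp_all
qed

text \<open>Existence: homogeneity leaves finitely many pairs, and quasi-symmetry reduces an
  arbitrary pair of monomials to canonical ones. Uniqueness: at a pair of canonical monomials, a
  combination of the \<open>M_I \<otimes> M_J\<close> takes its coefficient as value.\<close>

lemma lookup_delta_expansion:
  fixes K :: "'c::finite nzvec word"
  shows "(lookup (delta_expansion G K) (I, J) :: 'k::field) = delta_M G K (canon_mon I, canon_mon J)"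
proof -
  define P where "P p \<longleftrightarrow> (\<forall>m m'. (delta_M G K (m, m') :: 'k)
     = (\<Sum>(I, J)\<in>keys p. lookup p (I, J) * (qsym_M I m * qsym_M J m')))" for p
  define p where "p = Abs_poly_mapping (\<lambda>(I, J). (delta_M G K (canon_mon I, canon_mon J) :: 'k))"
  have "finite {IJ. (case IJ of (I, J) \<Rightarrow> (delta_M G K (canon_mon I, canon_mon J) :: 'k)) \<noteq> 0}"
    by (rule finite_subset[of _ "{w. word_degree w = word_degree K} \<times> {w. word_degree w = word_degree K}"])
      (auto simp: finite_words_of_degree canon_mon_def tot_deg_word_mon dest: delta_M_degree)
  then have p: "lookup p (I, J) = delta_M G K (canon_mon I, canon_mon J)" for I J
    by (simp add: p_def)
  have eval: "(\<Sum>(I', J')\<in>keys q. lookup q (I', J') * (qsym_M I' (word_mon I js) * qsym_M J' (word_mon J js')))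
      = lookup q (I, J)"
    if "sorted_wrt (<) js" "length js = length (letters I)" "sorted_wrt (<) js'" "length js' = length (letters J)"
    for q :: "'c nzvec word \<times> 'c nzvec word \<Rightarrow>\<^sub>0 'k" and I J js js'
  proof -
    have "(\<Sum>(I', J')\<in>keys q. lookup q (I', J') * (qsym_M I' (word_mon I js) * qsym_M J' (word_mon J js')))
        = (\<Sum>IJ'\<in>keys q. if IJ' = (I, J) then lookup q (I, J) else 0)"
      by (rule sum.cong) (auto simp: qsym_M_word_mon that split: if_splits)
    then show ?thesis by (auto simp: in_keys_iff)
  qed
  have sorted_upt: "sorted_wrt (<) (map \<psi> [0..<n])" if "strict_mono \<psi>" for \<psi> :: "nat \<Rightarrow> nat" and n
    by (simp add: sorted_wrt_map strict_mono_less[OF that])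
  have Pp: "P p"
    unfolding P_def
  proof (intro allI)
    fix m m' :: "'c monomial"
    obtain \<psi> I where I: "strict_mono \<psi>" "m = relabel \<psi> (canon_mon I)" by (rule monomial_canonical)
    obtain \<psi>' J where J: "strict_mono \<psi>'" "m' = relabel \<psi>' (canon_mon J)" by (rule monomial_canonical)
    have "(delta_M G K (m, m') :: 'k) = lookup p (I, J)"
      unfolding I(2) J(2) p by (rule delta_M_relabel[OF I(1) J(1)])
    also have "\<dots> = (\<Sum>(I', J')\<in>keys p. lookup p (I', J') * (qsym_M I' m * qsym_M J' m'))"
      unfolding I(2) J(2) relabel_canon_mon
      by (rule eval[symmetric]) (auto simp: sorted_upt I J simp del: sorted_wrt_map)
    finally show "delta_M G K (m, m') = (\<Sum>(I', J')\<in>keys p. lookup p (I', J') * (qsym_M I' m * qsym_M J' m'))" .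
  qed
  have unique: "q = p" if "P q" for q
  proof (rule poly_mapping_eqI, safe)
    fix I J
    have "lookup q (I, J) = delta_M G K (canon_mon I, canon_mon J)"
      using that unfolding P_def canon_mon_def by (simp add: eval)
    then show "lookup q (I, J) = lookup p (I, J)" by (simp add: p)
  qed
  have "delta_expansion G K = p"
  proof -
    have "delta_expansion G K = (THE p. P p)" by (simp only: delta_expansion_def P_def)
    also have "\<dots> = p" by (rule the_equality[of P]) (fact Pp, fact unique)
    finally show "delta_expansion G K = p" .
  qed
  then show ?thesis by (simp add: p)
qed

subsection \<open>Run-length encoding\<close>

definition unrl :: "(nat \<times> 'a) list \<Rightarrow> 'a list" where
  "unrl zs = concat (map (\<lambda>(n, x). replicate n x) zs)"

text \<open>Equal entries are collected globally, so \<open>unrl\<close> recovers sorted lists only.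
  For a sorted list of matrix cells the result is the nonzero entries in reading order.\<close>

definition rle :: "'a::linorder list \<Rightarrow> (nat \<times> 'a) list" where
  "rle hs = map (\<lambda>x. (count_list hs x, x)) (sorted_list_of_set (set hs))"

lemma unrl_Nil [simp]: "unrl [] = []"
  by (simp add: unrl_def)

lemma unrl_Cons [simp]: "unrl ((n, x) # zs) = replicate n x @ unrl zs"
  by (simp add: unrl_def)

lemma count_list_replicate: "count_list (replicate n x) y = (if x = y then n else 0)"
  by (induction n) auto

lemma count_list_map_unrl:
  "count_list (map f (unrl zs)) y = (\<Sum>(n, x)\<leftarrow>zs. if f x = y then n else 0)"
  by (induction zs) (auto simp: count_list_replicate)

lemma count_list_unrl: "count_list (unrl zs) y = (\<Sum>(n, x)\<leftarrow>zs. if x = y then n else 0)"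
  using count_list_map_unrl[of "\<lambda>x. x" zs y] by simp

lemma set_unrl_subset: "set (unrl zs) \<subseteq> snd ` set zs"
  by (auto simp: unrl_def intro: rev_image_eqI)

lemma set_unrl: "(\<And>n x. (n, x) \<in> set zs \<Longrightarrow> n \<ge> 1) \<Longrightarrow> set (unrl zs) = snd ` set zs"
proof (rule subset_antisym[OF set_unrl_subset], rule subsetI)
  fix x assume pos: "\<And>n x. (n, x) \<in> set zs \<Longrightarrow> n \<ge> 1" and "x \<in> snd ` set zs"
  then obtain n where "(n, x) \<in> set zs" by auto
  moreover from this have "x \<in> set (replicate n x)" using pos[of n x] by simp
  ultimately show "x \<in> set (unrl zs)" unfolding unrl_def by (auto intro!: bexI[of _ "(n, x)"])
qed

lemma sorted_unrl: "sorted (map snd zs) \<Longrightarrow> sorted (unrl (zs :: (nat \<times> 'a::linorder) list))"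
proof (induction zs)
  case (Cons z zs)
  then show ?case
    using set_unrl_subset[of zs] by (cases z) (auto simp: sorted_append)
qed simp

lemma sorted_eqI_count:
  assumes "sorted xs" "sorted ys" "\<And>x. count_list xs x = count_list ys x"
  shows "xs = ys"
proof -
  have "mset xs = mset ys" by (rule multiset_eqI) (simp add: assms(3) count_mset)
  then show ?thesis using properties_for_sort assms by (metis sorted_sort_id)
qed

lemma sum_list_distinct_select:
  "distinct (map snd zs) \<Longrightarrow> (n, x) \<in> set zs \<Longrightarrow> (\<Sum>(m, y)\<leftarrow>zs. if y = x then m else 0) = (n :: nat)"
proof (induction zs)
  case (Cons z zs)
  obtain m y where z: "z = (m, y)" by force
  show ?case
  proof (cases "y = x")
    case True
    then have "x \<notin> snd ` set zs" using Cons.prems by (auto simp: z)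
    then have "(\<Sum>(m, y)\<leftarrow>zs. if y = x then m else 0) = 0"
      by (force simp: sum_list_eq_0_iff)
    moreover have "m = n" using True \<open>x \<notin> snd ` set zs\<close> Cons.prems by (force simp: z)
    ultimately show ?thesis using True by (simp add: z)
  next
    case False
    then show ?thesis using Cons by (auto simp: z)
  qed
qed simp

lemma unrl_rle: "sorted hs \<Longrightarrow> unrl (rle hs) = hs"
proof (rule sorted_eqI_count)
  show "sorted (unrl (rle hs))"
    by (rule sorted_unrl) (simp add: rle_def o_def)
  fix x
  show "count_list (unrl (rle hs)) x = count_list hs x"
  proof (cases "x \<in> set hs")
    case True
    then show ?thesis
      unfolding count_list_unrl
      by (intro sum_list_distinct_select) (auto simp: rle_def o_def)
  next
    case False
    then show ?thesis
      using set_unrl_subset[of "rle hs"] by (auto simp: rle_def count_list_0_iff image_image)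
  qed
qed

lemma rle_unrl:
  assumes "sorted_wrt (<) (map snd zs)" "\<And>n x. (n, x) \<in> set zs \<Longrightarrow> n \<ge> 1"
  shows "rle (unrl zs) = zs"
proof -
  have zs: "sorted (map snd zs)" "distinct (map snd zs)"
    using assms(1) by (auto simp: strict_sorted_iff)
  have "sorted_list_of_set (set (unrl zs)) = map snd zs"
    using sorted_list_of_set.idem_if_sorted_distinct[OF zs] set_unrl[of zs] assms(2) by simp
  then show ?thesis
    unfolding rle_def by (simp add: o_def, intro map_idI) (auto simp: count_list_unrl intro!: sum_list_distinct_select zs)
qed

lemma rle_pos: "(n, x) \<in> set (rle hs) \<Longrightarrow> n \<ge> 1"
  by (auto simp: rle_def Suc_le_eq count_list_0_iff simp flip: neq0_conv)

lemma sorted_rle: "sorted_wrt (<) (map snd (rle hs))"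
  by (simp add: rle_def o_def)

subsection \<open>Internal products of monochromatic words\<close>

definition word_of :: "'c::finite ccomp \<Rightarrow> 'c nzvec word" where
  "word_of v = Word (map (\<lambda>(n, u). Abs_nzvec (mono_vec n u)) v)"

text \<open>Entry i is the index of the block containing position i, both counted from 0, so parts
  2, 1 give [0, 0, 1]; colors are forgotten.\<close>

definition block_row :: "'c ccomp \<Rightarrow> nat list" where
  "block_row v = unrl (zip (map fst v) [0..<length v])"

definition pos_comp :: "'c ccomp \<Rightarrow> bool" where
  "pos_comp v \<longleftrightarrow> (\<forall>(n, u)\<in>set v. n \<ge> 1)"

text \<open>The sequences of pairs (row, column) obtained by reading row by row a nonnegative integer matrix with
  prescribed row and column sums, each position being repeated as often as its entry says.\<close>

definition matrix_words :: "'c ccomp \<Rightarrow> 'c ccomp \<Rightarrow> (nat \<times> nat) list set" where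
  "matrix_words v w = {hs. sorted hs \<and> (\<forall>r. count_list (map fst hs) r = count_list (block_row v) r)
     \<and> (\<forall>s. count_list (map snd hs) s = count_list (block_row w) s)}"

text \<open>Cells with entry 0 are absent from \<open>rle hs\<close>, so all parts are
  positive.\<close>

definition matrix_comp :: "'c monoid \<Rightarrow> 'c ccomp \<Rightarrow> 'c ccomp \<Rightarrow> (nat \<times> nat) list \<Rightarrow> 'c ccomp" where
  "matrix_comp G v w hs = map (\<lambda>(n, (r, s)). (n, snd (v ! r) \<otimes>\<^bsub>G\<^esub> snd (w ! s))) (rle hs)"

lemma count_block_row: "count_list (block_row v) r = (if r < length v then fst (v ! r) else 0)"
proof -
  have "count_list (block_row v) r = (\<Sum>k<length v. if k = r then fst (v ! k) else 0)"
    by (simp add: block_row_def count_list_unrl sum_list_sum_nth atLeast0LessThan case_prod_unfold)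
  also have "\<dots> = (if r < length v then fst (v ! r) else 0)" by simp
  finally show ?thesis .
qed

lemma sorted_block_row: "sorted (block_row v)"
  unfolding block_row_def by (rule sorted_unrl) simp

lemma count_list_eq_length: "(\<And>x. count_list xs x = count_list ys x) \<Longrightarrow> length xs = length ys"
  by (metis count_mset multiset_eqI size_mset)

lemma count_list_eq_set: "(\<And>x. count_list xs x = count_list ys x) \<Longrightarrow> set xs = set ys"
  by (metis count_list_0_iff subsetI subset_antisym)

lemma set_block_row: "set (block_row v) \<subseteq> {..<length v}"
  unfolding block_row_def using set_unrl_subset[of "zip (map fst v) [0..<length v]"]
  by (auto simp: set_zip)

lemma finite_matrix_words [simp]: "finite (matrix_words v w)"
proof (rule finite_subset)
  show "matrix_words v w \<subseteq> {hs. set hs \<subseteq> {..<length v} \<times> {..<length w} \<and> length hs = length (block_row v)}"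
  proof
    fix hs assume hs: "hs \<in> matrix_words v w"
    then have "set (map fst hs) = set (block_row v)" "set (map snd hs) = set (block_row w)"
      by (auto simp: matrix_words_def intro!: count_list_eq_set simp del: set_map)
    then have "fst ` set hs \<subseteq> {..<length v}" "snd ` set hs \<subseteq> {..<length w}"
      using set_block_row[of v] set_block_row[of w] by auto
    then have "set hs \<subseteq> {..<length v} \<times> {..<length w}" by force
    moreover have "length (map fst hs) = length (block_row v)"
      using hs by (intro count_list_eq_length) (simp add: matrix_words_def)
    ultimately show "hs \<in> {hs. set hs \<subseteq> {..<length v} \<times> {..<length w} \<and> length hs = length (block_row v)}"
      by simp
  qed
qed (intro finite_lists_length_eq finite_SigmaI, auto)

lemma vec_degree_mono [simp]: "n \<ge> 1 \<Longrightarrow> vec_degree (Abs_nzvec (mono_vec n u)) = n"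
  by (simp add: vec_degree_def) (simp add: mono_vec_def)

lemma lookup_canon_mono:
  assumes "pos_comp v"
  shows "lookup (canon_mon (word_of v)) (r, c) = (if c = snd (v ! r) then count_list (block_row v) r else 0)"
proof -
  have "lookup (canon_mon (word_of v)) (r, c) =
      (\<Sum>k<length v. if k = r then (if c = snd (v ! r) then fst (v ! r) else 0) else 0)"
    unfolding canon_mon_def lookup_word_mon
  proof (rule sum.cong)
    fix k assume k: "k \<in> {..<length v}"
    then have "fst (v ! k) \<ge> 1" using assms nth_mem[of k v] by (cases "v ! k") (auto simp: pos_comp_def)
    then have "Rep_nzvec (letters (word_of v) ! k) = mono_vec (fst (v ! k)) (snd (v ! k))"
      using k by (simp add: word_of_def case_prod_unfold)
    then show "(if [0..<length (letters (word_of v))] ! k = r then Rep_nzvec (letters (word_of v) ! k) c else 0) =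
        (if k = r then (if c = snd (v ! r) then fst (v ! r) else 0) else 0)"
      using k by (auto simp: word_of_def mono_vec_def)
  qed (simp add: word_of_def)
  then show ?thesis by (auto simp: count_block_row)
qed

lemma keys_add_nat: "keys (m + m' :: 'a \<Rightarrow>\<^sub>0 nat) = keys m \<union> keys m'"
  by (auto simp: in_keys_iff lookup_add)

lemma mono_vec_cond:
  "(\<forall>c. c \<noteq> u \<longrightarrow> Rep_nzvec x c = 0) \<longleftrightarrow> Rep_nzvec x = mono_vec (vec_degree x) u"
proof
  assume *: "\<forall>c. c \<noteq> u \<longrightarrow> Rep_nzvec x c = 0"
  then have "vec_degree x = (\<Sum>c\<in>UNIV. if c = u then Rep_nzvec x u else 0)"
    unfolding vec_degree_def by (intro sum.cong) auto
  then have "vec_degree x = Rep_nzvec x u" by simp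
  with * show "Rep_nzvec x = mono_vec (vec_degree x) u" by (auto simp: mono_vec_def fun_eq_iff)
qed (metis mono_vec_def)

lemma prod_if_zero:
  fixes f :: "'i \<Rightarrow> 'b::comm_semiring_1"
  assumes "finite A"
  shows "(\<Prod>a\<in>A. if P a then f a else 0) = (if \<forall>a\<in>A. P a then \<Prod>a\<in>A. f a else 0)"
  using assms by (induction A rule: finite_induct) auto

text \<open>Setting to zero the variables whose color differs from the color of their row leaves in the alphabet
  \<open>X \<times>\<^sub>C Y\<close> a single monomial per pair of rows.\<close>

lemma lookup_M_term_mono:
  fixes K :: "'c::finite nzvec word" and G :: "'c monoid"
  assumes v: "pos_comp v" and w: "pos_comp w" and js: "length js = length (letters K)"
  defines "hs \<equiv> unrl (zip (map vec_degree (letters K)) js)"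
  shows "lookup (M_term (prod_alphabet G) K js :: _ \<Rightarrow>\<^sub>0 'k::field) (canon_mon (word_of v), canon_mon (word_of w)) =
    (if (\<forall>k<length js. Rep_nzvec (letters K ! k) =
            mono_vec (vec_degree (letters K ! k)) (snd (v ! fst (js ! k)) \<otimes>\<^bsub>G\<^esub> snd (w ! snd (js ! k))))
        \<and> (\<forall>r. count_list (map fst hs) r = count_list (block_row v) r)
        \<and> (\<forall>s. count_list (map snd hs) s = count_list (block_row w) s) then 1 else 0)"
proof -
  define good where "good v m \<longleftrightarrow> (\<forall>(r, c)\<in>keys m. c = snd (v ! r))" for v :: "'c ccomp" and m :: "'c monomial"
  define F where "F = lin_extend (\<lambda>p. if good v (fst p) \<and> good w (snd p) then single p (1::'k) else 0)"
  define col where "col rs = snd (v ! fst rs) \<otimes>\<^bsub>G\<^esub> snd (w ! snd rs)" for rs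
  define X :: "nat \<times> nat \<Rightarrow> 'c monomial \<times> 'c monomial" where
    "X rs = (single (fst rs, snd (v ! fst rs)) 1, single (snd rs, snd (w ! snd rs)) 1)" for rs
  define d where "d k = vec_degree (letters K ! k)" for k
  have good_add: "good v (m + m') \<longleftrightarrow> good v m \<and> good v m'" for v m m'
    by (auto simp: good_def keys_add_nat)
  have good_0: "good v 0" for v by (simp add: good_def)
  have good_canon: "pos_comp v \<Longrightarrow> good v (canon_mon (word_of v))" for v
    by (auto simp: good_def in_keys_iff lookup_canon_mono split: if_splits)
  \<comment> \<open>Canonical monomials of monochromatic words survive \<open>F\<close>, so this
    coefficient can be computed after the annihilation.\<close>
  have F_lookup: "lookup (F x) (canon_mon (word_of v), canon_mon (word_of w)) =
      lookup x (canon_mon (word_of v), canon_mon (word_of w))" for x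
  proof -
    let ?p = "(canon_mon (word_of v), canon_mon (word_of w))"
    have "lookup (F x) ?p = (\<Sum>b\<in>keys x. if b = ?p then lookup x ?p else 0)"
      unfolding F_def lookup_lin_extend
      by (rule sum.cong) (auto simp: lookup_single when_def good_canon v w)
    then show ?thesis by (auto simp: in_keys_iff)
  qed
  have F_alphabet: "F (prod_alphabet G rs \<gamma>) = (if col rs = \<gamma> then single (X rs) 1 else 0)" for rs \<gamma>
  proof -
    have "F (prod_alphabet G rs \<gamma>) = (\<Sum>\<alpha>\<beta>\<in>{(\<alpha>, \<beta>). \<alpha> \<otimes>\<^bsub>G\<^esub> \<beta> = \<gamma>}.
        if \<alpha>\<beta> = (snd (v ! fst rs), snd (w ! snd rs)) then single (X rs) 1 else 0)"
      unfolding F_def prod_alphabet_alt lin_sum[OF lin_lin_extend]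
      by (rule sum.cong) (auto simp: good_def X_def split: if_splits)
    then show ?thesis by (simp add: col_def)
  qed
  have F_mult: "F (x * y) = F x * F y" for x y
    unfolding F_def by (rule lin_extend_mult) (auto simp: good_add mult_single)
  have F_one: "F 1 = 1"
    by (simp add: F_def lin_extend_one good_0)
  \<comment> \<open>The product vanishes as soon as a color other than u occurs in l; colors with
    exponent 0 contribute 0 ^ 0 = 1.\<close>
  have letter: "(\<Prod>c\<in>UNIV. (if u = c then x else 0) ^ Rep_nzvec l c) =
      (if Rep_nzvec l = mono_vec (vec_degree l) u then x ^ vec_degree l else 0)"
    for u and x :: "'c monomial \<times> 'c monomial \<Rightarrow>\<^sub>0 'k" and l
  proof (cases "\<forall>c. c \<noteq> u \<longrightarrow> Rep_nzvec l c = 0")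
    case True
    then have "(\<Prod>c\<in>UNIV. (if u = c then x else 0) ^ Rep_nzvec l c) = (\<Prod>c\<in>UNIV. if c = u then x ^ Rep_nzvec l u else 1)"
      by (intro prod.cong) auto
    moreover have "Rep_nzvec l u = vec_degree l"
      using True unfolding mono_vec_cond by (metis mono_vec_def)
    ultimately show ?thesis using True unfolding mono_vec_cond by simp
  next
    case False
    then obtain c where "c \<noteq> u" "Rep_nzvec l c \<noteq> 0" by auto
    then have "(\<Prod>c\<in>UNIV. (if u = c then x else 0) ^ Rep_nzvec l c) = 0"
      by (intro prod_zero) (auto intro!: exI[of _ c] simp: zero_power)
    then show ?thesis using False unfolding mono_vec_cond by simp
  qed
  have power: "single p (1::'k) ^ n = single (\<Sum>i<n. p) 1" for p :: "'c monomial \<times> 'c monomial" and n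
    by (induction n) (simp_all add: mult_single add.commute)
  have prod: "(\<Prod>a\<in>A. single (f a) (1::'k)) = single (sum f A) 1" for f :: "nat \<Rightarrow> 'c monomial \<times> 'c monomial" and A
    by (induction A rule: infinite_finite_induct) (simp_all add: mult_single)
  have copies: "(\<Sum>i<n. X rs) = (single (fst rs, snd (v ! fst rs)) n, single (snd rs, snd (w ! snd rs)) n)" for n rs
    by (induction n) (simp_all add: X_def zero_prod_def single_add[symmetric])
  define row where "row = (\<Sum>k<length js. single (fst (js ! k), snd (v ! fst (js ! k))) (d k))"
  define column where "column = (\<Sum>k<length js. single (snd (js ! k), snd (w ! snd (js ! k))) (d k))"
  have "F (M_term (prod_alphabet G) K js) =
      (\<Prod>k<length js. if Rep_nzvec (letters K ! k) = mono_vec (d k) (col (js ! k)) then single (X (js ! k)) 1 ^ d k else 0)"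
    unfolding M_term_hom[of F, OF F_mult F_one] F_alphabet unfolding M_term_def letter d_def js ..
  also have "\<dots> = (if \<forall>k<length js. Rep_nzvec (letters K ! k) = mono_vec (d k) (col (js ! k))
      then single (row, column) 1 else 0)"
    by (auto simp add: prod_if_zero power prod copies row_def column_def sum_prod Ball_def)
  finally have FM: "F (M_term (prod_alphabet G) K js) = \<dots>" .
  \<comment> \<open>Every row of either monomial carries its prescribed color, so only exponents are
    compared. The parameter f is \<open>fst\<close> for \<open>v\<close> and \<open>snd\<close> for
    \<open>w\<close>.\<close>
  have row_eq: "(\<Sum>k<length js. single (f (js ! k), snd (v ! f (js ! k))) (d k)) = canon_mon (word_of v) \<longleftrightarrow>
      (\<forall>r. count_list (map f hs) r = count_list (block_row v) r)"
    if v: "pos_comp v" for f :: "nat \<times> nat \<Rightarrow> nat" and v :: "'c ccomp"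
  proof -
    have hs: "count_list (map f hs) r = (\<Sum>k<length js. if f (js ! k) = r then d k else 0)" for r
      unfolding d_def
      by (simp add: hs_def count_list_map_unrl sum_list_sum_nth atLeast0LessThan js)
    have "lookup (\<Sum>k<length js. single (f (js ! k), snd (v ! f (js ! k))) (d k)) (r, c) =
        (if c = snd (v ! r) then count_list (map f hs) r else 0)" for r c
      unfolding lookup_sum hs
      by (auto simp: lookup_single when_def intro!: sum.cong sum.neutral)
    then show ?thesis
      by (auto simp: poly_mapping_eq_iff fun_eq_iff lookup_canon_mono[OF v])
  qed
  have "lookup (M_term (prod_alphabet G) K js :: _ \<Rightarrow>\<^sub>0 'k) (canon_mon (word_of v), canon_mon (word_of w)) =
      (if (\<forall>k<length js. Rep_nzvec (letters K ! k) = mono_vec (d k) (col (js ! k)))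
        \<and> row = canon_mon (word_of v) \<and> column = canon_mon (word_of w) then 1 else 0)"
    by (subst F_lookup[symmetric]) (auto simp: FM lookup_single when_def)
  then show ?thesis
    unfolding row_def column_def row_eq[OF v] row_eq[OF w] by (simp add: d_def col_def)
qed

text \<open>An index list js gives the cells with nonzero entry, and the degrees of the letters of K
  are the entries; unrolling them yields a matrix word, and run-length encoding returns the
  list.\<close>

lemma delta_M_mono:
  fixes K :: "'c::finite nzvec word" and G :: "'c monoid"
  assumes v: "pos_comp v" and w: "pos_comp w"
  shows "(delta_M G K (canon_mon (word_of v), canon_mon (word_of w)) :: 'k::field) =
    of_nat (card {hs \<in> matrix_words v w. word_of (matrix_comp G v w hs) = K})"
proof -
  define ds where "ds = map vec_degree (letters K)"
  define col where "col rs = snd (v ! fst rs) \<otimes>\<^bsub>G\<^esub> snd (w ! snd rs)" for rs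
  define hs where "hs js = unrl (zip ds js)" for js :: "(nat \<times> nat) list"
  define A where "A = {js. length js = length (letters K) \<and> sorted_wrt (<) js \<and>
      (\<forall>k<length js. Rep_nzvec (letters K ! k) = mono_vec (vec_degree (letters K ! k)) (col (js ! k)))
        \<and> (\<forall>r. count_list (map fst (hs js)) r = count_list (block_row v) r)
        \<and> (\<forall>s. count_list (map snd (hs js)) s = count_list (block_row w) s)}"
  \<comment> \<open>The order in the definition is the lexicographic \<open><\<close> on pairs, for
    which \<open>sorted\<close> and \<open>rle\<close> are available.\<close>
  have lex: "(\<lambda>p q. (p, q) \<in> less_than <*lex*> less_than) = ((<) :: nat \<times> nat \<Rightarrow> nat \<times> nat \<Rightarrow> bool)"
    by (auto simp: fun_eq_iff)
  have "(delta_M G K (canon_mon (word_of v), canon_mon (word_of w)) :: 'k) = (\<Sum>js\<in>A. 1)"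
    unfolding delta_M_def M_on_def lex
    by (rule sum.cong) (auto simp: A_def lookup_M_term_mono[OF v w] hs_def ds_def col_def split: if_splits)
  also have "\<dots> = of_nat (card A)" by simp
  also have "card A = card {hs \<in> matrix_words v w. word_of (matrix_comp G v w hs) = K}"
  proof (rule bij_betw_same_card[of hs], rule bij_betw_byWitness[where f' = "\<lambda>hs. map snd (rle hs)"])
    have zip_hs: "rle (hs js) = zip ds js" if "js \<in> A" for js
      unfolding hs_def
    proof (rule rle_unrl)
      show "sorted_wrt (<) (map snd (zip ds js))" using that by (simp add: A_def ds_def)
    qed (auto simp: ds_def Suc_le_eq dest!: set_zip_leftD)
    show "\<forall>js\<in>A. map snd (rle (hs js)) = js"
      by (auto simp: zip_hs) (auto simp: A_def ds_def)
    \<comment> \<open>K is determined by the matrix word, so the degrees needed to unroll can be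
      read from \<open>rle xs\<close>.\<close>
    have ds: "ds = map fst (rle xs)" if "word_of (matrix_comp G v w xs) = K" for xs
      using rle_pos[of _ _ xs] unfolding ds_def that[symmetric] word_of_def matrix_comp_def
      by (auto simp: case_prod_unfold)
    have hs_rle: "hs (map snd (rle xs)) = xs"
      if "xs \<in> {hs \<in> matrix_words v w. word_of (matrix_comp G v w hs) = K}" for xs
      unfolding hs_def using that by (simp add: ds[of xs] zip_map_fst_snd unrl_rle matrix_words_def)
    then show "\<forall>xs\<in>{hs \<in> matrix_words v w. word_of (matrix_comp G v w hs) = K}. hs (map snd (rle xs)) = xs"
      by blast
    show "hs ` A \<subseteq> {hs \<in> matrix_words v w. word_of (matrix_comp G v w hs) = K}"
    proof safe
      fix js assume js: "js \<in> A"
      show "hs js \<in> matrix_words v w"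
        using js by (auto simp: matrix_words_def A_def hs_def ds_def strict_sorted_iff intro!: sorted_unrl)
      have "letters (word_of (matrix_comp G v w (hs js))) = letters K"
      proof (rule nth_equalityI)
        show "length (letters (word_of (matrix_comp G v w (hs js)))) = length (letters K)"
          using js by (simp add: word_of_def matrix_comp_def zip_hs) (simp add: A_def ds_def)
        fix k assume "k < length (letters (word_of (matrix_comp G v w (hs js))))"
        then have k: "k < length js" "k < length (letters K)"
          using js by (auto simp: word_of_def matrix_comp_def zip_hs A_def)
        then have "Rep_nzvec (letters K ! k) = mono_vec (vec_degree (letters K ! k)) (col (js ! k))"
          using js by (simp add: A_def)
        then have "letters K ! k = Abs_nzvec (mono_vec (vec_degree (letters K ! k)) (col (js ! k)))"
          by (metis Rep_nzvec_inverse)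
        then show "letters (word_of (matrix_comp G v w (hs js))) ! k = letters K ! k"
          using js k by (simp add: word_of_def matrix_comp_def zip_hs case_prod_unfold col_def ds_def)
      qed
      then show "word_of (matrix_comp G v w (hs js)) = K" by (metis word.expand)
    qed
    show "(\<lambda>hs. map snd (rle hs)) ` {hs \<in> matrix_words v w. word_of (matrix_comp G v w hs) = K} \<subseteq> A"
    proof safe
      fix xs assume xs: "xs \<in> matrix_words v w" "K = word_of (matrix_comp G v w xs)"
      have "hs (map snd (rle xs)) = xs" using xs hs_rle by blast
      moreover have "Rep_nzvec (letters K ! k) = mono_vec (vec_degree (letters K ! k)) (col (snd (rle xs ! k)))"
        if "k < length (rle xs)" for k
        using rle_pos[of "fst (rle xs ! k)" "snd (rle xs ! k)" xs] that nth_mem[OF that]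
        by (simp add: xs(2) word_of_def matrix_comp_def case_prod_unfold col_def)
      ultimately show "map snd (rle xs) \<in> A"
        using xs(1) sorted_rle[of xs]
        by (auto simp: A_def matrix_words_def) (simp_all add: xs(2) word_of_def matrix_comp_def)
    qed
  qed
  finally show ?thesis .
qed

lemma internal_basis_mono:
  fixes G :: "'c::finite monoid"
  assumes "pos_comp v" "pos_comp w"
  shows "(internal_basis G (word_of v) (word_of w) :: ('c, 'k::field) ncsf) =
    (\<Sum>hs\<in>matrix_words v w. single (word_of (matrix_comp G v w hs)) 1)"
proof -
  let ?S = "\<Sum>hs\<in>matrix_words v w. single (word_of (matrix_comp G v w hs)) (1::'k)"
  have "(lookup (delta_expansion G K) (word_of v, word_of w) :: 'k) = lookup ?S K" for K
  proof -
    have "lookup ?S K = (\<Sum>hs\<in>matrix_words v w. if word_of (matrix_comp G v w hs) = K then 1 else 0)"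
      by (simp add: lookup_sum lookup_single when_def)
    also have "\<dots> = of_nat (card {hs \<in> matrix_words v w. word_of (matrix_comp G v w hs) = K})"
      by (subst sum.If_cases) (auto simp: Int_def)
    finally show ?thesis by (simp add: lookup_delta_expansion delta_M_mono[OF assms])
  qed
  then have "internal_basis G (word_of v) (word_of w) = Abs_poly_mapping (lookup ?S)"
    unfolding internal_basis_def by presburger
  then show ?thesis by (simp add: lookup_inverse)
qed

section \<open>Products in the Mantaci--Reutenauer algebra\<close>

subsection \<open>Permutations determined by the order of their values\<close>

text \<open>The values fill an initial segment starting at 1, so each value is its own rank. Hence
  the order of the values determines the permutation.\<close>

lemma permutes_card_le:
  fixes n :: nat
  assumes "\<tau> permutes {1..n}" "i \<in> {1..n}"
  shows "card {j \<in> {1..n}. \<tau> j \<le> \<tau> i} = \<tau> i"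
proof -
  have "\<tau> ` {j \<in> {1..n}. \<tau> j \<le> \<tau> i} = {1..\<tau> i}"
  proof
    show "{1..\<tau> i} \<subseteq> \<tau> ` {j \<in> {1..n}. \<tau> j \<le> \<tau> i}"
    proof
      fix k assume k: "k \<in> {1..\<tau> i}"
      have "\<tau> i \<in> {1..n}" using permutes_in_image[OF assms(1)] assms(2) by blast
      with k have "k \<in> {1..n}" by auto
      then have "k \<in> \<tau> ` {1..n}" using permutes_image[OF assms(1)] by simp
      with k show "k \<in> \<tau> ` {j \<in> {1..n}. \<tau> j \<le> \<tau> i}" by auto
    qed
  qed (use permutes_in_image[OF assms(1)] in force)
  moreover have "card (\<tau> ` {j \<in> {1..n}. \<tau> j \<le> \<tau> i}) = card {j \<in> {1..n}. \<tau> j \<le> \<tau> i}"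
    by (rule card_image) (rule inj_on_subset[OF permutes_inj_on[OF assms(1)] subset_UNIV])
  ultimately show ?thesis by simp
qed

lemma permutes_order_unique:
  fixes n :: nat
  assumes "\<tau> permutes {1..n}" "\<tau>' permutes {1..n}"
    and "\<And>i j. i \<in> {1..n} \<Longrightarrow> j \<in> {1..n} \<Longrightarrow> \<tau> i < \<tau> j \<longleftrightarrow> \<tau>' i < \<tau>' j"
  shows "\<tau> = \<tau>'"
proof
  fix i
  show "\<tau> i = \<tau>' i"
  proof (cases "i \<in> {1..n}")
    case True
    have "{j \<in> {1..n}. \<tau> j \<le> \<tau> i} = {j \<in> {1..n}. \<tau>' j \<le> \<tau>' i}"
      using assms(3)[OF True] by (auto simp: not_less[symmetric])
    then show ?thesis
      using permutes_card_le[OF assms(1) True] permutes_card_le[OF assms(2) True] by simp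
  next
    case False
    then show ?thesis using assms(1,2) by (simp add: permutes_not_in)
  qed
qed

lemma rank_permutation:
  fixes key :: "nat \<Rightarrow> 'a::linorder"
  assumes inj: "inj_on key {1..n}"
  obtains \<tau> where "\<tau> permutes {1..n}"
    "\<And>i j. i \<in> {1..n} \<Longrightarrow> j \<in> {1..n} \<Longrightarrow> \<tau> i < \<tau> j \<longleftrightarrow> key i < key j"
proof
  \<comment> \<open>The rank of the key; counting the key itself makes ranks start at 1.\<close>
  define \<tau> where "\<tau> i = (if i \<in> {1..n} then card {j \<in> {1..n}. key j \<le> key i} else i)" for i
  have less: "\<tau> i < \<tau> j" if "i \<in> {1..n}" "j \<in> {1..n}" "key i < key j" for i j
  proof -
    have "{k \<in> {1..n}. key k \<le> key i} \<subset> {k \<in> {1..n}. key k \<le> key j}"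
    proof (rule psubsetI)
      show "{k \<in> {1..n}. key k \<le> key i} \<subseteq> {k \<in> {1..n}. key k \<le> key j}"
        using that(3) by auto
      have "j \<in> {k \<in> {1..n}. key k \<le> key j} - {k \<in> {1..n}. key k \<le> key i}"
        using that by auto
      then show "{k \<in> {1..n}. key k \<le> key i} \<noteq> {k \<in> {1..n}. key k \<le> key j}" by blast
    qed
    then show ?thesis using that by (simp add: \<tau>_def psubset_card_mono)
  qed
  show iff: "\<tau> i < \<tau> j \<longleftrightarrow> key i < key j" if "i \<in> {1..n}" "j \<in> {1..n}" for i j
    using less[OF that] less[OF that(2,1)] inj_onD[OF inj _ that]
    by (cases "key i" "key j" rule: linorder_cases) auto
  have "inj_on \<tau> {1..n}"
    by (rule inj_onI, rule ccontr) (metis iff inj inj_on_eq_iff less_irrefl linorder_less_linear)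
  moreover have "\<tau> ` {1..n} \<subseteq> {1..n}"
  proof safe
    fix i assume i: "i \<in> {1..n}"
    have "card {j \<in> {1..n}. key j \<le> key i} \<le> card {1..n}" by (rule card_mono) auto
    moreover have "card {j \<in> {1..n}. key j \<le> key i} > 0"
      using i by (subst card_gt_0_iff) auto
    ultimately show "\<tau> i \<in> {1..n}" using i by (simp add: \<tau>_def)
  qed
  ultimately have "bij_betw \<tau> {1..n} {1..n}"
    unfolding bij_betw_def by (simp add: endo_inj_surj)
  then show "\<tau> permutes {1..n}"
    by (rule bij_imp_permutes) (auto simp: \<tau>_def)
qed

subsection \<open>Permutations increasing on the fibers of a word\<close>

text \<open>Positions are numbered from 1, so the label of position \<open>i\<close> is \<open>h ! (i - 1)\<close>.\<close>

definition fiber_inc :: "'a list \<Rightarrow> (nat \<Rightarrow> nat) set" where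
  "fiber_inc h = {\<sigma>. \<sigma> permutes {1..length h} \<and>
     (\<forall>i\<in>{1..length h}. \<forall>j\<in>{1..length h}. i < j \<and> h ! (i - 1) = h ! (j - 1) \<longrightarrow> \<sigma> i < \<sigma> j)}"

lemma finite_fiber_inc [simp]: "finite (fiber_inc h)"
  by (rule finite_subset[OF _ finite_permutations[of "{1..length h}"]]) (auto simp: fiber_inc_def)

definition pair_word :: "nat list \<Rightarrow> nat list \<Rightarrow> (nat \<Rightarrow> nat) \<Rightarrow> (nat \<times> nat) list" where
  "pair_word g h \<tau> = map (\<lambda>i. (g ! (i - 1), h ! (\<tau> i - 1))) [1..<Suc (length g)]"

text \<open>Stated for label lists, since the correspondence below concerns labels and permutations;
  \<open>matrix_words\<close> is the case of block labels.\<close>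

definition pair_words :: "nat list \<Rightarrow> nat list \<Rightarrow> (nat \<times> nat) list set" where
  "pair_words g h = {hs. sorted hs \<and> (\<forall>r. count_list (map fst hs) r = count_list g r)
     \<and> (\<forall>s. count_list (map snd hs) s = count_list h s)}"

lemma length_pair_word [simp]: "length (pair_word g h \<tau>) = length g"
  by (simp add: pair_word_def del: upt_Suc)

lemma nth_pair_word: "i \<in> {1..length g} \<Longrightarrow> pair_word g h \<tau> ! (i - 1) = (g ! (i - 1), h ! (\<tau> i - 1))"
  by (auto simp: pair_word_def simp del: upt_Suc)

lemma count_list_permuted:
  assumes "\<tau> permutes {1..length h}"
  shows "count_list (map (\<lambda>i. h ! (\<tau> i - 1)) [1..<Suc (length h)]) x = count_list h x"
proof -
  have "mset (map (\<lambda>i. h ! (\<tau> i - 1)) [1..<Suc (length h)]) =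
      image_mset (\<lambda>i. h ! (i - 1)) (image_mset \<tau> (mset_set {1..length h}))"
    by (simp add: image_mset.compositionality o_def atLeastLessThanSuc_atLeastAtMost del: upt_Suc)
  also have "image_mset \<tau> (mset_set {1..length h}) = mset_set {1..length h}"
    using permutes_image[OF assms] permutes_inj_on[OF assms]
    by (simp add: image_mset_mset_set inj_on_subset)
  also have "image_mset (\<lambda>i. h ! (i - 1)) \<dots> = mset (map (\<lambda>i. h ! (i - 1)) [1..<Suc (length h)])"
    by (simp add: atLeastLessThanSuc_atLeastAtMost del: upt_Suc)
  also have "map (\<lambda>i. h ! (i - 1)) [1..<Suc (length h)] = h"
    by (rule nth_equalityI) (auto simp del: upt_Suc)
  finally show ?thesis by (metis count_mset)
qed

text \<open>Labels increase weakly along positions, and \<sigma> breaks the ties within a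
  fiber.\<close>

lemma fiber_inc_order:
  fixes h :: "'a::linorder list"
  assumes "sorted h" "\<sigma> \<in> fiber_inc h" "k \<in> {1..length h}" "l \<in> {1..length h}"
  shows "k < l \<longleftrightarrow> (h ! (k - 1), \<sigma> k) < (h ! (l - 1), \<sigma> l)"
proof -
  have lt: "(h ! (k - 1), \<sigma> k) < (h ! (l - 1), \<sigma> l)"
    if "k < l" "k \<in> {1..length h}" "l \<in> {1..length h}" for k l
  proof -
    have "h ! (k - 1) \<le> h ! (l - 1)" using assms(1) that by (intro sorted_nth_mono) auto
    moreover have "h ! (k - 1) = h ! (l - 1) \<Longrightarrow> \<sigma> k < \<sigma> l"
      using assms(2) that by (auto simp: fiber_inc_def)
    ultimately show ?thesis by (cases "h ! (k - 1) = h ! (l - 1)") auto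
  qed
  show ?thesis
  proof (cases k l rule: linorder_cases)
    case less
    then show ?thesis using lt[OF _ assms(3,4)] by simp
  next
    case equal
    then show ?thesis by simp
  next
    case greater
    then have "(h ! (l - 1), \<sigma> l) < (h ! (k - 1), \<sigma> k)" by (rule lt[OF _ assms(4,3)])
    then show ?thesis using greater by (meson less_asym)
  qed
qed

text \<open>Both components on the right are read off from the pair word and from
  \<open>\<sigma> \<circ> \<tau>\<close>, so these two data determine the order of the values of
  \<tau>.\<close>

lemma pair_word_order:
  assumes h: "sorted h" "length h = length g" and \<sigma>: "\<sigma> \<in> fiber_inc h" and \<tau>: "\<tau> permutes {1..length g}"
    and ij: "i \<in> {1..length g}" "j \<in> {1..length g}"
  shows "\<tau> i < \<tau> j \<longleftrightarrow> (snd (pair_word g h \<tau> ! (i - 1)), \<sigma> (\<tau> i)) < (snd (pair_word g h \<tau> ! (j - 1)), \<sigma> (\<tau> j))"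
proof -
  have "\<tau> i \<in> {1..length h}" "\<tau> j \<in> {1..length h}"
    using permutes_in_image[OF \<tau>] ij h(2) by metis+
  from fiber_inc_order[OF h(1) \<sigma> this] show ?thesis
    by (simp add: nth_pair_word[OF ij(1)] nth_pair_word[OF ij(2)] del: One_nat_def)
qed

lemma pair_word_in:
  assumes g: "sorted g" and h: "sorted h" "length h = length g" and \<tau>: "\<tau> \<in> fiber_inc g"
  shows "pair_word g h \<tau> \<in> pair_words g h"
proof -
  have perm: "\<tau> permutes {1..length g}" using \<tau> by (simp add: fiber_inc_def)
  have "sorted (pair_word g h \<tau>)"
    unfolding sorted_wrt_iff_nth_less
  proof safe
    fix i j assume ij: "i < j" "j < length (pair_word g h \<tau>)"
    let ?i = "Suc i" and ?j = "Suc j"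
    have in_range: "?i \<in> {1..length g}" "?j \<in> {1..length g}" using ij by auto
    have gle: "g ! i \<le> g ! j" using g ij by (intro sorted_nth_mono) auto
    \<comment> \<open>Positions in one row are moved by \<tau> in increasing order and h is sorted,
      so their columns weakly increase.\<close>
    have "h ! (\<tau> ?i - 1) \<le> h ! (\<tau> ?j - 1)" if "g ! i = g ! j"
    proof -
      have "\<tau> ?i < \<tau> ?j" using \<tau> that in_range ij(1) by (auto simp: fiber_inc_def)
      moreover have "\<tau> ?j \<in> {1..length g}" using permutes_in_image[OF perm] in_range(2) by metis
      ultimately show ?thesis using h by (intro sorted_nth_mono) auto
    qed
    with gle show "pair_word g h \<tau> ! i \<le> pair_word g h \<tau> ! j"
      using nth_pair_word[OF in_range(1), of h \<tau>] nth_pair_word[OF in_range(2), of h \<tau>]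
      by (cases "g ! i = g ! j") (auto simp: less_eq_prod_def)
  qed
  moreover have "map fst (pair_word g h \<tau>) = g"
    by (rule nth_equalityI) (auto simp: pair_word_def simp del: upt_Suc)
  moreover have "map snd (pair_word g h \<tau>) = map (\<lambda>i. h ! (\<tau> i - 1)) [1..<Suc (length h)]"
    by (simp add: pair_word_def h(2) del: upt_Suc)
  ultimately show ?thesis
    using count_list_permuted[of \<tau> h] perm h(2) by (simp add: pair_words_def del: upt_Suc)
qed

text \<open>To invert, sort the positions by column and then by the value of \<pi>: the resulting
  ranks form \<tau>, and \<sigma> is \<pi> composed with the inverse of \<tau>. Sortedness of hs
  gives monotonicity of \<tau> on the rows.\<close>

lemma pair_word_bij:
  assumes g: "sorted g" and h: "sorted h" "length h = length g"
  shows "bij_betw (\<lambda>(\<sigma>, \<tau>). (pair_word g h \<tau>, \<sigma> \<circ> \<tau>)) (fiber_inc h \<times> fiber_inc g)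
    (SIGMA hs:pair_words g h. fiber_inc hs)"
  unfolding bij_betw_def
proof
  let ?n = "length g"
  show "inj_on (\<lambda>(\<sigma>, \<tau>). (pair_word g h \<tau>, \<sigma> \<circ> \<tau>)) (fiber_inc h \<times> fiber_inc g)"
  proof (rule inj_onI, clarsimp)
    fix \<sigma> \<tau> \<sigma>' \<tau>'
    assume \<sigma>: "\<sigma> \<in> fiber_inc h" "\<sigma>' \<in> fiber_inc h" and \<tau>: "\<tau> \<in> fiber_inc g" "\<tau>' \<in> fiber_inc g"
      and eq: "pair_word g h \<tau> = pair_word g h \<tau>'" "\<sigma> \<circ> \<tau> = \<sigma>' \<circ> \<tau>'"
    have perm: "\<tau> permutes {1..?n}" "\<tau>' permutes {1..?n}" using \<tau> by (auto simp: fiber_inc_def)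
    have "\<sigma> (\<tau> i) = \<sigma>' (\<tau>' i)" for i using eq(2) by (metis comp_apply)
    then have "\<tau> = \<tau>'"
      using pair_word_order[OF h \<sigma>(1) perm(1)] pair_word_order[OF h \<sigma>(2) perm(2)] eq(1)
      by (intro permutes_order_unique[OF perm]) simp
    moreover from this have "\<sigma> = \<sigma>'"
      using eq(2) permutes_surj[OF perm(1)] by (metis comp_apply ext surjD)
    ultimately show "\<sigma> = \<sigma>' \<and> \<tau> = \<tau>'" by simp
  qed
  show "(\<lambda>(\<sigma>, \<tau>). (pair_word g h \<tau>, \<sigma> \<circ> \<tau>)) ` (fiber_inc h \<times> fiber_inc g) = (SIGMA hs:pair_words g h. fiber_inc hs)"
  proof
    show "(\<lambda>(\<sigma>, \<tau>). (pair_word g h \<tau>, \<sigma> \<circ> \<tau>)) ` (fiber_inc h \<times> fiber_inc g) \<subseteq> (SIGMA hs:pair_words g h. fiber_inc hs)"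
    proof clarsimp
      fix \<sigma> \<tau> assume \<sigma>: "\<sigma> \<in> fiber_inc h" and \<tau>: "\<tau> \<in> fiber_inc g"
      have perm: "\<sigma> permutes {1..?n}" "\<tau> permutes {1..?n}" using \<sigma> \<tau> h(2) by (auto simp: fiber_inc_def)
      have "\<sigma> (\<tau> i) < \<sigma> (\<tau> j)" if ij: "i \<in> {1..?n}" "j \<in> {1..?n}" "i < j"
        "pair_word g h \<tau> ! (i - 1) = pair_word g h \<tau> ! (j - 1)" for i j
      proof -
        have "g ! (i - 1) = g ! (j - 1)" "h ! (\<tau> i - 1) = h ! (\<tau> j - 1)"
          using ij(4) unfolding nth_pair_word[OF ij(1)] nth_pair_word[OF ij(2)] by auto
        moreover from this(1) have "\<tau> i < \<tau> j" using \<tau> ij by (auto simp: fiber_inc_def)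
        moreover have "\<tau> i \<in> {1..?n}" "\<tau> j \<in> {1..?n}" using permutes_in_image[OF perm(2)] ij by metis+
        ultimately show ?thesis using \<sigma> h(2) by (auto simp: fiber_inc_def)
      qed
      then have "\<sigma> \<circ> \<tau> \<in> fiber_inc (pair_word g h \<tau>)"
        using permutes_compose[OF perm(2,1)] by (auto simp: fiber_inc_def simp del: One_nat_def)
      then show "pair_word g h \<tau> \<in> pair_words g h \<and> \<sigma> \<circ> \<tau> \<in> fiber_inc (pair_word g h \<tau>)"
        using pair_word_in[OF g h \<tau>] by simp
    qed
    show "(SIGMA hs:pair_words g h. fiber_inc hs) \<subseteq> (\<lambda>(\<sigma>, \<tau>). (pair_word g h \<tau>, \<sigma> \<circ> \<tau>)) ` (fiber_inc h \<times> fiber_inc g)"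
    proof clarify
      fix hs \<pi> assume hs: "hs \<in> pair_words g h" and \<pi>: "\<pi> \<in> fiber_inc hs"
      have sorted_hs: "sorted hs" using hs by (simp add: pair_words_def)
      have "length (map fst hs) = ?n"
        by (rule count_list_eq_length) (use hs in \<open>simp add: pair_words_def\<close>)
      then have len: "length hs = ?n" by simp
      have perm_\<pi>: "\<pi> permutes {1..?n}" using \<pi> by (simp add: fiber_inc_def len)
      have "sorted (map fst hs)"
        using sorted_hs unfolding sorted_map
        by (rule sorted_wrt_mono_rel[rotated]) (auto simp: less_eq_prod_def)
      then have g_eq: "map fst hs = g"
        using g hs by (intro sorted_eqI_count) (auto simp: pair_words_def)
      have g_nth: "g ! (i - 1) = fst (hs ! (i - 1))" if "i \<in> {1..?n}" for i
      proof -
        have "i - 1 < length hs" using that len by auto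
        then have "map fst hs ! (i - 1) = fst (hs ! (i - 1))" by simp
        then show ?thesis by (simp only: g_eq)
      qed
      \<comment> \<open>Modelled on \<open>pair_word_order\<close>: any preimage must order
        positions by this key.\<close>
      define key where "key i = (snd (hs ! (i - 1)), \<pi> i)" for i
      have "inj_on key {1..?n}"
        using permutes_inj[OF perm_\<pi>] by (auto simp: inj_on_def key_def dest: injD)
      then obtain \<tau> where \<tau>: "\<tau> permutes {1..?n}"
        and order: "\<And>i j. i \<in> {1..?n} \<Longrightarrow> j \<in> {1..?n} \<Longrightarrow> \<tau> i < \<tau> j \<longleftrightarrow> key i < key j"
        by (rule rank_permutation) blast
      define \<rho> where "\<rho> = inv_into UNIV \<tau>"
      have \<rho>: "\<rho> permutes {1..?n}" unfolding \<rho>_def by (rule permutes_inv[OF \<tau>])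
      have \<rho>\<tau>: "\<rho> (\<tau> i) = i" "\<tau> (\<rho> i) = i" for i
        unfolding \<rho>_def using permutes_inverses[OF \<tau>] by auto
      have \<rho>_in: "\<rho> k \<in> {1..?n}" if "k \<in> {1..?n}" for k using permutes_in_image[OF \<rho>] that by metis
      have \<tau>_in: "\<tau> k \<in> {1..?n}" if "k \<in> {1..?n}" for k using permutes_in_image[OF \<tau>] that by metis
      have key_\<rho>: "key (\<rho> k) < key (\<rho> l)" if "k \<in> {1..?n}" "l \<in> {1..?n}" "k < l" for k l
        using order[of "\<rho> k" "\<rho> l"] \<rho>_in that by (simp add: \<rho>\<tau>)
      \<comment> \<open>Listing columns in the order of the keys sorts them; a sorted list with the
        counts of h is h.\<close>
      have "map (\<lambda>i. map snd hs ! (\<rho> i - 1)) [1..<Suc ?n] = h"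
      proof (rule sorted_eqI_count[OF _ h(1)])
        show "sorted (map (\<lambda>i. map snd hs ! (\<rho> i - 1)) [1..<Suc ?n])"
          unfolding sorted_wrt_iff_nth_less
        proof (safe, simp del: upt_Suc)
          fix i j assume "i < j" "j < ?n"
          then have "Suc i \<in> {1..?n}" "Suc j \<in> {1..?n}" "Suc i < Suc j" by auto
          then have "key (\<rho> (Suc i)) < key (\<rho> (Suc j))"
            and "\<rho> (Suc i) \<in> {1..?n}" "\<rho> (Suc j) \<in> {1..?n}"
            using key_\<rho> \<rho>_in by blast+
          then show "map snd hs ! (\<rho> (Suc i) - Suc 0) \<le> map snd hs ! (\<rho> (Suc j) - Suc 0)"
            using len by (auto simp: key_def)
        qed
        show "count_list (map (\<lambda>i. map snd hs ! (\<rho> i - 1)) [1..<Suc ?n]) x = count_list h x" for x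
          using count_list_permuted[of \<rho> "map snd hs" x] \<rho> hs by (simp add: len pair_words_def)
      qed
      then have h_\<rho>: "h ! (k - 1) = snd (hs ! (\<rho> k - 1))" if "k \<in> {1..?n}" for k
        using that \<rho>_in[OF that] len by (auto simp del: upt_Suc)
      have h_\<tau>: "h ! (\<tau> i - 1) = snd (hs ! (i - 1))" if "i \<in> {1..?n}" for i
        using h_\<rho>[OF \<tau>_in[OF that]] by (simp add: \<rho>\<tau>)
      have "\<pi> \<circ> \<rho> \<in> fiber_inc h"
      proof -
        have "\<pi> (\<rho> k) < \<pi> (\<rho> l)" if "k \<in> {1..?n}" "l \<in> {1..?n}" "k < l" "h ! (k - 1) = h ! (l - 1)" for k l
          using key_\<rho>[OF that(1-3)] that(4) h_\<rho>[OF that(1)] h_\<rho>[OF that(2)] by (auto simp: key_def)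
        then show ?thesis
          using permutes_compose[OF \<rho> perm_\<pi>] h(2) by (auto simp: fiber_inc_def simp del: One_nat_def)
      qed
      moreover have "\<tau> \<in> fiber_inc g"
      proof -
        \<comment> \<open>Within a row of the matrix the columns weakly increase because hs is
          sorted, and equal cells are separated by the monotonicity of \<pi> on its fibers.\<close>
        have "\<tau> i < \<tau> j" if ij: "i \<in> {1..?n}" "j \<in> {1..?n}" "i < j" "g ! (i - 1) = g ! (j - 1)" for i j
        proof -
          have "hs ! (i - 1) \<le> hs ! (j - 1)" using sorted_hs ij len by (intro sorted_nth_mono) auto
          moreover have "fst (hs ! (i - 1)) = fst (hs ! (j - 1))"
            using ij(4) by (simp only: g_nth[OF ij(1)] g_nth[OF ij(2)])
          moreover have "\<pi> i < \<pi> j" if "hs ! (i - 1) = hs ! (j - 1)"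
            using \<pi> that ij len by (auto simp: fiber_inc_def)
          ultimately have "key i < key j"
            by (cases "snd (hs ! (i - 1)) = snd (hs ! (j - 1))")
              (auto simp: key_def less_eq_prod_def prod_eq_iff)
          then show ?thesis using order ij by simp
        qed
        then show ?thesis using \<tau> by (auto simp: fiber_inc_def simp del: One_nat_def)
      qed
      moreover have "pair_word g h \<tau> = hs"
      proof (rule nth_equalityI)
        fix i assume "i < length (pair_word g h \<tau>)"
        then have i: "Suc i \<in> {1..?n}" by simp
        show "pair_word g h \<tau> ! i = hs ! i"
          using nth_pair_word[OF i, of h \<tau>] h_\<tau>[OF i] g_nth[OF i] by (simp add: prod_eq_iff)
      qed (simp add: len)
      moreover have "\<pi> \<circ> \<rho> \<circ> \<tau> = \<pi>" by (auto simp: \<rho>\<tau>)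
      ultimately show "(hs, \<pi>) \<in> (\<lambda>(\<sigma>, \<tau>). (pair_word g h \<tau>, \<sigma> \<circ> \<tau>)) ` (fiber_inc h \<times> fiber_inc g)"
        by (intro image_eqI[of _ _ "(\<pi> \<circ> \<rho>, \<tau>)"]) auto
    qed
  qed
qed

subsection \<open>Block sums as sums over fiber-increasing permutations\<close>

lemma csize_append [simp]: "csize (v @ w) = csize v + csize w"
  by (simp add: csize_def)

lemma csize_Nil [simp]: "csize [] = 0"
  by (simp add: csize_def)

lemma csize_single [simp]: "csize [x] = fst x"
  by (simp add: csize_def)

lemma cblock_append: "k < length v \<Longrightarrow> cblock (v @ w) k = cblock v k"
  by (simp add: cblock_def)

lemma cblock_exists: "i \<in> {1..csize v} \<Longrightarrow> \<exists>k<length v. i \<in> cblock v k"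
proof (induction v rule: rev_induct)
  case (snoc x v)
  show ?case
  proof (cases "i \<le> csize v")
    case True
    then obtain k where "k < length v" "i \<in> cblock v k" using snoc by auto
    then show ?thesis by (intro exI[of _ k]) (simp add: cblock_append)
  next
    case False
    then show ?thesis using snoc.prems by (intro exI[of _ "length v"]) (simp add: cblock_def)
  qed
qed simp

lemma unrl_append [simp]: "unrl (xs @ ys) = unrl xs @ unrl ys"
  by (simp add: unrl_def)

lemma csize_relabelled: "csize (map (\<lambda>(n, x). (n, col x)) zs) = length (unrl zs)"
  by (induction zs) (auto simp: csize_def)

lemma cblock_label:
  assumes k: "k < length zs" and i: "i \<in> cblock (map (\<lambda>(n, x). (n, col x)) zs) k"
  shows "i \<in> {1..length (unrl zs)}" "unrl zs ! (i - 1) = snd (zs ! k)"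
proof -
  let ?v = "map (\<lambda>(n, x). (n, col x)) zs"
  obtain n x where nx: "zs ! k = (n, x)" by force
  have zs: "zs = take k zs @ (n, x) # drop (Suc k) zs"
    using id_take_nth_drop[OF k] nx by simp
  have len: "csize (take j ?v) = length (unrl (take j zs))" for j
    by (simp add: take_map csize_relabelled)
  have "unrl (take (Suc k) zs) = unrl (take k zs) @ replicate n x"
    using k nx by (simp add: take_Suc_conv_app_nth)
  with i have i': "length (unrl (take k zs)) < i" "i \<le> length (unrl (take k zs)) + n"
    by (auto simp: cblock_def len)
  have u: "unrl zs = unrl (take k zs) @ replicate n x @ unrl (drop (Suc k) zs)"
    by (subst zs) (simp only: unrl_append unrl_Cons)
  show "i \<in> {1..length (unrl zs)}" using i' by (subst u) auto
  show "unrl zs ! (i - 1) = snd (zs ! k)"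
    using i' by (subst u) (auto simp: nth_append nx)
qed

text \<open>The restriction matches the extensional colorings that form the carrier of
  \<open>wreath\<close>.\<close>

definition fiber_colors :: "'a list \<Rightarrow> ('a \<Rightarrow> 'c) \<Rightarrow> nat \<Rightarrow> 'c" where
  "fiber_colors h col = restrict (\<lambda>i. col (h ! (i - 1))) {1..length h}"

text \<open>Distinct labels make the blocks exactly the fibers of the unrolled list. Distinctness
  concerns labels and not colors: neighbouring blocks may share a color without merging.\<close>

lemma cblock_condition:
  fixes zs :: "(nat \<times> 'a) list" and col :: "'a \<Rightarrow> 'c"
  assumes "distinct (map snd zs)"
  defines "v \<equiv> map (\<lambda>(n, x). (n, col x)) zs" and "n \<equiv> length (unrl zs)"
  shows "(\<forall>k<length v. strict_mono_on (cblock v k) \<sigma> \<and> (\<forall>i\<in>cblock v k. c i = snd (v ! k))) \<longleftrightarrow>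
    (\<forall>i\<in>{1..n}. c i = col (unrl zs ! (i - 1))) \<and>
    (\<forall>i\<in>{1..n}. \<forall>j\<in>{1..n}. i < j \<and> unrl zs ! (i - 1) = unrl zs ! (j - 1) \<longrightarrow> \<sigma> i < \<sigma> j)"
    (is "?L \<longleftrightarrow> ?R1 \<and> ?R2")
proof -
  have len: "length v = length zs" by (simp add: v_def)
  have label: "i \<in> {1..n}" "unrl zs ! (i - 1) = snd (zs ! k)" if "k < length zs" "i \<in> cblock v k" for i k
    using cblock_label[OF that(1), of i col] that(2) by (simp_all add: v_def n_def)
  have block: "\<exists>k<length zs. i \<in> cblock v k" if "i \<in> {1..n}" for i
    using cblock_exists[of i v] that by (simp add: v_def n_def csize_relabelled)
  have snd_v: "snd (v ! k) = col (snd (zs ! k))" if "k < length zs" for k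
    using that by (simp add: v_def case_prod_unfold)
  have colors: "(\<forall>k<length zs. \<forall>i\<in>cblock v k. c i = snd (v ! k)) \<longleftrightarrow> ?R1"
    using label block snd_v by metis
  have "(\<forall>k<length zs. strict_mono_on (cblock v k) \<sigma>) \<longleftrightarrow> ?R2"
  proof safe
    fix i j assume mono: "\<forall>k<length zs. strict_mono_on (cblock v k) \<sigma>"
      and ij: "i \<in> {1..n}" "j \<in> {1..n}" "i < j" "unrl zs ! (i - 1) = unrl zs ! (j - 1)"
    obtain k l where kl: "k < length zs" "i \<in> cblock v k" "l < length zs" "j \<in> cblock v l"
      using block ij by metis
    then have "snd (zs ! k) = snd (zs ! l)" using label ij(4) by metis
    then have "k = l" using assms(1) kl nth_eq_iff_index_eq[OF assms(1), of k l] by simp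
    then show "\<sigma> i < \<sigma> j" using mono kl ij(3) by (auto dest: strict_mono_onD)
  next
    fix k assume R2: ?R2 and k: "k < length zs"
    show "strict_mono_on (cblock v k) \<sigma>"
    proof (rule strict_mono_onI)
      fix i j assume "i \<in> cblock v k" "j \<in> cblock v k" "i < j"
      then show "\<sigma> i < \<sigma> j" using R2 label[OF k] by metis
    qed
  qed
  then show ?thesis using colors len by auto
qed

text \<open>The label type is free, so that one formula covers block indices, for a given
  composition, and matrix cells, for a term of a product.\<close>

lemma MR_B_unrl:
  fixes G :: "'c monoid"
  assumes G: "carrier G = UNIV" and zs: "distinct (map snd zs)"
  shows "(MR_B G (map (\<lambda>(n, x). (n, col x)) zs) :: _ \<Rightarrow>\<^sub>0 'k::field) =
    (\<Sum>\<sigma>\<in>fiber_inc (unrl zs). single (length (unrl zs), \<sigma>, fiber_colors (unrl zs) col) 1)"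
proof -
  let ?v = "map (\<lambda>(n, x). (n, col x)) zs"
  let ?n = "length (unrl zs)"
  let ?c = "fiber_colors (unrl zs) col"
  have n: "csize ?v = ?n" by (rule csize_relabelled)
  have "{(\<sigma>, c) \<in> carrier (wreath G (csize ?v)). \<forall>k < length ?v.
        strict_mono_on (cblock ?v k) \<sigma> \<and> (\<forall>i \<in> cblock ?v k. c i = snd (?v ! k))} =
      (\<lambda>\<sigma>. (\<sigma>, ?c)) ` fiber_inc (unrl zs)"
    unfolding cblock_condition[OF zs, of col] n
  proof (safe, goal_cases)
    case (1 \<sigma> c)
    then have "c = ?c" "\<sigma> \<in> fiber_inc (unrl zs)"
      by (auto simp: wreath_def fiber_colors_def fiber_inc_def PiE_iff simp del: One_nat_def
          intro!: extensionalityI[of c "{1..?n}"] restrict_extensional)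
    then show ?case by auto
  next
    case (2 a b \<sigma>)
    then show ?case by (auto simp: wreath_def fiber_colors_def fiber_inc_def G)
  next
    case (3 a b \<sigma> i)
    then show ?case by (simp add: fiber_colors_def)
  next
    case (4 a b \<sigma> i j)
    then show ?case by (simp add: fiber_inc_def del: One_nat_def)
  qed
  then show ?thesis
    unfolding MR_B_def by (simp add: n sum.reindex inj_on_def)
qed

lemma MR_B_alt:
  fixes G :: "'c monoid"
  assumes "carrier G = UNIV"
  shows "(MR_B G v :: _ \<Rightarrow>\<^sub>0 'k::field) = (\<Sum>\<sigma>\<in>fiber_inc (block_row v).
    single (csize v, \<sigma>, fiber_colors (block_row v) (\<lambda>r. snd (v ! r))) 1)"
proof -
  let ?zs = "zip (map fst v) [0..<length v]"
  have v: "map (\<lambda>(n, r). (n, snd (v ! r))) ?zs = v"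
    by (rule nth_equalityI) auto
  show ?thesis
    using MR_B_unrl[OF assms, of ?zs "\<lambda>r. snd (v ! r)", where ?'k = 'k]
      csize_relabelled[of "\<lambda>r. snd (v ! r)" ?zs]
    unfolding v by (simp add: block_row_def)
qed

lemma length_block_row: "length (block_row v) = csize v"
proof -
  let ?zs = "zip (map fst v) [0..<length v]"
  have v: "map (\<lambda>(n, r). (n, snd (v ! r))) ?zs = v"
    by (rule nth_equalityI) auto
  show ?thesis
    using csize_relabelled[of "\<lambda>r. snd (v ! r)" ?zs] unfolding v by (simp add: block_row_def)
qed

lemma matrix_words_alt: "matrix_words v w = pair_words (block_row v) (block_row w)"
  by (simp add: matrix_words_def pair_words_def)

lemma matrix_words_length: "hs \<in> matrix_words v w \<Longrightarrow> length hs = csize v \<and> length hs = csize w"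
  using count_list_eq_length[of "map fst hs" "block_row v"] count_list_eq_length[of "map snd hs" "block_row w"]
  by (simp add: matrix_words_def length_block_row)

lemma MR_B_matrix_comp:
  fixes G :: "'c monoid"
  assumes "carrier G = UNIV" "hs \<in> matrix_words v w"
  shows "(MR_B G (matrix_comp G v w hs) :: _ \<Rightarrow>\<^sub>0 'k::field) = (\<Sum>\<pi>\<in>fiber_inc hs.
    single (csize v, \<pi>, fiber_colors hs (\<lambda>(r, s). snd (v ! r) \<otimes>\<^bsub>G\<^esub> snd (w ! s))) 1)"
proof -
  have "distinct (map snd (rle hs))"
    using sorted_rle[of hs] by (simp add: strict_sorted_iff)
  moreover have "unrl (rle hs) = hs"
    using assms(2) by (simp add: unrl_rle matrix_words_def)
  moreover have "matrix_comp G v w hs = map (\<lambda>(n, x). (n, (\<lambda>(r, s). snd (v ! r) \<otimes>\<^bsub>G\<^esub> snd (w ! s)) x)) (rle hs)"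
    by (simp add: matrix_comp_def case_prod_unfold)
  ultimately show ?thesis
    using MR_B_unrl[OF assms(1), of "rle hs" "\<lambda>(r, s). snd (v ! r) \<otimes>\<^bsub>G\<^esub> snd (w ! s)", where ?'k = 'k]
      matrix_words_length[OF assms(2)] by simp
qed

lemma group_alg_mult_single:
  "group_alg_mult G (single (n, g) 1) (single (m, h) (1::'k::field)) =
    (if n = m then single (n, g \<otimes>\<^bsub>wreath G n\<^esub> h) 1 else 0)"
  by (simp add: group_alg_mult_def)

lemma lin_group_alg_mult_left: "lin f \<Longrightarrow> lin (\<lambda>x. group_alg_mult G (f x) y)"
  unfolding group_alg_mult_def by (rule lin_lin_extend_comp)

lemma lin_group_alg_mult_right: "lin f \<Longrightarrow> lin (\<lambda>y. group_alg_mult G x (f y))"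
  unfolding group_alg_mult_def case_prod_unfold
  by (rule lin_lin_extend_param) (rule lin_lin_extend_comp)

text \<open>The opposite product puts w on the left, so \<sigma> comes from w and \<tau> from v. The
  color of the product at i is the color of the block of \<tau> i in w times that of the block of i
  in v, the reverse of the order in \<open>matrix_comp\<close>; commutativity makes them
  agree.\<close>

theorem MR_internal_MR_B:
  fixes G :: "'c monoid"
  assumes G: "carrier G = UNIV" and comm: "\<And>a b. a \<otimes>\<^bsub>G\<^esub> b = b \<otimes>\<^bsub>G\<^esub> a"
  shows "MR_internal G (MR_B G v) (MR_B G w :: _ \<Rightarrow>\<^sub>0 'k::field) =
    (\<Sum>hs\<in>matrix_words v w. MR_B G (matrix_comp G v w hs))"
proof (cases "csize v = csize w")
  case False
  \<comment> \<open>Row sums and column sums of a matrix have the same total.\<close>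
  then have "matrix_words v w = {}" using matrix_words_length[of _ v w] by fastforce
  moreover have "group_alg_mult G (MR_B G w) (MR_B G v :: _ \<Rightarrow>\<^sub>0 'k) = 0"
    using False unfolding MR_B_alt[OF G]
    by (simp add: lin_sum[OF lin_group_alg_mult_left[OF lin_ident]]
        lin_sum[OF lin_group_alg_mult_right[OF lin_ident]] group_alg_mult_single)
  ultimately show ?thesis by (simp add: MR_internal_def)
next
  case True
  let ?g = "block_row v" and ?h = "block_row w" and ?n = "csize v"
  define col where "col = (\<lambda>(r, s). snd (v ! r) \<otimes>\<^bsub>G\<^esub> snd (w ! s))"
  define F :: "(nat \<times> nat) list \<times> (nat \<Rightarrow> nat) \<Rightarrow> 'c wr \<Rightarrow>\<^sub>0 'k"
    where "F = (\<lambda>(hs, \<pi>). single (?n, \<pi>, fiber_colors hs col) 1)"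
  have len: "length ?g = ?n" "length ?h = ?n" using True by (auto simp: length_block_row)
  have colors: "(\<sigma>, fiber_colors ?h (\<lambda>r. snd (w ! r))) \<otimes>\<^bsub>wreath G ?n\<^esub> (\<tau>, fiber_colors ?g (\<lambda>r. snd (v ! r)))
      = (\<sigma> \<circ> \<tau>, fiber_colors (pair_word ?g ?h \<tau>) col)" if "\<tau> \<in> fiber_inc ?g" for \<sigma> \<tau>
  proof -
    have \<tau>: "\<tau> permutes {1..?n}" using that by (simp add: fiber_inc_def len)
    have "fiber_colors ?h (\<lambda>r. snd (w ! r)) (\<tau> i) \<otimes>\<^bsub>G\<^esub> fiber_colors ?g (\<lambda>r. snd (v ! r)) i
      = col (pair_word ?g ?h \<tau> ! (i - 1))" if i: "i \<in> {1..?n}" for i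
    proof -
      have "\<tau> i \<in> {1..?n}" using permutes_in_image[OF \<tau>] i by metis
      then show ?thesis
        using i nth_pair_word[of i ?g ?h \<tau>]
        by (simp add: fiber_colors_def len col_def comm[of "snd (w ! _)"])
    qed
    then show ?thesis
      by (auto simp: wreath_def fiber_colors_def[of "pair_word ?g ?h \<tau>"] len intro!: restrict_ext)
  qed
  have "MR_internal G (MR_B G v) (MR_B G w) = (\<Sum>\<sigma>\<in>fiber_inc ?h. \<Sum>\<tau>\<in>fiber_inc ?g.
      F (pair_word ?g ?h \<tau>, \<sigma> \<circ> \<tau>))"
    unfolding MR_internal_def MR_B_alt[OF G]
    by (simp add: lin_sum[OF lin_group_alg_mult_left[OF lin_ident]]
        lin_sum[OF lin_group_alg_mult_right[OF lin_ident]] group_alg_mult_single True[symmetric] colors F_def)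
      (rule sum.swap)
  also have "\<dots> = (\<Sum>p\<in>fiber_inc ?h \<times> fiber_inc ?g. F ((\<lambda>(\<sigma>, \<tau>). (pair_word ?g ?h \<tau>, \<sigma> \<circ> \<tau>)) p))"
    by (simp add: sum.cartesian_product case_prod_unfold)
  \<comment> \<open>Colors depend on the pair of \<sigma> and \<tau> only through its matrix word,
    so the summand is a function on the target of \<open>pair_word_bij\<close>.\<close>
  also have "\<dots> = (\<Sum>q\<in>(SIGMA hs:matrix_words v w. fiber_inc hs). F q)"
    unfolding matrix_words_alt
    by (rule sum.reindex_bij_betw[OF pair_word_bij]) (simp_all add: sorted_block_row len)
  also have "\<dots> = (\<Sum>hs\<in>matrix_words v w. MR_B G (matrix_comp G v w hs))"
    by (simp add: sum.Sigma[symmetric] MR_B_matrix_comp[OF G] F_def col_def)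
  finally show ?thesis .
qed

subsection \<open>Linear independence of the block sums\<close>

lemma set_block_row_eq: "pos_comp v \<Longrightarrow> set (block_row v) = {..<length v}"
proof -
  assume v: "pos_comp v"
  have "r \<in> set (block_row v)" if "r < length v" for r
  proof -
    have "fst (v ! r) \<ge> 1" using v nth_mem[OF that] by (cases "v ! r") (auto simp: pos_comp_def)
    then show ?thesis using count_block_row[of v r] that count_notin by fastforce
  qed
  then show ?thesis using set_block_row[of v] by auto
qed

text \<open>The permutation \<open>\<sigma>\<close> below separates \<open>MR_B G v\<close> from every other \<open>MR_B G w\<close> with at most as many blocks.\<close>

lemma block_descents_exist:
  obtains \<sigma> where "\<sigma> \<in> fiber_inc (block_row v)"
    "\<And>i j. i \<in> {1..csize v} \<Longrightarrow> j \<in> {1..csize v} \<Longrightarrow> block_row v ! (i - 1) < block_row v ! (j - 1) \<Longrightarrow> \<sigma> j < \<sigma> i"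
proof -
  \<comment> \<open>Later blocks get smaller keys, so every two positions in different blocks become
    an inversion; \<open>bound\<close> keeps the truncated subtraction faithful.\<close>
  define key where "key i = (length v - block_row v ! (i - 1), i)" for i
  have bound: "block_row v ! (i - 1) < length v" if "i \<in> {1..csize v}" for i
    using set_block_row[of v] nth_mem[of "i - 1" "block_row v"] that
    by (fastforce simp: length_block_row)
  have "inj_on key {1..csize v}" by (auto simp: inj_on_def key_def)
  then obtain \<sigma> where \<sigma>: "\<sigma> permutes {1..csize v}"
    and order: "\<And>i j. i \<in> {1..csize v} \<Longrightarrow> j \<in> {1..csize v} \<Longrightarrow> \<sigma> i < \<sigma> j \<longleftrightarrow> key i < key j"
    by (rule rank_permutation) blast
  show ?thesis
  proof
    show "\<sigma> \<in> fiber_inc (block_row v)"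
      using \<sigma> order by (auto simp: fiber_inc_def length_block_row key_def simp del: One_nat_def)
    show "\<sigma> j < \<sigma> i" if "i \<in> {1..csize v}" "j \<in> {1..csize v}" "block_row v ! (i - 1) < block_row v ! (j - 1)" for i j
      using order[OF that(2,1)] that(3) bound[OF that(2)] by (auto simp: key_def)
  qed
qed

text \<open>Positive parts leave no block empty, so a sorted list of labels cannot skip one.\<close>

lemma block_row_steps:
  assumes v: "pos_comp v" and i: "Suc i < csize v"
  shows "block_row v ! Suc i \<le> Suc (block_row v ! i)"
proof (rule ccontr)
  let ?g = "block_row v"
  assume "\<not> ?thesis"
  then have gap: "Suc (?g ! i) < ?g ! Suc i" by simp
  have "?g ! Suc i \<in> set ?g" using i by (simp add: length_block_row)
  then have "Suc (?g ! i) \<in> set ?g" using gap set_block_row_eq[OF v] by auto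
  then obtain k where k: "k < csize v" "?g ! k = Suc (?g ! i)"
    by (auto simp: in_set_conv_nth length_block_row)
  have "k \<le> i \<or> Suc i \<le> k" by auto
  then show False
  proof
    assume "k \<le> i"
    then have "?g ! k \<le> ?g ! i" using i sorted_block_row[of v] by (intro sorted_nth_mono) (auto simp: length_block_row)
    then show False using k by simp
  next
    assume "Suc i \<le> k"
    then have "?g ! Suc i \<le> ?g ! k" using k sorted_block_row[of v] by (intro sorted_nth_mono) (auto simp: length_block_row)
    then show False using k gap by simp
  qed
qed

text \<open>Each step up in the labels of v has height 1 and forces a step up in those of w, so the
  difference of labels, w minus v, never decreases. It is 0 at the first position and at most 0 at
  the last, by the assumption on the number of blocks, so it vanishes throughout.\<close>

lemma block_row_refine:
  fixes v w :: "'c ccomp"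
  assumes v: "pos_comp v" and w: "pos_comp w" and size: "csize w = csize v" and len: "length w \<le> length v"
    and refine: "\<And>i j. i < j \<Longrightarrow> j < csize v \<Longrightarrow> block_row w ! i = block_row w ! j \<Longrightarrow> block_row v ! i = block_row v ! j"
  shows "block_row w = block_row v"
proof -
  let ?g = "block_row v" and ?h = "block_row w" and ?n = "csize v"
  have incr: "?g ! Suc i + ?h ! i \<le> ?g ! i + ?h ! Suc i" if "Suc i < ?n" for i
  proof (cases "?h ! i = ?h ! Suc i")
    case True
    then show ?thesis using refine[of i "Suc i"] that by simp
  next
    case False
    moreover have "?h ! i \<le> ?h ! Suc i"
      using that size sorted_block_row[of w] by (intro sorted_nth_mono) (auto simp: length_block_row)
    ultimately show ?thesis using block_row_steps[OF v that] by linarith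
  qed
  have diff: "?g ! j + ?h ! i \<le> ?g ! i + ?h ! j" if "i \<le> j" "j < ?n" for i j
    using that
  proof (induction j rule: dec_induct)
    case (step j)
    then show ?case using incr[of j] by simp
  qed simp
  have first: "block_row u ! 0 = 0" if u: "pos_comp u" "csize u > 0" for u :: "'c ccomp"
  proof -
    have "0 \<in> set (block_row u)"
      using u set_block_row_eq[OF u(1)] length_block_row[of u] by (cases u) auto
    then obtain k where "k < csize u" "block_row u ! k = 0"
      by (auto simp: in_set_conv_nth length_block_row)
    moreover have "block_row u ! 0 \<le> block_row u ! k"
      using sorted_block_row[of u] \<open>k < csize u\<close> by (intro sorted_nth_mono) (auto simp: length_block_row)
    ultimately show ?thesis by simp
  qed
  have last: "block_row u ! (csize u - 1) = length u - 1" if u: "pos_comp u" "csize u > 0" for u :: "'c ccomp"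
  proof -
    have "length u > 0" using u(2) by (cases u) auto
    then have "length u - 1 \<in> set (block_row u)"
      using set_block_row_eq[OF u(1)] by auto
    then obtain k where "k < csize u" "block_row u ! k = length u - 1"
      by (auto simp: in_set_conv_nth length_block_row)
    moreover have "block_row u ! k \<le> block_row u ! (csize u - 1)"
      using sorted_block_row[of u] \<open>k < csize u\<close> by (intro sorted_nth_mono) (auto simp: length_block_row)
    moreover have "block_row u ! (csize u - 1) \<in> set (block_row u)"
      using u(2) by (intro nth_mem) (simp add: length_block_row)
    ultimately show ?thesis using set_block_row_eq[OF u(1)] by auto
  qed
  show ?thesis
  proof (rule nth_equalityI)
    fix i assume "i < length ?h"
    then have i: "i < ?n" by (simp add: length_block_row size)
    have n: "csize v > 0" "csize w > 0" using i size by auto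
    have "?g ! i \<le> ?h ! i" using diff[of 0 i] i first[OF v n(1)] first[OF w n(2)] by simp
    moreover have "i \<le> ?n - 1" "?n - 1 < ?n" using i by auto
    then have "?h ! i \<le> ?g ! i"
      using diff[of i "?n - 1"] last[OF v n(1)] last[OF w n(2)] size len by simp
    ultimately show "?h ! i = ?g ! i" by simp
  qed (simp add: length_block_row size)
qed

lemma block_row_inject:
  assumes v: "pos_comp v" and w: "pos_comp w" and row: "block_row w = block_row v"
    and colors: "fiber_colors (block_row w) (\<lambda>r. snd (w ! r)) = fiber_colors (block_row v) (\<lambda>r. snd (v ! r))"
  shows "w = v"
proof -
  have len: "length w = length v"
    using set_block_row_eq[OF v] set_block_row_eq[OF w] row by simp
  have "w ! r = v ! r" if r: "r < length v" for r
  proof (rule prod_eqI)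
    show "fst (w ! r) = fst (v ! r)"
      using count_block_row[of v r] count_block_row[of w r] row r len by simp
    have "r \<in> set (block_row v)" using set_block_row_eq[OF v] r by simp
    then obtain i where "i < length (block_row v)" "block_row v ! i = r" by (auto simp: in_set_conv_nth)
    then show "snd (w ! r) = snd (v ! r)"
      using fun_cong[OF colors, of "Suc i"] by (simp add: fiber_colors_def row)
  qed
  then show ?thesis using len by (intro nth_equalityI) auto
qed

lemma lookup_MR_B:
  fixes G :: "'c monoid"
  assumes "carrier G = UNIV"
  shows "(lookup (MR_B G v) (n, \<sigma>, c) :: 'k::field) =
    (if n = csize v \<and> \<sigma> \<in> fiber_inc (block_row v) \<and> c = fiber_colors (block_row v) (\<lambda>r. snd (v ! r)) then 1 else 0)"
proof -
  let ?c = "fiber_colors (block_row v) (\<lambda>r. snd (v ! r))"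
  have "(lookup (MR_B G v) (n, \<sigma>, c) :: 'k) = (\<Sum>\<tau>\<in>fiber_inc (block_row v).
      if \<tau> = \<sigma> then (if n = csize v \<and> c = ?c then 1 else 0) else 0)"
    unfolding MR_B_alt[OF assms] lookup_sum by (rule sum.cong) (auto simp: lookup_single when_def)
  then show ?thesis by (auto simp: sum.delta)
qed

text \<open>A longest composition v of the support is isolated by the basis element with the
  coloring of v and a \<sigma> that has inversions between all its blocks. If this element occurs in
  the block sum of w, then no block of w meets two blocks of v; since w has no more blocks than v,
  both have the same blocks and colors.\<close>

lemma MR_B_independent:
  fixes G :: "'c monoid" and p :: "'c ccomp \<Rightarrow>\<^sub>0 'k::field"
  assumes G: "carrier G = UNIV" and p: "keys p \<subseteq> Collect pos_comp" and zero: "lin_extend (MR_B G) p = 0"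
  shows "p = 0"
proof (rule ccontr)
  assume "p \<noteq> 0"
  then have "keys p \<noteq> {}" by (metis in_keys_iff emptyE lookup_zero poly_mapping_eqI)
  then have "Max (length ` keys p) \<in> length ` keys p" by (intro Max_in) auto
  then obtain v where v: "v \<in> keys p" and "length v = Max (length ` keys p)" by auto
  then have max: "length w \<le> length v" if "w \<in> keys p" for w using that by simp
  have pos: "pos_comp w" if "w \<in> keys p" for w using p that by auto
  obtain \<sigma> where \<sigma>: "\<sigma> \<in> fiber_inc (block_row v)" and desc:
    "\<And>i j. i \<in> {1..csize v} \<Longrightarrow> j \<in> {1..csize v} \<Longrightarrow> block_row v ! (i - 1) < block_row v ! (j - 1) \<Longrightarrow> \<sigma> j < \<sigma> i"
    by (rule block_descents_exist) blast
  let ?c = "fiber_colors (block_row v) (\<lambda>r. snd (v ! r))"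
  have "lookup (MR_B G w) (csize v, \<sigma>, ?c) = (if w = v then 1 else (0::'k))" if w: "w \<in> keys p" for w
  proof (cases "csize v = csize w \<and> \<sigma> \<in> fiber_inc (block_row w) \<and> ?c = fiber_colors (block_row w) (\<lambda>r. snd (w ! r))")
    case True
    then have size: "csize w = csize v" by simp
    have "block_row w = block_row v"
    proof (rule block_row_refine[OF pos[OF v] pos[OF w] size max[OF w]])
      \<comment> \<open>Equal labels in w force \<sigma> to increase, which rules out two different
        blocks of v.\<close>
      fix i j assume ij: "i < j" "j < csize v" "block_row w ! i = block_row w ! j"
      have in_range: "Suc i \<in> {1..csize v}" "Suc j \<in> {1..csize v}" using ij by auto
      have "\<sigma> (Suc i) < \<sigma> (Suc j)"
        using True ij in_range by (auto simp: fiber_inc_def length_block_row)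
      then have "\<not> block_row v ! i < block_row v ! j" using desc[OF in_range] by auto
      moreover have "block_row v ! i \<le> block_row v ! j"
        using ij sorted_block_row[of v] by (intro sorted_nth_mono) (auto simp: length_block_row)
      ultimately show "block_row v ! i = block_row v ! j" by simp
    qed
    then have "w = v" using True by (intro block_row_inject pos v w) auto
    then show ?thesis using \<sigma> by (simp add: lookup_MR_B[OF G])
  next
    case False
    then have "w \<noteq> v" using \<sigma> by auto
    then show ?thesis using False by (auto simp: lookup_MR_B[OF G])
  qed
  then have "lookup (lin_extend (MR_B G) p) (csize v, \<sigma>, ?c) = (\<Sum>w\<in>keys p. if w = v then lookup p v else 0)"
    unfolding lookup_lin_extend by (intro sum.cong) auto
  then have "lookup p v = 0" using v zero by simp
  then show False using v by (simp add: in_keys_iff)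
qed

section \<open>The isomorphism\<close>

lemma pos_comp_Nil [simp]: "pos_comp []"
  by (simp add: pos_comp_def)

lemma pos_comp_Cons [simp]: "pos_comp ((n, u) # v) \<longleftrightarrow> n \<ge> 1 \<and> pos_comp v"
  by (simp add: pos_comp_def)

lemma pos_comp_append [simp]: "pos_comp (v @ w) \<longleftrightarrow> pos_comp v \<and> pos_comp w"
  by (auto simp: pos_comp_def)

lemma pos_comp_matrix_comp: "pos_comp (matrix_comp G v w hs)"
  using rle_pos[of _ _ hs] by (force simp: pos_comp_def matrix_comp_def)

lemma ccomps_eq: "carrier G = UNIV \<Longrightarrow> ccomps G = Collect pos_comp"
  by (auto simp: ccomps_def pos_comp_def)

lemma word_of_Nil [simp]: "word_of [] = 0"
  by (simp add: word_of_def zero_word_def)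

lemma word_of_append: "word_of (v @ w) = word_of v + word_of w"
  by (simp add: word_of_def plus_word_def)

text \<open>Positive parts make the color visible: \<open>mono_vec 0 u\<close> is the zero vector
  for every u.\<close>

lemma word_of_inj:
  fixes v w :: "'c::finite ccomp"
  assumes "pos_comp v" "pos_comp w" "word_of v = word_of w"
  shows "v = w"
proof -
  have "inj_on (\<lambda>(n, u :: 'c). Abs_nzvec (mono_vec n u)) (set v \<union> set w)"
  proof (rule inj_onI, clarify)
    fix n m :: nat and t u :: 'c
    assume "(n, t) \<in> set v \<union> set w" "(m, u) \<in> set v \<union> set w"
      and eq: "Abs_nzvec (mono_vec n t) = Abs_nzvec (mono_vec m u)"
    then have nm: "n \<ge> 1" "m \<ge> 1" using assms(1,2) by (auto simp: pos_comp_def)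
    then have "mono_vec n t = mono_vec m u" using eq Rep_Abs_mono_vec by metis
    then show "n = m \<and> t = u" using nm by (auto simp: mono_vec_def fun_eq_iff split: if_splits)
  qed
  then show ?thesis
    using assms(3) by (simp add: word_of_def inj_on_map_eq_map)
qed

lemma word_of_mono: "pos_comp v \<Longrightarrow> word_of v \<in> mono_words"
  unfolding mono_words_def
proof (safe)
  fix l assume v: "pos_comp v" and "l \<in> set (letters (word_of v))"
  then obtain n u where "(n, u) \<in> set v" "l = Abs_nzvec (mono_vec n u)"
    by (auto simp: word_of_def)
  moreover from this have "n \<ge> 1" using v by (auto simp: pos_comp_def)
  ultimately show "\<exists>n i. n \<ge> 1 \<and> Rep_nzvec l = mono_vec n i"
    by (intro exI[of _ n] exI[of _ u]) simp
qed

lemma mono_word_conv: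
  assumes "w \<in> mono_words" obtains v where "pos_comp v" "w = word_of v"
proof -
  have "\<exists>v. pos_comp v \<and> w = word_of v"
    using assms
  proof (induction w rule: word_induct)
    case zero
    then show ?case by (intro exI[of _ "[]"]) simp
  next
    case (add l w)
    then obtain v where v: "pos_comp v" "w = word_of v" by auto
    obtain n i where "n \<ge> 1" "Rep_nzvec l = mono_vec n i"
      using add.prems by (auto simp: mono_words_def plus_word_def)
    then have "Word [l] = word_of [(n, i)]"
      by (simp add: word_of_def) (metis Rep_nzvec_inverse)
    then show ?case using v \<open>n \<ge> 1\<close>
      by (intro exI[of _ "[(n, i)] @ v"]) (simp only: word_of_append, simp)
  qed
  then show ?thesis using that by blast
qed

lemma word_degree_word_of: "pos_comp v \<Longrightarrow> word_degree (word_of v) = csize v"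
proof (induction v)
  case (Cons x v)
  obtain n u where x: "x = (n, u)" by force
  have "word_of (x # v) = word_of [x] + word_of v" using word_of_append[of "[x]" v] by simp
  moreover have "word_degree (word_of [x]) = n"
    using Cons.prems vec_degree_mono[of n u] by (simp add: x word_of_def word_degree_letter vec_degree_def)
  ultimately show ?case using Cons by (simp add: x csize_def)
qed simp

definition comp_of :: "'c::finite nzvec word \<Rightarrow> 'c ccomp" where
  "comp_of = inv_into (Collect pos_comp) word_of"

lemma comp_of_word_of [simp]: "pos_comp v \<Longrightarrow> comp_of (word_of v) = v"
  unfolding comp_of_def by (rule inv_into_f_f) (auto simp: inj_on_def intro: word_of_inj)

lemma comp_of_mono: "w \<in> mono_words \<Longrightarrow> pos_comp (comp_of w) \<and> word_of (comp_of w) = w"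
  by (elim mono_word_conv) simp

lemma comp_of_0 [simp]: "comp_of 0 = []"
  using comp_of_word_of[of "[]"] by simp

lemma comp_of_add: "u \<in> mono_words \<Longrightarrow> v \<in> mono_words \<Longrightarrow> comp_of (u + v) = comp_of u @ comp_of v"
  using comp_of_word_of[of "comp_of u @ comp_of v"] comp_of_mono[of u] comp_of_mono[of v]
  by (simp add: word_of_append)

lemma csize_comp_of: "w \<in> mono_words \<Longrightarrow> csize (comp_of w) = word_degree w"
  using comp_of_mono[of w] word_degree_word_of[of "comp_of w"] by simp

lemma comp_of_eq_iff: "u \<in> mono_words \<Longrightarrow> v \<in> mono_words \<Longrightarrow> comp_of u = comp_of v \<longleftrightarrow> u = v"
  using comp_of_mono by metis

text \<open>On words that are not monochromatic \<open>comp_of\<close> has an unspecified value; the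
  map is total for the sake of linearity, and its content lies in the restriction to
  \<open>MR\<close>.\<close>

definition MR_iso :: "'c::finite monoid \<Rightarrow> ('c, 'k::field) ncsf \<Rightarrow> ('c wr \<Rightarrow>\<^sub>0 'k)" where
  "MR_iso G = lin_extend (\<lambda>w. MR_B G (comp_of w))"

text \<open>Coordinates computed on the side of words, free of any unique-existence description;
  they replace \<open>MR_coords\<close> in what follows.\<close>

definition comp_coords :: "('c::finite, 'k::field) ncsf \<Rightarrow> ('c ccomp \<Rightarrow>\<^sub>0 'k)" where
  "comp_coords = lin_extend (\<lambda>w. single (comp_of w) 1)"

lemma lin_MR_iso [simp]: "lin (MR_iso G)"
  by (simp add: MR_iso_def)

lemma lin_MR_iso_comp: "lin f \<Longrightarrow> lin (\<lambda>x. MR_iso G (f x))"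
  by (rule lin_comp[OF lin_MR_iso])

lemma lin_comp_coords: "lin f \<Longrightarrow> lin (\<lambda>x. comp_coords (f x))"
  unfolding comp_coords_def by (rule lin_lin_extend_comp)

lemma MR_iso_word [simp]: "MR_iso G (single w 1) = MR_B G (comp_of w)"
  by (simp add: MR_iso_def)

lemma comp_coords_word [simp]: "comp_coords (single w 1) = single (comp_of w) 1"
  by (simp add: comp_coords_def)

lemma MR_iso_coords: "MR_iso G x = lin_extend (MR_B G) (comp_coords x)"
  by (rule lin_eqI) (auto intro!: lin_lin_extend_comp lin_comp_coords lin_ident)

lemma keys_comp_coords: "x \<in> MR \<Longrightarrow> keys (comp_coords x) \<subseteq> Collect pos_comp"
  unfolding comp_coords_def
  by (rule order_trans[OF keys_lin_extend]) (auto simp: MR_eq dest: comp_of_mono)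

lemma lookup_comp_coords:
  assumes x: "x \<in> MR" and w: "w \<in> mono_words"
  shows "lookup (comp_coords x) (comp_of w) = lookup x w"
proof -
  have "lookup (comp_coords x) (comp_of w) = (\<Sum>u\<in>keys x. if u = w then lookup x w else 0)"
    unfolding comp_coords_def lookup_lin_extend
    by (rule sum.cong)
      (use x w in \<open>auto simp: lookup_single when_def MR_eq comp_of_eq_iff subset_iff\<close>)
  then show ?thesis by (auto simp: in_keys_iff)
qed

lemma word_of_comp_coords: "x \<in> MR \<Longrightarrow> lin_extend (\<lambda>v. single (word_of v) 1) (comp_coords x) = x"
  by (rule lin_eqI_on) (auto intro!: lin_lin_extend_comp lin_comp_coords lin_ident simp: MR_eq comp_of_mono subset_iff)

context
  fixes G :: "'c::finite monoid"
  assumes carrier_UNIV: "carrier G = UNIV"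
begin

text \<open>Linear independence of the block sums makes the description in \<open>MR_coords\<close>
  single-valued. All operations defined through coordinates are transported along this
  equation.\<close>

lemma MR_coords_iso:
  assumes "(x :: ('c, 'k::field) ncsf) \<in> MR"
  shows "MR_coords G (MR_iso G x) = comp_coords x"
  unfolding MR_coords_def
proof (rule the_equality)
  show "keys (comp_coords x) \<subseteq> ccomps G \<and> MR_iso G x = lin_extend (MR_B G) (comp_coords x)"
    using keys_comp_coords[OF assms] MR_iso_coords[of G x] by (simp add: ccomps_eq[OF carrier_UNIV])
  fix p assume p: "keys p \<subseteq> ccomps G \<and> MR_iso G x = lin_extend (MR_B G) p"
  have "keys (p - comp_coords x) \<subseteq> keys p \<union> keys (comp_coords x)"
    by (auto simp: in_keys_iff lookup_minus)
  then have "keys (p - comp_coords x) \<subseteq> Collect pos_comp"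
    using p keys_comp_coords[OF assms] by (auto simp: ccomps_eq[OF carrier_UNIV])
  moreover have "lin_extend (MR_B G) (p - comp_coords x) = 0"
    using p MR_iso_coords[of G x] by (simp add: pmp.linear_diff[OF lin_lin_extend])
  ultimately have "p - comp_coords x = 0" by (rule MR_B_independent[OF carrier_UNIV])
  then show "p = comp_coords x" by simp
qed

lemma inj_on_MR_iso: "inj_on (MR_iso G) (MR :: ('c, 'k::field) ncsf set)"
  by (rule inj_onI) (metis MR_coords_iso word_of_comp_coords)

lemma image_MR_iso_span:
  assumes "A \<subseteq> mono_words"
  shows "MR_iso G ` (pm.span ((\<lambda>w. single w (1::'k::field)) ` A)) = pm.span (MR_B G ` comp_of ` A)"
  by (simp add: pmp.linear_span_image[symmetric] image_image)

lemma image_MR_iso: "MR_iso G ` (MR :: ('c, 'k::field) ncsf set) = MR_descent G"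
proof -
  have "comp_of ` mono_words = ccomps G"
    unfolding ccomps_eq[OF carrier_UNIV]
  proof
    show "comp_of ` mono_words \<subseteq> (Collect pos_comp :: 'c ccomp set)" using comp_of_mono by auto
    show "Collect pos_comp \<subseteq> comp_of ` (mono_words :: 'c nzvec word set)"
    proof
      fix v :: "'c ccomp" assume "v \<in> Collect pos_comp"
      then show "v \<in> comp_of ` mono_words"
        by (intro image_eqI[of _ _ "word_of v"]) (auto simp: word_of_mono)
    qed
  qed
  then show ?thesis
    using image_MR_iso_span[of mono_words, where ?'k = 'k]
    by (simp add: MR_span MR_descent_def)
qed

lemma image_MR_iso_deg:
  "MR_iso G ` ((MR :: ('c, 'k::field) ncsf set) \<inter> nc_homogeneous n) = MR_descent_deg G n"
proof -
  let ?A = "mono_words \<inter> {w. word_degree w = n}"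
  have "(MR :: ('c, 'k) ncsf set) \<inter> nc_homogeneous n = pm.span ((\<lambda>w. single w 1) ` ?A)"
    unfolding pm_span_singles by (auto simp: MR_eq nc_homogeneous_def)
  moreover have "comp_of ` ?A = {w \<in> ccomps G. csize w = n}"
  proof
    show "comp_of ` ?A \<subseteq> {w \<in> ccomps G. csize w = n}"
      unfolding ccomps_eq[OF carrier_UNIV] using comp_of_mono csize_comp_of by auto
    show "{w \<in> ccomps G. csize w = n} \<subseteq> comp_of ` ?A"
    proof
      fix v assume "v \<in> {w \<in> ccomps G. csize w = n}"
      then have v: "pos_comp v" "csize v = n" by (auto simp: ccomps_eq[OF carrier_UNIV])
      then show "v \<in> comp_of ` ?A"
        by (intro image_eqI[of _ _ "word_of v"]) (auto simp: word_of_mono word_degree_word_of)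
    qed
  qed
  ultimately show ?thesis
    using image_MR_iso_span[of ?A, where ?'k = 'k] by (simp add: MR_descent_deg_def)
qed

lemma MR_iso_mult:
  assumes "(x :: ('c, 'k::field) ncsf) \<in> MR" "y \<in> MR"
  shows "MR_iso G (x * y) = MR_outer G (MR_iso G x) (MR_iso G y)"
  unfolding MR_outer_def MR_coords_iso[OF assms(1)] MR_coords_iso[OF assms(2)]
proof (rule bilin_eqI[of "\<lambda>x y. MR_iso G (x * y)"
      "\<lambda>x y. lin_extend (\<lambda>v. lin_extend (\<lambda>w. MR_B G (v @ w)) (comp_coords y)) (comp_coords x)"])
  fix a b assume "a \<in> keys x" "b \<in> keys y"
  then have "a \<in> mono_words" "b \<in> mono_words" using assms by (auto simp: MR_eq)
  then show "MR_iso G (single a 1 * single b 1) =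
      lin_extend (\<lambda>v. lin_extend (\<lambda>w. MR_B G (v @ w)) (comp_coords (single b 1))) (comp_coords (single a 1))"
    by (simp add: mult_single comp_of_add)
qed (intro lin_MR_iso_comp lin_intros lin_comp_coords lin_lin_extend_param lin_MR_iso)+

text \<open>The case n = 0 serves the end terms of the coproduct of a generator, where a part of
  size 0 stands for the unit.\<close>

lemma MR_iso_nc_S: "MR_iso G (nc_S (mono_vec n i) :: ('c, 'k::field) ncsf) = MR_B G [(n, i)]"
proof (cases "n = 0")
  case True
  have "csize [(0, i)] = 0" "length (block_row [(0, i)]) = 0"
    using length_block_row[of "[(0, i)]"] by auto
  then have "(MR_B G [(0, i)] :: 'c wr \<Rightarrow>\<^sub>0 'k) = MR_B G []"
    unfolding MR_B_alt[OF carrier_UNIV] using length_block_row[of "[] :: 'c ccomp"]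
    by (simp add: fiber_colors_def restrict_def)
  then show ?thesis using True by (simp add: one_conv_single del: single_one)
next
  case False
  then have "(nc_S (mono_vec n i) :: ('c, 'k) ncsf) = single (word_of [(n, i)]) 1"
    by (simp add: nc_S_def word_of_def)
  then show ?thesis using False by simp
qed

lemma MR_iso_in: "(x :: ('c, 'k::field) ncsf) \<in> MR \<Longrightarrow> MR_iso G x \<in> MR_descent G"
  using image_MR_iso by blast

section \<open>Transport of tensors and of the coproduct\<close>

definition MR_iso2 :: "('c nzvec word \<times> 'c nzvec word \<Rightarrow>\<^sub>0 'k::field) \<Rightarrow> ('c wr \<times> 'c wr \<Rightarrow>\<^sub>0 'k)" where
  "MR_iso2 = bilin_extend (\<lambda>a b. tens (MR_iso G a) (MR_iso G b))"

lemma lin_MR_iso2: "lin f \<Longrightarrow> lin (\<lambda>x. MR_iso2 (f x))"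
  unfolding MR_iso2_def by (rule lin_bilin_extend_comp)

lemma MR_iso2_tens: "MR_iso2 (tens x y) = tens (MR_iso G x) (MR_iso G y)"
  unfolding MR_iso2_def by (rule bilin_extend_tens) (intro lin_tens_left lin_tens_right lin_MR_iso)+

lemma tensor_space_MR_keys:
  "(t :: 'c nzvec word \<times> 'c nzvec word \<Rightarrow>\<^sub>0 'k::field) \<in> tensor_space MR MR \<Longrightarrow> keys t \<subseteq> mono_words \<times> mono_words"
proof -
  assume t: "t \<in> tensor_space MR MR"
  have "tensor_space MR MR \<subseteq> pm.span ((\<lambda>b. single b (1::'k)) ` (mono_words \<times> mono_words :: ('c nzvec word \<times> 'c nzvec word) set))"
    unfolding tensor_space_def
  proof (rule pm.span_minimal, safe)
    fix x y :: "('c, 'k) ncsf" assume "x \<in> MR" "y \<in> MR"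
    then have "keys (tens x y) \<subseteq> mono_words \<times> mono_words"
      using keys_tens[of x y] by (auto simp: MR_eq)
    then show "tens x y \<in> pm.span ((\<lambda>b. single b 1) ` (mono_words \<times> mono_words))"
      by (simp add: pm_span_singles)
  qed
  then show ?thesis using t by (auto simp: pm_span_singles)
qed

lemma MR_iso2_in:
  "(t :: 'c nzvec word \<times> 'c nzvec word \<Rightarrow>\<^sub>0 'k::field) \<in> tensor_space MR MR \<Longrightarrow>
    MR_iso2 t \<in> tensor_space (MR_descent G) (MR_descent G)"
proof -
  assume t: "t \<in> tensor_space MR MR"
  have "MR_iso2 t = lin_extend (\<lambda>p. MR_iso2 (single p 1)) t"
    by (rule lin_eq_lin_extend) (rule lin_MR_iso2[OF lin_ident])
  also have "\<dots> \<in> tensor_space (MR_descent G) (MR_descent G)"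
    unfolding lin_extend_def
  proof (intro pm.subspace_sum pm.subspace_scale)
    fix p assume "p \<in> keys t"
    then obtain a b where "p = (a, b)" "a \<in> mono_words" "b \<in> mono_words"
      using tensor_space_MR_keys[OF t] by auto
    then show "MR_iso2 (single p 1) \<in> tensor_space (MR_descent G) (MR_descent G :: ('c wr \<Rightarrow>\<^sub>0 'k) set)"
      using MR_iso_in[OF single_in_MR[of a 1]] MR_iso_in[OF single_in_MR[of b 1]]
      by (auto simp: MR_iso2_def intro!: tens_in_tensor_space)
  qed (simp_all add: tensor_space_def)
  finally show ?thesis .
qed

lemma subspace_MR_descent [simp]: "pm.subspace (MR_descent G)"
  by (simp add: MR_descent_def)

text \<open>\<open>MR_outer\<close> is meaningful on \<open>MR_descent\<close> only, while
  \<open>tensor_lift_eq\<close> asks for a linear map on the ambient tensors. A linear left inverse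
  \<open>g\<close> of \<open>MR_iso\<close> on \<open>MR\<close>, defined everywhere, expresses the
  outer product as \<open>MR_iso G (g a * g c)\<close> and so supplies such a map.\<close>

lemma MR_iso_tensor_mult:
  fixes t u :: "'c nzvec word \<times> 'c nzvec word \<Rightarrow>\<^sub>0 'k::field"
  assumes t: "t \<in> tensor_space MR MR" and u: "u \<in> tensor_space MR MR"
  shows "tensor_mult (MR_descent G) (MR_outer G) (MR_iso2 t) (MR_iso2 u) = MR_iso2 (t * u)"
proof -
  obtain g :: "('c wr \<Rightarrow>\<^sub>0 'k) \<Rightarrow> ('c, 'k) ncsf" where g: "lin g" "\<And>x. x \<in> MR \<Longrightarrow> g (MR_iso G x) = x"
    using pmp.linear_exists_left_inverse_on[OF lin_MR_iso subspace_MR inj_on_MR_iso] by blast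
  have g_in: "g a \<in> MR \<and> MR_iso G (g a) = a" if "a \<in> MR_descent G" for a
    using that g(2) unfolding image_MR_iso[symmetric] by auto
  define g2 where "g2 = bilin_extend (\<lambda>a b. tens (g a) (g b))"
  have lin_g2: "lin (\<lambda>x. g2 (f x))" if "lin f" for f :: "('c wr \<times> 'c wr \<Rightarrow>\<^sub>0 'k) \<Rightarrow> _"
    unfolding g2_def by (rule lin_bilin_extend_comp[OF that])
  have lin_g2': "lin (\<lambda>x. g2 (MR_iso2 x))"
    unfolding g2_def by (intro lin_bilin_extend_comp lin_MR_iso2 lin_ident)
  have g2_tens: "g2 (tens a b) = tens (g a) (g b)" for a b
    unfolding g2_def by (rule bilin_extend_tens) (intro lin_tens_left lin_tens_right g(1))+
  have g2_iso: "g2 (MR_iso2 s) = s" if s: "s \<in> tensor_space MR MR" for s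
  proof (rule lin_eqI_on[OF lin_g2' lin_ident])
    fix p assume "p \<in> keys s"
    then obtain a b where "p = (a, b)" "a \<in> mono_words" "b \<in> mono_words"
      using tensor_space_MR_keys[OF s] by auto
    then show "g2 (MR_iso2 (single p 1)) = single p 1"
      using g(2)[OF single_in_MR[of a 1]] g(2)[OF single_in_MR[of b 1]]
      by (simp add: MR_iso2_def g2_tens)
  qed
  have outer: "MR_outer G a c = MR_iso G (g a * g c)" if "a \<in> MR_descent G" "c \<in> MR_descent G" for a c
    using MR_iso_mult[of "g a" "g c"] g_in[OF that(1)] g_in[OF that(2)] by simp
  have inner: "tensor_lift (MR_descent G) (MR_descent G) (\<lambda>c d. tens (MR_outer G a c) (MR_outer G b d)) s
      = MR_iso2 (tens (g a) (g b) * g2 s)"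
    if s: "s \<in> tensor_space (MR_descent G) (MR_descent G)" and ab: "a \<in> MR_descent G" "b \<in> MR_descent G" for a b s
  proof (rule tensor_lift_eq[OF s subspace_MR_descent])
    show "lin (\<lambda>s. MR_iso2 (tens (g a) (g b) * g2 s))"
      by (intro lin_MR_iso2 lin_mult_right lin_g2 lin_ident)
  qed (simp add: g2_tens tens_mult MR_iso2_tens outer ab)
  have "tensor_mult (MR_descent G) (MR_outer G) (MR_iso2 t) (MR_iso2 u) = MR_iso2 (g2 (MR_iso2 t) * g2 (MR_iso2 u))"
    unfolding tensor_mult_def
  proof (rule tensor_lift_eq[OF MR_iso2_in[OF t] subspace_MR_descent])
    show "lin (\<lambda>s. MR_iso2 (g2 s * g2 (MR_iso2 u)))"
      by (intro lin_MR_iso2 lin_mult_left lin_g2 lin_ident)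
  qed (simp add: g2_tens inner MR_iso2_in[OF u])
  then show ?thesis by (simp add: g2_iso t u)
qed

text \<open>\<open>MR_comult_B\<close> multiplies the coproducts of the parts as
  \<open>nc_comult\<close> multiplies those of the letters, so the induction removes one part at a
  time.\<close>

lemma MR_comult_B_iso:
  "pos_comp v \<Longrightarrow> MR_comult_B G v = MR_iso2 (nc_comult (single (word_of v) (1::'k::field)))"
proof (induction v)
  case Nil
  have "MR_iso G (1 :: ('c, 'k) ncsf) = MR_B G []"
    by (simp add: one_conv_single del: single_one)
  then show ?case by (simp add: nc_comult_one MR_iso2_tens flip: tens_one)
next
  case (Cons x v)
  obtain n i where x: "x = (n, i)" by force
  have n: "n \<ge> 1" and v: "pos_comp v" using Cons.prems by (auto simp: x)
  have letter: "(single (word_of [x]) 1 :: ('c, 'k) ncsf) = nc_S (mono_vec n i)"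
    using n by (simp add: x nc_S_def word_of_def)
  have "(single (word_of (x # v)) 1 :: ('c, 'k) ncsf) = single (word_of [x]) 1 * single (word_of v) 1"
    using word_of_append[of "[x]" v] by (simp add: mult_single)
  then have comult: "nc_comult (single (word_of (x # v)) 1) =
      nc_comult_S (mono_vec n i) * nc_comult (single (word_of v) (1::'k))"
    by (simp add: nc_comult_mult letter nc_comult_nc_S)
  have "MR_iso2 (nc_comult_S (mono_vec n i)) =
      (\<Sum>p\<le>n. tens (MR_B G [(p, i)]) (MR_B G [(n - p, i)] :: 'c wr \<Rightarrow>\<^sub>0 'k))"
    by (simp add: nc_comult_S_mono lin_sum[OF lin_MR_iso2[OF lin_ident]] MR_iso2_tens MR_iso_nc_S)
  moreover have "(nc_comult_S (mono_vec n i) :: _ \<Rightarrow>\<^sub>0 'k) \<in> tensor_space MR MR"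
    using nc_comult_MR[OF nc_S_mono_in_MR[of n i, where ?'k = 'k]] by (simp add: nc_comult_nc_S)
  moreover have "nc_comult (single (word_of v) (1::'k)) \<in> tensor_space MR MR"
    by (intro nc_comult_MR single_in_MR word_of_mono v)
  ultimately show ?case
    using MR_iso_tensor_mult[of "nc_comult_S (mono_vec n i)" "nc_comult (single (word_of v) (1::'k))"]
    by (simp add: Cons.IH[OF v] comult) (simp add: x)
qed

lemma hopf_iso_MR_iso: "hopf_iso MR_hopf (MR_descent_hopf G) (MR_iso G :: ('c, 'k::field) ncsf \<Rightarrow> _)"
proof -
  have "bij_betw (MR_iso G) (MR :: ('c, 'k) ncsf set) (MR_descent G)"
    unfolding bij_betw_def using inj_on_MR_iso image_MR_iso by blast
  moreover have "MR_iso G (1 :: ('c, 'k) ncsf) = MR_B G []"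
    by (simp add: one_conv_single del: single_one)
  moreover have "lin_extend (MR_comult_B G) (comp_coords x) =
      tensor_lift MR MR (\<lambda>a b. tens (MR_iso G a) (MR_iso G b)) (nc_comult x)"
    if x: "x \<in> MR" for x :: "('c, 'k) ncsf"
  proof -
    have "lin_extend (MR_comult_B G) (comp_coords x) = MR_iso2 (nc_comult x)"
    proof (rule lin_eqI_on[of "\<lambda>x. lin_extend (MR_comult_B G) (comp_coords x)" "\<lambda>x. MR_iso2 (nc_comult x)"])
      fix w assume "w \<in> keys x"
      then have "w \<in> mono_words" using x by (auto simp: MR_eq)
      then show "lin_extend (MR_comult_B G) (comp_coords (single w (1::'k))) = MR_iso2 (nc_comult (single w 1))"
        using MR_comult_B_iso[of "comp_of w", where ?'k = 'k] comp_of_mono[of w] by simp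
    qed (intro lin_lin_extend_comp lin_comp_coords lin_MR_iso2 lin_nc_comult lin_ident)+
    also have "\<dots> = tensor_lift MR MR (\<lambda>a b. tens (MR_iso G a) (MR_iso G b)) (nc_comult x)"
      by (rule tensor_lift_eq[symmetric])
        (use nc_comult_MR[OF x] in \<open>auto intro!: lin_MR_iso2 lin_ident simp: MR_iso2_tens\<close>)
    finally show ?thesis .
  qed
  ultimately show ?thesis
    unfolding hopf_iso_def MR_hopf_def MR_descent_hopf_def NCSF_def
    by (auto simp: Let_def lin_imp_linear_on MR_iso_mult MR_coords_iso
        lookup_comp_coords[OF _ mono_words_0, simplified])
qed

section \<open>Compatibility with the internal products\<close>

lemma lin_internal_prod_left: "lin f \<Longrightarrow> lin (\<lambda>x. internal_prod G (f x) y)"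
  unfolding internal_prod_def by (rule lin_lin_extend_comp)

lemma lin_internal_prod_right: "lin f \<Longrightarrow> lin (\<lambda>y. internal_prod G x (f y))"
  unfolding internal_prod_def by (rule lin_lin_extend_param) (rule lin_lin_extend_comp)

lemma internal_prod_MR:
  assumes "(x :: ('c, 'k::field) ncsf) \<in> MR" "y \<in> MR"
  shows "internal_prod G x y \<in> MR"
  unfolding internal_prod_def lin_extend_def
proof (intro pm.subspace_sum pm.subspace_scale subspace_MR)
  fix a b assume "a \<in> keys x" "b \<in> keys y"
  then have "a \<in> mono_words" "b \<in> mono_words" using assms by (auto simp: MR_eq)
  then obtain v w where "pos_comp v" "a = word_of v" "pos_comp w" "b = word_of w"
    by (elim mono_word_conv)
  then show "(internal_basis G a b :: ('c, 'k) ncsf) \<in> MR"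
    by (auto simp: internal_basis_mono intro!: pm.subspace_sum single_in_MR word_of_mono pos_comp_matrix_comp)
qed

lemma MR_iso_internal:
  assumes comm: "\<And>a b. a \<otimes>\<^bsub>G\<^esub> b = b \<otimes>\<^bsub>G\<^esub> a"
    and "(x :: ('c, 'k::field) ncsf) \<in> MR" "y \<in> MR"
  shows "MR_iso G (internal_prod G x y) = MR_internal G (MR_iso G x) (MR_iso G y)"
proof (rule bilin_eqI[of "\<lambda>x y. MR_iso G (internal_prod G x y)" "\<lambda>x y. MR_internal G (MR_iso G x) (MR_iso G y)"])
  fix a b assume "a \<in> keys x" "b \<in> keys y"
  then have "a \<in> mono_words" "b \<in> mono_words" using assms(2,3) by (auto simp: MR_eq)
  then obtain v w where "pos_comp v" "a = word_of v" "pos_comp w" "b = word_of w"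
    by (elim mono_word_conv)
  \<comment> \<open>Both products of basis elements are sums over the same matrix words.\<close>
  then show "MR_iso G (internal_prod G (single a 1) (single b 1)) =
      MR_internal G (MR_iso G (single a 1)) (MR_iso G (single b (1::'k)))"
    by (simp add: internal_prod_def internal_basis_mono lin_sum[OF lin_MR_iso] pos_comp_matrix_comp
        MR_internal_MR_B[OF carrier_UNIV comm])
qed (unfold MR_internal_def, (intro lin_MR_iso_comp lin_internal_prod_left lin_internal_prod_right
      lin_group_alg_mult_left lin_group_alg_mult_right lin_MR_iso lin_ident)+)

end

text \<open>Commutativity travels along the isomorphism from the integers modulo n.\<close>

lemma iso_integer_mod_group_comm:
  assumes "group G" "carrier G = UNIV" "G \<cong> integer_mod_group n"
  shows "a \<otimes>\<^bsub>G\<^esub> b = b \<otimes>\<^bsub>G\<^esub> a"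
proof -
  have "integer_mod_group n \<cong> G"
    using assms(1,3) group.iso_sym by blast
  then have "comm_group G"
    using comm_group.iso_imp_comm_group[OF abelian_integer_mod_group] assms(1) group.is_monoid by blast
  then show ?thesis
    using assms(2) comm_monoid.m_comm[of G a b] by (simp add: comm_group_def)
qed

theorem proposition6p1:
  shows "hopf_subalgebra (MR :: ('c::finite, 'k::field) ncsf set) NCSF
    \<and> (\<forall>G :: 'c monoid. group G \<and> carrier G = UNIV \<and> G \<cong> integer_mod_group CARD('c) \<longrightarrow>
          (\<forall>x\<in>MR. \<forall>y\<in>MR. internal_prod G x y \<in> (MR :: ('c, 'k) ncsf set))
        \<and> (\<exists>f :: ('c, 'k) ncsf \<Rightarrow> ('c wr \<Rightarrow>\<^sub>0 'k).
              hopf_iso MR_hopf (MR_descent_hopf G) f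
            \<and> (\<forall>x\<in>MR. \<forall>y\<in>MR. f (internal_prod G x y) = MR_internal G (f x) (f y))
            \<and> (\<forall>n. f ` (MR \<inter> nc_homogeneous n) = MR_descent_deg G n)))"
proof (intro conjI allI impI)
  show "hopf_subalgebra (MR :: ('c, 'k) ncsf set) NCSF" by (rule hopf_subalgebra_MR)
next
  fix G :: "'c monoid"
  assume G: "group G \<and> carrier G = UNIV \<and> G \<cong> integer_mod_group CARD('c)"
  then have carrier: "carrier G = UNIV" by simp
  have comm: "a \<otimes>\<^bsub>G\<^esub> b = b \<otimes>\<^bsub>G\<^esub> a" for a b
    by (rule iso_integer_mod_group_comm[of G "CARD('c)"]) (use G in auto)
  show "\<forall>x\<in>MR. \<forall>y\<in>MR. internal_prod G x y \<in> (MR :: ('c, 'k) ncsf set)"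
    using internal_prod_MR[OF carrier] by blast
  show "\<exists>f :: ('c, 'k) ncsf \<Rightarrow> ('c wr \<Rightarrow>\<^sub>0 'k).
              hopf_iso MR_hopf (MR_descent_hopf G) f
            \<and> (\<forall>x\<in>MR. \<forall>y\<in>MR. f (internal_prod G x y) = MR_internal G (f x) (f y))
            \<and> (\<forall>n. f ` (MR \<inter> nc_homogeneous n) = MR_descent_deg G n)"
    using hopf_iso_MR_iso[OF carrier] MR_iso_internal[OF carrier comm] image_MR_iso_deg[OF carrier]
    by (intro exI[of _ "MR_iso G"] conjI ballI allI) simp_all
qed

end
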